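(* Let $n \ge 3$ and $u_+=0$. Then, for any $\rho_+>0$ and $\theta_+>0$, there exist positive constants $\epsilon_0$ and $C$ satisfying the following: (I) Let $u_->0$. If $|u_-|+|\rho_--\rho_+|+|\theta_--\theta_+| \le \epsilon_0$, there exists a unique smooth solution $(\rho,u,\theta)$ of the stationary problem below (with the inflow boundary condition $(\rho,u,\theta)(r_0)=(\rho_-,u_-,\theta_-)$) satisfying $$|\rho(r)-\rho_+|,\ |\theta(r)-\theta_+|\le Cr^{-(n-2)}(|u_-|+|\rho_--\rho_+|+|\theta_--\theta_+|),$$ $$C^{-1}r^{-(n-1)}|u_-| \le |u(r)| \le Cr^{-(n-1)}|u_-|, \qquad r\ge r_0.$$ (II) Let $u_-< 0$. If $|u_-|+|\theta_--\theta_+|\le \epsilon_0$, there exists a unique smooth solution $(\rho, u, \theta)$ of the stationary problem below (with the outflow boundary condition $(u,\theta)(r_0)=(u_-,\theta_-)$) satisfying $$|\rho(r)-\rho_+|,\ |\theta(r)-\theta_+|\le Cr^{-(n-2)}(|u_-|+|\theta_--\theta_+|),$$ $$C^{-1}r^{-(n-1)}|u_-| \le |u(r)|\le Cr^{-(n-1)}|u_-|, \qquad r\ge r_0.$$ Here the stationary problem is: for $r\ge r_0$, $$\frac{(r^{n-1}\rho u)_r}{r^{n-1}}=0,\qquad \frac{(r^{n-1}\rho u^2)_r}{r^{n-1}}+ p_r =\mu \Big(\frac{(r^{n-1}u)_r}{r^{n-1}}\Big)_r,$$ $$\frac{\{r^{n-1}\rho u (e + \tfrac{1}{2}u^2)\}_r}{r^{n-1}}+\frac{(r^{n-1}pu)_r}{r^{n-1}}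 = \kappa\frac{(r^{n-1}\theta_r)_r}{r^{n-1}} +\mu \Big(\frac{(r^{n-1}u)_r}{r^{n-1}}\Big)_r u +\Psi,$$ $$\lim_{r\to \infty} (\rho, u, \theta)(r) =(\rho_+, u_+, \theta_+),$$ $$(\rho, u, \theta)(r_0)=(\rho_-, u_-, \theta_-)\ (u_->0),\qquad (u, \theta)(r_0)=(u_-, \theta_-)\ (u_- \le 0),$$ with $p= R\rho\theta$, $e=c_V \theta$, $\Psi = 2\nu u_r^2 +2\nu(n-1)(u/r)^2+\lambda(u_r+\tfrac{n-1}{r}u)^2$.
   Context: Radially symmetric stationary solutions $(\rho(r),u(r),\theta(r))$, $r=|x|$, of the compressible Navier–Stokes equations for a viscous heat-conductive polytropic ideal gas in the exterior domain $\{x\in\mathbb{R}^n: |x|>r_0\}$ ($r_0>0$), with velocity field $U=\frac{x}{r}u(r)$, density $\rho>0$, absolute temperature $\theta>0$. Constants $c_V>0$, $R>0$ (specific heat at constant volume and gas constant), viscosity coefficients $\nu,\lambda$ and heat conductivity $\kappa$ are constants with $\nu>0$, $2\nu+n\lambda\ge 0$, $\kappa>0$, and $\mu:=2\nu+\lambda>0$. $\rho_\pm>0$, $u_\pm$, $\theta_\pm$ are given constants; $u_->0$ is the inflow problem, $u_-<0$ the outflow problem. *)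

theory Defs
  imports "HOL-Analysis.Analysis"
begin

definition C_infty_on :: "real set \<Rightarrow> (real \<Rightarrow> real) \<Rightarrow> bool" where
  "C_infty_on S f \<longleftrightarrow>
     (\<exists>D :: nat \<Rightarrow> real \<Rightarrow> real. (\<forall>x\<in>S. D 0 x = f x) \<and>
        (\<forall>k. \<forall>x\<in>S. (D k has_real_derivative D (Suc k) x) (at x within S)))"

definition dr :: "real \<Rightarrow> (real \<Rightarrow> real) \<Rightarrow> real \<Rightarrow> real" where
  "dr r0 f r = vector_derivative f (at r within {r0..})"

definition stationary_sol ::
  "nat \<Rightarrow> real \<Rightarrow> real \<Rightarrow> real \<Rightarrow> real \<Rightarrow> real \<Rightarrow> real \<Rightarrow> real \<Rightarrow> real \<Rightarrow> real \<Rightarrow>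
   (real \<Rightarrow> real) \<Rightarrow> (real \<Rightarrow> real) \<Rightarrow> (real \<Rightarrow> real) \<Rightarrow> bool" where
  "stationary_sol n r0 cV R nu lam kappa rho_p u_p theta_p rho u theta \<longleftrightarrow>
     (let mu = 2 * nu + lam;
          p = (\<lambda>s. R * rho s * theta s);
          e = (\<lambda>s. cV * theta s);
          Psi = (\<lambda>s. 2 * nu * (dr r0 u s)^2 + 2 * nu * (real n - 1) * (u s / s)^2
                      + lam * (dr r0 u s + (real n - 1) / s * u s)^2);
          divu = (\<lambda>s. dr r0 (\<lambda>t. t^(n-1) * u t) s / s^(n-1))
      in C_infty_on {r0..} rho \<and> C_infty_on {r0..} u \<and> C_infty_on {r0..} theta \<and>
         (\<forall>r\<ge>r0. rho r > 0 \<and> theta r > 0) \<and>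
         (\<forall>r\<ge>r0.
            dr r0 (\<lambda>s. s^(n-1) * rho s * u s) r / r^(n-1) = 0 \<and>
            dr r0 (\<lambda>s. s^(n-1) * rho s * (u s)^2) r / r^(n-1) + dr r0 p r
              = mu * dr r0 divu r \<and>
            dr r0 (\<lambda>s. s^(n-1) * rho s * u s * (e s + (u s)^2 / 2)) r / r^(n-1)
              + dr r0 (\<lambda>s. s^(n-1) * p s * u s) r / r^(n-1)
              = kappa * dr r0 (\<lambda>s. s^(n-1) * dr r0 theta s) r / r^(n-1)
                + mu * dr r0 divu r * u r + Psi r) \<and>
         (rho \<longlongrightarrow> rho_p) at_top \<and> (u \<longlongrightarrow> u_p) at_top \<and> (theta \<longlongrightarrow> theta_p) at_top)"

end

theory Submission
  imports Defs
begin

text \<open>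
  Write \<open>v = 1 / \<rho>\<close> and let \<open>M = r ^ (n - 1) \<rho> u\<close> be the constant mass flux. The momentum equation and the equation
  of total energy integrate once; the integration constant of the former vanishes because \<open>v\<close> converges, and in the
  latter the pressure work \<open>p v = R \<theta>\<close> combines with the momentum flux. What remains is a first-order system: a
  relaxation equation \<open>v' = - (\<beta> r ^ (n - 1) / M) (v - v\<^sub>+ - g)\<close>, singularly perturbed as \<open>M\<close> tends to \<open>0\<close>, and
  a heat equation \<open>\<kappa> r ^ (n - 1) \<theta>' = H - E\<close> with \<open>H = O(M)\<close> and a free constant \<open>E\<close>.

  Comparison with \<open>r ^ - (n - 2)\<close> bounds the solutions of the relaxation equation by their forcing, uniformly in
  \<open>M\<close>: for \<open>M > 0\<close> it is stable and takes an initial value, for \<open>M < 0\<close> it has exactly one bounded solution. The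
  constant \<open>E\<close> fits the boundary temperature. In the norm weighted by \<open>r ^ (n - 2)\<close> the resulting solution map is
  a contraction for small data, also when \<open>M\<close> is determined by the boundary value of \<open>v\<close>, and every stationary
  solution in the class is a fixed point.
\<close>

section \<open>Calculus on a half line\<close>

abbreviation deriv_from :: "real \<Rightarrow> (real \<Rightarrow> real) \<Rightarrow> (real \<Rightarrow> real) \<Rightarrow> bool" where
  "deriv_from a f f' \<equiv> \<forall>r\<ge>a. (f has_real_derivative f' r) (at r within {a..})"

lemma has_real_derivative_cong_atLeast:
  fixes f g :: "real \<Rightarrow> real"
  assumes "(f has_real_derivative D) (at r within {a..})" "\<And>s. a \<le> s \<Longrightarrow> f s = g s" "a \<le> r"
  shows "(g has_real_derivative D) (at r within {a..})"
  by (rule has_field_derivative_transform_within[OF assms(1), of 1]) (use assms in auto)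

lemma deriv_from_cong:
  assumes "deriv_from a f f'" "\<And>r. a \<le> r \<Longrightarrow> f r = g r" "\<And>r. a \<le> r \<Longrightarrow> f' r = g' r"
  shows "deriv_from a g g'"
  using assms by (auto intro: has_real_derivative_cong_atLeast[of f _ _ a g])

lemma deriv_from_continuous_on: "deriv_from a f f' \<Longrightarrow> continuous_on {a..} f"
  by (rule DERIV_continuous_on) auto

lemma deriv_from_add: "deriv_from a f f' \<Longrightarrow> deriv_from a g g' \<Longrightarrow> deriv_from a (\<lambda>r. f r + g r) (\<lambda>r. f' r + g' r)"
  by (simp add: DERIV_add)

lemma deriv_from_diff: "deriv_from a f f' \<Longrightarrow> deriv_from a g g' \<Longrightarrow> deriv_from a (\<lambda>r. f r - g r) (\<lambda>r. f' r - g' r)"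
  by (simp add: DERIV_diff)

lemma deriv_from_cmult: "deriv_from a f f' \<Longrightarrow> deriv_from a (\<lambda>r. c * f r) (\<lambda>r. c * f' r)"
  by (simp add: DERIV_cmult)

lemma deriv_from_const_add_iff: "deriv_from a (\<lambda>r. c + f r) f' \<longleftrightarrow> deriv_from a f f'"
  using deriv_from_add[of a "\<lambda>r. c" "\<lambda>r. 0" f f'] deriv_from_add[of a "\<lambda>r. - c" "\<lambda>r. 0" "\<lambda>r. c + f r" f']
  by auto

lemma deriv_from_inverse_power:
  assumes "0 < a"
  shows "deriv_from a (\<lambda>r. 1 / r ^ j) (\<lambda>r. - real j / r ^ Suc j)"
proof (intro allI impI)
  fix r assume "a \<le> r"
  then have r: "0 < r" using assms by simp
  then have "((\<lambda>s. 1 / s ^ j) has_real_derivative - (real j * r ^ (j - 1)) / (r ^ j * r ^ j)) (at r within {a..})"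
    by (auto intro!: derivative_eq_intros)
  moreover have "(real j * r ^ (j - 1)) / (r ^ j * r ^ j) = real j / r ^ Suc j"
    using r by (cases j) (auto simp: field_simps)
  ultimately show "((\<lambda>s. 1 / s ^ j) has_real_derivative - real j / r ^ Suc j) (at r within {a..})" by simp
qed

lemma constant_if_deriv_zero:
  assumes "deriv_from a f (\<lambda>r. 0)" "a \<le> r"
  shows "f r = f a"
  using has_field_derivative_zero_constant[of "{a..}" f] assms by fastforce

lemma nondecreasing_if_deriv_nonneg:
  assumes deriv: "deriv_from a f f'" and nonneg: "\<And>r. a \<le> r \<Longrightarrow> 0 \<le> f' r" and "a \<le> x" "x \<le> y"
  shows "f x \<le> f y"
proof (rule DERIV_nonneg_imp_increasing_open[OF \<open>x \<le> y\<close>])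
  fix z assume z: "x < z" "z < y"
  have "at z within {a..} = at z"
    using z \<open>a \<le> x\<close> by (intro at_within_interior) (auto simp: interior_real_atLeast)
  then show "\<exists>l. (f has_real_derivative l) (at z) \<and> 0 \<le> l"
    using deriv nonneg[of z] z \<open>a \<le> x\<close> by (metis less_imp_le order_trans)
next
  show "continuous_on {x..y} f"
    using \<open>a \<le> x\<close> by (intro continuous_on_subset[OF deriv_from_continuous_on[OF deriv]]) auto
qed

lemma nonneg_if_deriv_nonpos_tendsto_0:
  assumes deriv: "deriv_from a f f'" and nonpos: "\<And>r. a \<le> r \<Longrightarrow> f' r \<le> 0"
    and lim: "(f \<longlongrightarrow> 0) at_top" and "a \<le> x"
  shows "0 \<le> f x"
proof -
  have "deriv_from a (\<lambda>r. - f r) (\<lambda>r. - f' r)" using deriv by (simp add: DERIV_minus)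
  then have "f y \<le> f x" if "x \<le> y" for y
    using nondecreasing_if_deriv_nonneg[of a "\<lambda>r. - f r" "\<lambda>r. - f' r" x y] nonpos that \<open>a \<le> x\<close> by simp
  then have "\<forall>\<^sub>F y in at_top. f y \<le> f x"
    unfolding eventually_at_top_linorder by blast
  then show ?thesis
    by (rule tendsto_upperbound[OF lim]) simp
qed

lemma abs_le_if_deriv_dominated:
  assumes F: "deriv_from a F f" "(F \<longlongrightarrow> 0) at_top"
    and W: "deriv_from a W W'" "(W \<longlongrightarrow> 0) at_top"
    and dominated: "\<And>r. a \<le> r \<Longrightarrow> \<bar>f r\<bar> \<le> - W' r" and "a \<le> x"
  shows "\<bar>F x\<bar> \<le> W x"
proof -
  have "0 \<le> W x - s * F x" if s: "\<bar>s\<bar> = 1" for s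
  proof (rule nonneg_if_deriv_nonpos_tendsto_0[OF _ _ _ \<open>a \<le> x\<close>])
    show "deriv_from a (\<lambda>r. W r - s * F r) (\<lambda>r. W' r - s * f r)"
      by (intro deriv_from_diff deriv_from_cmult W F)
    show "W' r - s * f r \<le> 0" if "a \<le> r" for r
      using dominated[OF that] abs_ge_minus_self[of "s * f r"] by (simp add: abs_mult s)
    show "((\<lambda>r. W r - s * F r) \<longlongrightarrow> 0) at_top"
      using tendsto_diff[OF W(2) tendsto_mult[OF tendsto_const[of s] F(2)]] by simp
  qed
  from this[of 1] this[of "-1"] show ?thesis by simp
qed

lemma eq_if_same_deriv_tendsto_0:
  assumes "deriv_from a F f" "(F \<longlongrightarrow> 0) at_top" "deriv_from a G f" "(G \<longlongrightarrow> 0) at_top" "a \<le> x"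
  shows "F x = G x"
proof -
  have "\<bar>F x - G x\<bar> \<le> 0"
  proof (rule abs_le_if_deriv_dominated[where W = "\<lambda>r. 0" and W' = "\<lambda>r. 0", OF _ _ _ _ _ \<open>a \<le> x\<close>])
    show "deriv_from a (\<lambda>r. F r - G r) (\<lambda>r. 0)"
      using deriv_from_diff[OF assms(1,3)] by simp
    show "((\<lambda>r. F r - G r) \<longlongrightarrow> 0) at_top"
      using tendsto_diff[OF assms(2,4)] by simp
  qed auto
  then show ?thesis by simp
qed

lemma deriv_over_power_tendsto_imp_0:
  fixes f :: "real \<Rightarrow> real"
  assumes f: "deriv_from a f f'" "(f \<longlongrightarrow> L) at_top" and f': "((\<lambda>r. f' r / r ^ Suc k) \<longlongrightarrow> l) at_top"
  shows "l = 0"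
proof -
  define g where "g r = 1 / (k + 2) * r ^ (k + 2)" for r :: real
  have g: "filterlim g at_top at_top"
    unfolding g_def
    by (intro filterlim_tendsto_pos_mult_at_top[OF tendsto_const] filterlim_pow_at_top filterlim_ident) auto
  have "((\<lambda>r. f r / g r) \<longlongrightarrow> l) at_top"
  proof (rule lhospital_at_top_at_top[OF g _ _ _ f'])
    show "\<forall>\<^sub>F r in at_top. r ^ Suc k \<noteq> (0::real)"
      by (rule eventually_mono[OF eventually_gt_at_top[of 0]]) simp
    show "\<forall>\<^sub>F r in at_top. (f has_real_derivative f' r) (at r)"
    proof (rule eventually_mono[OF eventually_gt_at_top[of a]])
      fix r assume "a < r"
      then have "at r within {a..} = at r"
        by (intro at_within_interior) (simp add: interior_real_atLeast)
      then show "(f has_real_derivative f' r) (at r)" using f(1) \<open>a < r\<close> by (metis less_imp_le)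
    qed
    have "(g has_real_derivative r ^ Suc k) (at r)" for r
      unfolding g_def by (rule derivative_eq_intros refl | simp)+
    then show "\<forall>\<^sub>F r in at_top. (g has_real_derivative r ^ Suc k) (at r)" by simp
  qed
  moreover have "((\<lambda>r. f r / g r) \<longlongrightarrow> 0) at_top"
    by (rule real_tendsto_divide_at_top[OF f(2) g])
  ultimately show ?thesis by (intro tendsto_unique[of at_top]) auto
qed

lemma deriv_from_integral:
  fixes f :: "real \<Rightarrow> real"
  assumes "continuous_on {a..} f"
  shows "deriv_from a (\<lambda>x. integral {a..x} f) f"
proof (intro allI impI)
  fix r assume r: "a \<le> r"
  have "((\<lambda>x. integral {a..x} f) has_real_derivative f r) (at r within {a..r+1})"
    using assms r by (intro integral_has_real_derivative) (auto intro: continuous_on_subset)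
  moreover have "at r within {a..r+1} = at r within {a..}"
    by (rule at_within_nhd[of _ "{..<r+1}"]) auto
  ultimately show "((\<lambda>x. integral {a..x} f) has_real_derivative f r) (at r within {a..})" by simp
qed

lemma convergent_if_deriv_dominated:
  assumes F: "deriv_from a F f" and W: "deriv_from a W W'" "(W \<longlongrightarrow> 0) at_top"
    and dominated: "\<And>r. a \<le> r \<Longrightarrow> \<bar>f r\<bar> \<le> - W' r"
  obtains L where "(F \<longlongrightarrow> L) at_top"
proof -
  define h where "h r = F (max a r) - W (max a r)" for r
  have "mono h"
  proof
    fix x y :: real assume "x \<le> y"
    then show "h x \<le> h y"
      unfolding h_def using dominated
      by (intro nondecreasing_if_deriv_nonneg[OF deriv_from_diff[OF F W(1)]]) fastforce+
  qed
  moreover have "h x \<le> F a + W a" for x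
  proof -
    have "- (F a + W a) \<le> - (F (max a x) + W (max a x))"
      using dominated
      by (intro nondecreasing_if_deriv_nonneg[of a "\<lambda>r. - (F r + W r)" "\<lambda>r. - (f r + W' r)"])
        (use F W(1) in \<open>fastforce intro: DERIV_minus DERIV_add\<close>)+
    moreover have "0 \<le> W (max a x)"
      using dominated by (intro nonneg_if_deriv_nonpos_tendsto_0[OF W(1) _ W(2)]) fastforce+
    ultimately show ?thesis by (simp add: h_def)
  qed
  ultimately obtain L where "(\<lambda>n. h (real n)) \<longlonglongrightarrow> L"
    using incseq_convergent[of "\<lambda>n. h (real n)" "F a + W a"] by (metis incseq_def monoD of_nat_mono)
  then have "((\<lambda>r. h r + W r) \<longlongrightarrow> L + 0) at_top"
    by (intro tendsto_add tendsto_at_topI_sequentially_real \<open>mono h\<close> W(2))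
  moreover have "\<forall>\<^sub>F r in at_top. h r + W r = F r"
    by (rule eventually_mono[OF eventually_ge_at_top[of a]]) (simp add: h_def max_def)
  ultimately have "(F \<longlongrightarrow> L) at_top" by (simp add: tendsto_cong)
  then show ?thesis by (rule that)
qed

definition tail_integral :: "(real \<Rightarrow> real) \<Rightarrow> real \<Rightarrow> real" where
  "tail_integral f r = Lim at_top (\<lambda>x. integral {r..x} f)"

lemma tail_integral_dominated:
  assumes cont: "continuous_on {a..} f" and W: "deriv_from a W W'" "(W \<longlongrightarrow> 0) at_top"
    and dominated: "\<And>r. a \<le> r \<Longrightarrow> \<bar>f r\<bar> \<le> - W' r"
  shows "deriv_from a (tail_integral f) (\<lambda>r. - f r)" "(tail_integral f \<longlongrightarrow> 0) at_top"
proof -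
  define G where "G x = integral {a..x} f" for x
  have G: "deriv_from a G f" unfolding G_def by (rule deriv_from_integral[OF cont])
  obtain L where L: "(G \<longlongrightarrow> L) at_top" by (rule convergent_if_deriv_dominated[OF G W dominated])
  have eq: "L - G r = tail_integral f r" if "a \<le> r" for r
  proof -
    have "G x - G r = integral {r..x} f" if "r \<le> x" for x
      unfolding G_def using cont \<open>a \<le> r\<close> that
        Henstock_Kurzweil_Integration.integral_combine[of a r x f, symmetric]
      by (simp add: integrable_continuous_real continuous_on_subset)
    then have "\<forall>\<^sub>F x in at_top. G x - G r = integral {r..x} f"
      unfolding eventually_at_top_linorder by blast
    moreover have "((\<lambda>x. G x - G r) \<longlongrightarrow> L - G r) at_top" by (intro tendsto_intros L)
    ultimately show ?thesis
      unfolding tail_integral_def by (simp add: tendsto_Lim tendsto_cong)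
  qed
  show "deriv_from a (tail_integral f) (\<lambda>r. - f r)"
    using deriv_from_diff[of a "\<lambda>r. L" "\<lambda>r. 0", OF _ G] by (rule deriv_from_cong) (auto simp: eq)
  have "((\<lambda>r. L - G r) \<longlongrightarrow> L - L) at_top" by (intro tendsto_intros L)
  moreover have "\<forall>\<^sub>F r in at_top. L - G r = tail_integral f r"
    by (rule eventually_mono[OF eventually_ge_at_top[of a]]) (rule eq)
  ultimately show "(tail_integral f \<longlongrightarrow> 0) at_top" by (simp add: tendsto_cong)
qed

section \<open>Functions with power decay\<close>

definition decaying :: "nat \<Rightarrow> real \<Rightarrow> real \<Rightarrow> (real \<Rightarrow> 'a::real_normed_vector) \<Rightarrow> bool" where
  "decaying k a A f \<longleftrightarrow> continuous_on {a..} f \<and> (\<forall>r\<ge>a. norm (f r) \<le> A / r ^ k)"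

lemma decayingI:
  "continuous_on {a..} f \<Longrightarrow> (\<And>r. a \<le> r \<Longrightarrow> norm (f r) \<le> A / r ^ k) \<Longrightarrow> decaying k a A f"
  by (simp add: decaying_def)

lemma decaying_continuous_on: "decaying k a A f \<Longrightarrow> continuous_on {a..} f"
  by (simp add: decaying_def)

lemma decaying_norm_le: "decaying k a A f \<Longrightarrow> a \<le> r \<Longrightarrow> norm (f r) \<le> A / r ^ k"
  by (simp add: decaying_def)

lemma decaying_const_nonneg:
  assumes "decaying k a A f" "0 < a"
  shows "0 \<le> A"
proof -
  have "0 \<le> A / a ^ k" using decaying_norm_le[OF assms(1), of a] norm_ge_zero order_trans by blast
  then show ?thesis using assms(2) by (metis divide_neg_pos not_le zero_less_power)
qed

lemma decaying_mono:
  assumes "decaying k a A f" "A \<le> B" "0 < a"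
  shows "decaying k a B f"
proof (rule decayingI[OF decaying_continuous_on[OF assms(1)]])
  fix r assume r: "a \<le> r"
  have "A / r ^ k \<le> B / r ^ k" using assms r by (intro divide_right_mono) auto
  then show "norm (f r) \<le> B / r ^ k" using decaying_norm_le[OF assms(1) r] by linarith
qed

lemma decaying_weaken:
  assumes f: "decaying (i + j) a A f" and a: "0 < a"
  shows "decaying i a (A / a ^ j) f"
proof (rule decayingI[OF decaying_continuous_on[OF f]])
  fix r assume r: "a \<le> r"
  have "norm (f r) \<le> A / (r ^ i * r ^ j)" using decaying_norm_le[OF f r] by (simp add: power_add)
  also have "\<dots> \<le> A / (r ^ i * a ^ j)"
    using decaying_const_nonneg[OF f a] a r by (intro divide_left_mono mult_left_mono power_mono mult_pos_pos) auto
  finally show "norm (f r) \<le> A / a ^ j / r ^ i" by (simp add: mult.commute)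
qed

lemma decaying_cong:
  assumes "decaying k a A f" "\<And>r. a \<le> r \<Longrightarrow> f r = g r"
  shows "decaying k a A g"
  using assms continuous_on_cong[of "{a..}" "{a..}" f g] by (simp add: decaying_def)

lemma decaying_add:
  assumes "decaying k a A f" "decaying k a B g"
  shows "decaying k a (A + B) (\<lambda>r. f r + g r)"
proof (rule decayingI)
  show "norm (f r + g r) \<le> (A + B) / r ^ k" if "a \<le> r" for r
    unfolding add_divide_distrib
    by (intro norm_triangle_mono decaying_norm_le[OF assms(1) that] decaying_norm_le[OF assms(2) that])
qed (intro continuous_intros assms[THEN decaying_continuous_on])

lemma decaying_mult:
  fixes f g :: "real \<Rightarrow> 'a::real_normed_algebra"
  assumes "decaying i a A f" "decaying j a B g"
  shows "decaying (i + j) a (A * B) (\<lambda>r. f r * g r)"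
proof (rule decayingI)
  fix r assume r: "a \<le> r"
  have le: "norm (f r) \<le> A / r ^ i" "norm (g r) \<le> B / r ^ j"
    using assms r by (auto simp: decaying_def)
  have "norm (f r * g r) \<le> norm (f r) * norm (g r)" by (rule norm_mult_ineq)
  also have "\<dots> \<le> (A / r ^ i) * (B / r ^ j)"
    using le order_trans[OF norm_ge_zero le(1)] by (intro mult_mono) auto
  finally show "norm (f r * g r) \<le> A * B / r ^ (i + j)" by (simp add: power_add)
qed (intro continuous_intros assms[THEN decaying_continuous_on])

lemma decaying_const: "decaying 0 a (norm c) (\<lambda>r. c)"
  by (simp add: decaying_def)

lemma decaying_cmult:
  fixes f :: "real \<Rightarrow> real"
  assumes "decaying k a A f"
  shows "decaying k a (\<bar>c\<bar> * A) (\<lambda>r. c * f r)"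
  using decaying_mult[OF decaying_const[of a c] assms] by simp

lemma decaying_zero: "0 < a \<Longrightarrow> 0 \<le> A \<Longrightarrow> decaying k a A (\<lambda>r. 0)"
  by (simp add: decaying_def)

lemma decaying_weaken_0:
  assumes "decaying k a A f" "0 < a"
  shows "decaying 0 a (A / a ^ k) f"
  using decaying_weaken[of 0 k a A f] assms by simp

lemma decaying_mult_diff:
  fixes f g f' g' :: "real \<Rightarrow> real"
  assumes "decaying i a A f" "decaying j a B g'" "decaying i a X (\<lambda>r. f r - f' r)" "decaying j a Y (\<lambda>r. g r - g' r)"
  shows "decaying (i + j) a (A * Y + X * B) (\<lambda>r. f r * g r - f' r * g' r)"
  using decaying_add[OF decaying_mult[OF assms(1,4)] decaying_mult[OF assms(3,2)]]
  by (rule decaying_cong) (simp add: algebra_simps)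

lemma decaying_minus: "decaying k a A f \<Longrightarrow> decaying k a A (\<lambda>r. - f r)"
  by (auto simp: decaying_def intro: continuous_intros)

lemma decaying_diff:
  "decaying k a A f \<Longrightarrow> decaying k a B g \<Longrightarrow> decaying k a (A + B) (\<lambda>r. f r - g r)"
  using decaying_add[OF _ decaying_minus, of k a A f B g] by simp

lemma decaying_inverse_power: "0 < a \<Longrightarrow> decaying k a 1 (\<lambda>r. 1 / r ^ k :: real)"
  by (intro decayingI continuous_intros) auto

lemma norm_fst_le_norm: "norm (fst z) \<le> norm z" and norm_snd_le_norm: "norm (snd z) \<le> norm z"
  by (metis norm_fst_le prod.collapse) (metis norm_snd_le prod.collapse)

lemma decaying_fst: "decaying k a A f \<Longrightarrow> decaying k a A (\<lambda>r. fst (f r))"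
  and decaying_snd: "decaying k a A f \<Longrightarrow> decaying k a A (\<lambda>r. snd (f r))"
  for f :: "real \<Rightarrow> 'a::real_normed_vector \<times> 'b::real_normed_vector"
  by (auto simp: decaying_def intro: continuous_intros
      order_trans[OF norm_fst_le_norm] order_trans[OF norm_snd_le_norm])

lemma decaying_Pair:
  assumes "decaying k a A (\<lambda>r. fst (f r))" "decaying k a B (\<lambda>r. snd (f r))"
  shows "decaying k a (A + B) f"
proof (rule decayingI)
  show "continuous_on {a..} f"
    using continuous_on_Pair[OF assms[THEN decaying_continuous_on]] by simp
  show "norm (f r) \<le> (A + B) / r ^ k" if "a \<le> r" for r
    using norm_Pair_le[of "fst (f r)" "snd (f r)"] assms[THEN decaying_norm_le, OF that]
    by (simp add: add_divide_distrib)
qed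

lemma tendsto_inverse_power_at_top:
  assumes "0 < k"
  shows "((\<lambda>r::real. c / r ^ k) \<longlongrightarrow> 0) at_top"
  using assms by (intro real_tendsto_divide_at_top[OF tendsto_const] filterlim_pow_at_top filterlim_ident)

lemma decaying_tendsto_0:
  assumes "decaying k a A f" "0 < k"
  shows "(f \<longlongrightarrow> 0) at_top"
proof (rule Lim_null_comparison[OF _ tendsto_inverse_power_at_top[OF \<open>0 < k\<close>, of A]])
  show "\<forall>\<^sub>F r in at_top. norm (f r) \<le> A / r ^ k"
    by (rule eventually_mono[OF eventually_ge_at_top[of a]]) (rule decaying_norm_le[OF assms(1)])
qed

lemma tail_integral_decaying:
  assumes f: "decaying (Suc k) a A f" and pos: "0 < a" "0 < k"
  shows "deriv_from a (tail_integral f) (\<lambda>r. - f r)" "(tail_integral f \<longlongrightarrow> 0) at_top"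
    "decaying k a (A / k) (tail_integral f)"
proof -
  let ?W = "\<lambda>r. A / k * (1 / r ^ k)" and ?W' = "\<lambda>r. A / k * (- real k / r ^ Suc k)"
  have W: "deriv_from a ?W ?W'"
    by (intro deriv_from_cmult deriv_from_inverse_power pos)
  have W_lim: "(?W \<longlongrightarrow> 0) at_top"
    using tendsto_inverse_power_at_top[OF pos(2), of "A / k"] by simp
  have f_le: "\<bar>f r\<bar> \<le> - ?W' r" if "a \<le> r" for r
    using decaying_norm_le[OF f that] pos(2) by simp
  note tail = tail_integral_dominated[OF decaying_continuous_on[OF f] W W_lim f_le]
  show "deriv_from a (tail_integral f) (\<lambda>r. - f r)" by (rule tail(1))
  show "(tail_integral f \<longlongrightarrow> 0) at_top" by (rule tail(2))
  show "decaying k a (A / k) (tail_integral f)"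
  proof (rule decayingI[OF deriv_from_continuous_on[OF tail(1)]])
    show "norm (tail_integral f r) \<le> A / k / r ^ k" if "a \<le> r" for r
      using abs_le_if_deriv_dominated[OF tail W W_lim _ that] f_le by simp
  qed
qed

lemma tail_integral_diff:
  assumes f: "decaying (Suc k) a A f" and g: "decaying (Suc k) a B g" and pos: "0 < a" "0 < k" and r: "a \<le> r"
  shows "tail_integral (\<lambda>r. f r - g r) r = tail_integral f r - tail_integral g r"
proof (rule eq_if_same_deriv_tendsto_0[OF _ _ _ _ r])
  note tails = tail_integral_decaying[OF f pos] tail_integral_decaying[OF g pos]
    tail_integral_decaying[OF decaying_diff[OF f g] pos]
  show "deriv_from a (tail_integral (\<lambda>r. f r - g r)) (\<lambda>r. - (f r - g r))"
    "(tail_integral (\<lambda>r. f r - g r) \<longlongrightarrow> 0) at_top" by (fact tails)+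
  show "deriv_from a (\<lambda>r. tail_integral f r - tail_integral g r) (\<lambda>r. - (f r - g r))"
    using deriv_from_diff[OF tails(1,4)] by (rule deriv_from_cong) simp_all
  show "((\<lambda>r. tail_integral f r - tail_integral g r) \<longlongrightarrow> 0) at_top"
    using tendsto_diff[OF tails(2,5)] by simp
qed

section \<open>Heat conduction and relaxation\<close>

definition heat_solution :: "real \<Rightarrow> nat \<Rightarrow> (real \<Rightarrow> real) \<Rightarrow> real \<Rightarrow> real \<Rightarrow> real" where
  "heat_solution \<kappa> k H E r = E / (\<kappa> * k) * (1 / r ^ k) - tail_integral (\<lambda>s. H s / (\<kappa> * s ^ Suc k)) r"

lemma heat_solution:
  assumes H: "decaying 0 a A H" and pos: "0 < a" "0 < k" "0 < \<kappa>"
  shows "deriv_from a (heat_solution \<kappa> k H E) (\<lambda>r. (H r - E) / (\<kappa> * r ^ Suc k))"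
    "(heat_solution \<kappa> k H E \<longlongrightarrow> 0) at_top"
    "decaying k a (\<bar>E\<bar> / (\<kappa> * k) + A / (\<kappa> * k)) (heat_solution \<kappa> k H E)"
proof -
  have "decaying (0 + Suc k) a (\<bar>1 / \<kappa>\<bar> * (A * 1)) (\<lambda>r. 1 / \<kappa> * (H r * (1 / r ^ Suc k)))"
    by (intro decaying_cmult decaying_mult H decaying_inverse_power pos)
  then have "decaying (Suc k) a (A / \<kappa>) (\<lambda>r. H r / (\<kappa> * r ^ Suc k))" using pos by simp
  note tail = tail_integral_decaying[OF this pos(1,2)]
  show "deriv_from a (heat_solution \<kappa> k H E) (\<lambda>r. (H r - E) / (\<kappa> * r ^ Suc k))"
    using deriv_from_diff[OF deriv_from_cmult[OF deriv_from_inverse_power[OF pos(1), of k],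
        where c = "E / (\<kappa> * k)"] tail(1)]
    by (rule deriv_from_cong) (use pos in \<open>auto simp: heat_solution_def diff_divide_distrib\<close>)
  have "decaying k a (\<bar>E / (\<kappa> * k)\<bar> * 1 + A / \<kappa> / k)
      (\<lambda>r. E / (\<kappa> * k) * (1 / r ^ k) - tail_integral (\<lambda>s. H s / (\<kappa> * s ^ Suc k)) r)"
    by (intro decaying_diff decaying_cmult decaying_inverse_power tail(3) pos)
  then show decay: "decaying k a (\<bar>E\<bar> / (\<kappa> * k) + A / (\<kappa> * k)) (heat_solution \<kappa> k H E)"
    using pos by (simp add: heat_solution_def[abs_def])
  show "(heat_solution \<kappa> k H E \<longlongrightarrow> 0) at_top"
    by (rule decaying_tendsto_0[OF decay pos(2)])
qed

lemma heat_solution_at_boundary: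
  assumes H: "decaying 0 a A H" and pos: "0 < a" "0 < k" "0 < \<kappa>"
  shows "\<bar>E\<bar> / (\<kappa> * k) \<le> a ^ k * \<bar>heat_solution \<kappa> k H E a\<bar> + A / (\<kappa> * k)"
proof -
  have "\<bar>heat_solution \<kappa> k H 0 a\<bar> \<le> A / (\<kappa> * k) / a ^ k"
    using decaying_norm_le[OF heat_solution(3)[OF H pos, of 0], of a] by simp
  then have "a ^ k * \<bar>heat_solution \<kappa> k H 0 a\<bar> \<le> A / (\<kappa> * k)"
    using pos by (simp add: pos_le_divide_eq mult_ac)
  moreover have "a ^ k * heat_solution \<kappa> k H E a - a ^ k * heat_solution \<kappa> k H 0 a = E / (\<kappa> * k)"
    using pos by (simp add: heat_solution_def right_diff_distrib)
  then have "\<bar>E / (\<kappa> * k)\<bar> \<le> \<bar>a ^ k * heat_solution \<kappa> k H E a\<bar> + \<bar>a ^ k * heat_solution \<kappa> k H 0 a\<bar>"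
    by (metis abs_triangle_ineq4)
  ultimately show ?thesis using pos by (simp add: abs_mult)
qed

lemma heat_equation_decaying:
  assumes H: "decaying 0 a A H" and pos: "0 < a" "0 < k" "0 < \<kappa>"
    and Q: "deriv_from a Q (\<lambda>r. (H r - E) / (\<kappa> * r ^ Suc k))" "(Q \<longlongrightarrow> 0) at_top"
  shows "decaying k a (a ^ k * \<bar>Q a\<bar> + 2 * A / (\<kappa> * k)) Q"
proof -
  have Q_eq: "heat_solution \<kappa> k H E r = Q r" if "a \<le> r" for r
    using eq_if_same_deriv_tendsto_0[OF heat_solution(1,2)[OF H pos] Q that] .
  then have "\<bar>E\<bar> / (\<kappa> * k) + A / (\<kappa> * k) \<le> a ^ k * \<bar>Q a\<bar> + 2 * A / (\<kappa> * k)"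
    using heat_solution_at_boundary[OF H pos, of E] by simp
  with heat_solution(3)[OF H pos] have "decaying k a (a ^ k * \<bar>Q a\<bar> + 2 * A / (\<kappa> * k)) (heat_solution \<kappa> k H E)"
    using pos(1) by (rule decaying_mono)
  then show ?thesis by (rule decaying_cong) (rule Q_eq)
qed

lemma heat_equation_exists:
  assumes H: "decaying 0 a A H" and pos: "0 < a" "0 < k" "0 < \<kappa>"
  obtains Q E where "Q a = q0" "deriv_from a Q (\<lambda>r. (H r - E) / (\<kappa> * r ^ Suc k))" "(Q \<longlongrightarrow> 0) at_top"
proof -
  define E where "E = \<kappa> * k * (a ^ k * (q0 - heat_solution \<kappa> k H 0 a))"
  have "heat_solution \<kappa> k H E a = q0" using pos by (simp add: E_def heat_solution_def)
  then show ?thesis using that heat_solution(1,2)[OF H pos] by blast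
qed

lemma deriv_from_exp_mult_defect:
  assumes "deriv_from a \<Omega> \<omega>" "deriv_from a y (\<lambda>r. - \<omega> r * (y r - g r))" "deriv_from a W W'"
  shows "deriv_from a (\<lambda>r. exp (\<Omega> r) * (W r - s * y r)) (\<lambda>r. exp (\<Omega> r) * (W' r + \<omega> r * (W r - s * g r)))"
proof (intro allI impI)
  fix r assume "a \<le> r"
  with assms have d: "(\<Omega> has_real_derivative \<omega> r) (at r within {a..})"
    "(W has_real_derivative W' r) (at r within {a..})"
    "(y has_real_derivative - \<omega> r * (y r - g r)) (at r within {a..})" by auto
  show "((\<lambda>r. exp (\<Omega> r) * (W r - s * y r)) has_real_derivative
      exp (\<Omega> r) * (W' r + \<omega> r * (W r - s * g r))) (at r within {a..})"
    by (rule derivative_eq_intros d refl)+ (simp add: algebra_simps)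
qed

lemma abs_le_supersolution_stable:
  assumes \<Omega>: "deriv_from a \<Omega> \<omega>" and \<omega>: "\<And>r. a \<le> r \<Longrightarrow> 0 \<le> \<omega> r"
    and y: "deriv_from a y (\<lambda>r. - \<omega> r * (y r - g r))"
    and W: "deriv_from a W W'" "\<And>r. a \<le> r \<Longrightarrow> 0 \<le> W' r + \<omega> r * (W r - \<bar>g r\<bar>)"
    and init: "\<bar>y a\<bar> \<le> W a" and x: "a \<le> x"
  shows "\<bar>y x\<bar> \<le> W x"
proof -
  have "s * y x \<le> W x" if s: "\<bar>s\<bar> = 1" for s
  proof -
    have "exp (\<Omega> a) * (W a - s * y a) \<le> exp (\<Omega> x) * (W x - s * y x)"
    proof (rule nondecreasing_if_deriv_nonneg[OF deriv_from_exp_mult_defect[OF \<Omega> y W(1)] _ order_refl x])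
      fix r assume r: "a \<le> r"
      have "s * g r \<le> \<bar>g r\<bar>" using abs_ge_self[of "s * g r"] by (simp add: abs_mult s)
      then have "\<omega> r * (W r - \<bar>g r\<bar>) \<le> \<omega> r * (W r - s * g r)" using \<omega>[OF r] by (intro mult_left_mono) auto
      then have "0 \<le> W' r + \<omega> r * (W r - s * g r)" using W(2)[OF r] by linarith
      then show "0 \<le> exp (\<Omega> r) * (W' r + \<omega> r * (W r - s * g r))" by simp
    qed
    moreover have "s * y a \<le> W a" using init abs_ge_self[of "s * y a"] by (simp add: abs_mult s)
    then have "0 \<le> exp (\<Omega> a) * (W a - s * y a)" by simp
    ultimately have "0 \<le> exp (\<Omega> x) * (W x - s * y x)" by linarith
    then show ?thesis by (simp add: zero_le_mult_iff)
  qed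
  from this[of 1] this[of "-1"] show ?thesis by simp
qed

lemma abs_le_supersolution_unstable:
  assumes \<Omega>: "deriv_from a \<Omega> \<omega>" and \<omega>: "\<And>r. a \<le> r \<Longrightarrow> \<omega> r \<le> 0"
    and y: "deriv_from a y (\<lambda>r. - \<omega> r * (y r - g r))"
    and W: "deriv_from a W W'" "\<And>r. a \<le> r \<Longrightarrow> W' r + \<omega> r * (W r - \<bar>g r\<bar>) \<le> 0"
    and lim: "((\<lambda>r. exp (\<Omega> r) * W r) \<longlongrightarrow> 0) at_top" "((\<lambda>r. exp (\<Omega> r) * y r) \<longlongrightarrow> 0) at_top"
    and x: "a \<le> x"
  shows "\<bar>y x\<bar> \<le> W x"
proof -
  have "s * y x \<le> W x" if s: "\<bar>s\<bar> = 1" for s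
  proof -
    have "0 \<le> exp (\<Omega> x) * (W x - s * y x)"
    proof (rule nonneg_if_deriv_nonpos_tendsto_0[OF deriv_from_exp_mult_defect[OF \<Omega> y W(1)] _ _ x])
      fix r assume r: "a \<le> r"
      have "s * g r \<le> \<bar>g r\<bar>" using abs_ge_self[of "s * g r"] by (simp add: abs_mult s)
      then have "\<omega> r * (W r - s * g r) \<le> \<omega> r * (W r - \<bar>g r\<bar>)"
        using \<omega>[OF r] by (intro mult_left_mono_neg) auto
      then have "W' r + \<omega> r * (W r - s * g r) \<le> 0" using W(2)[OF r] by linarith
      then show "exp (\<Omega> r) * (W' r + \<omega> r * (W r - s * g r)) \<le> 0" by (simp add: mult_nonneg_nonpos)
    next
      have "((\<lambda>r. exp (\<Omega> r) * W r - s * (exp (\<Omega> r) * y r)) \<longlongrightarrow> 0 - s * 0) at_top"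
        by (intro tendsto_intros lim)
      then show "((\<lambda>r. exp (\<Omega> r) * (W r - s * y r)) \<longlongrightarrow> 0) at_top" by (simp add: algebra_simps)
    qed
    then show ?thesis by (simp add: zero_le_mult_iff)
  qed
  from this[of 1] this[of "-1"] show ?thesis by simp
qed

lemma variation_of_constants:
  assumes "deriv_from a \<Omega> \<omega>" "deriv_from a Y (\<lambda>r. \<omega> r * exp (\<Omega> r) * g r)"
  shows "deriv_from a (\<lambda>r. exp (- \<Omega> r) * Y r) (\<lambda>r. - \<omega> r * (exp (- \<Omega> r) * Y r - g r))"
proof (intro allI impI)
  fix r assume "a \<le> r"
  with assms have d: "(\<Omega> has_real_derivative \<omega> r) (at r within {a..})"
    "(Y has_real_derivative \<omega> r * exp (\<Omega> r) * g r) (at r within {a..})" by auto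
  show "((\<lambda>r. exp (- \<Omega> r) * Y r) has_real_derivative - \<omega> r * (exp (- \<Omega> r) * Y r - g r)) (at r within {a..})"
    by (rule derivative_eq_intros d refl)+ (simp add: algebra_simps flip: exp_add)
qed

lemma linear_initial_value_problem_exists:
  assumes \<Omega>: "deriv_from a \<Omega> \<omega>" and cont: "continuous_on {a..} \<omega>" "continuous_on {a..} g"
  obtains y where "deriv_from a y (\<lambda>r. - \<omega> r * (y r - g r))" "y a = y0"
proof -
  define Y where "Y x = integral {a..x} (\<lambda>r. \<omega> r * exp (\<Omega> r) * g r) + exp (\<Omega> a) * y0" for x
  have "deriv_from a Y (\<lambda>r. \<omega> r * exp (\<Omega> r) * g r + 0)"
    unfolding Y_def
    by (intro deriv_from_add deriv_from_integral continuous_intros cont deriv_from_continuous_on[OF \<Omega>]) auto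
  moreover have "exp (- \<Omega> a) * Y a = y0" by (simp add: Y_def flip: exp_add mult.assoc)
  ultimately show ?thesis using that[of "\<lambda>r. exp (- \<Omega> r) * Y r"] variation_of_constants[OF \<Omega>] by simp
qed

lemma linear_bounded_solution_exists:
  assumes \<Omega>: "deriv_from a \<Omega> \<omega>" "((\<lambda>r. exp (\<Omega> r)) \<longlongrightarrow> 0) at_top"
    and \<omega>: "continuous_on {a..} \<omega>" "\<And>r. a \<le> r \<Longrightarrow> \<omega> r \<le> 0"
    and g: "continuous_on {a..} g" "\<And>r. a \<le> r \<Longrightarrow> \<bar>g r\<bar> \<le> B"
  obtains y where "deriv_from a y (\<lambda>r. - \<omega> r * (y r - g r))" "\<And>r. a \<le> r \<Longrightarrow> \<bar>y r\<bar> \<le> B"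
proof -
  let ?f = "\<lambda>r. - (\<omega> r * exp (\<Omega> r) * g r)"
  have f_cont: "continuous_on {a..} ?f"
    by (intro continuous_intros \<omega> g deriv_from_continuous_on[OF \<Omega>(1)])
  have W: "deriv_from a (\<lambda>r. B * exp (\<Omega> r)) (\<lambda>r. B * (exp (\<Omega> r) * \<omega> r))"
    using \<Omega>(1) by (intro deriv_from_cmult) (auto intro!: derivative_eq_intros)
  have W_lim: "((\<lambda>r. B * exp (\<Omega> r)) \<longlongrightarrow> 0) at_top"
    using tendsto_mult[OF tendsto_const[of B] \<Omega>(2)] by simp
  have f_le: "\<bar>?f r\<bar> \<le> - (B * (exp (\<Omega> r) * \<omega> r))" if "a \<le> r" for r
  proof -
    have "(- \<omega> r * exp (\<Omega> r)) * \<bar>g r\<bar> \<le> (- \<omega> r * exp (\<Omega> r)) * B"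
      using \<omega>(2) g(2) that by (intro mult_left_mono) (auto simp: mult_nonpos_nonneg)
    then show ?thesis using \<omega>(2)[OF that] by (simp add: abs_mult mult_ac)
  qed
  note tail = tail_integral_dominated[OF f_cont W W_lim f_le]
  have "deriv_from a (tail_integral ?f) (\<lambda>r. \<omega> r * exp (\<Omega> r) * g r)" using tail(1) by simp
  note y = variation_of_constants[OF \<Omega>(1) this]
  have "\<bar>exp (- \<Omega> r) * tail_integral ?f r\<bar> \<le> B" if "a \<le> r" for r
  proof -
    have "\<bar>tail_integral ?f r\<bar> \<le> B * exp (\<Omega> r)"
      using f_le by (intro abs_le_if_deriv_dominated[OF tail W W_lim _ that]) auto
    then show ?thesis by (simp add: abs_mult exp_minus field_simps)
  qed
  with y show ?thesis by (rule that)
qed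

lemma tendsto_exp_power_0:
  assumes "\<gamma> < 0" "0 < j"
  shows "((\<lambda>r::real. exp (\<gamma> * r ^ j)) \<longlongrightarrow> 0) at_top"
proof -
  have "filterlim (\<lambda>r::real. r ^ j) at_top at_top"
    using assms by (intro filterlim_pow_at_top filterlim_ident) auto
  then have "filterlim (\<lambda>r::real. \<gamma> * r ^ j) at_bot at_top"
    using assms by (intro filterlim_tendsto_neg_mult_at_bot[OF tendsto_const]) auto
  then show ?thesis
    by (rule filterlim_compose[OF exp_at_bot])
qed

lemma tendsto_0_mult_bounded:
  fixes f g :: "real \<Rightarrow> real"
  assumes "(f \<longlongrightarrow> 0) at_top" "decaying 0 a B g"
  shows "((\<lambda>r. f r * g r) \<longlongrightarrow> 0) at_top"
proof (rule tendsto_0_le[OF assms(1)])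
  show "\<forall>\<^sub>F r in at_top. norm (f r * g r) \<le> norm (f r) * B"
    by (rule eventually_mono[OF eventually_ge_at_top[of a]])
      (use decaying_norm_le[OF assms(2)] in \<open>simp add: abs_mult mult_left_mono\<close>)
qed

lemma deriv_from_relaxation_exponent:
  "deriv_from a (\<lambda>r. \<beta> / (M * (real k + 2)) * r ^ (k + 2)) (\<lambda>r. \<beta> * r ^ Suc k / M)"
proof -
  have "deriv_from a (\<lambda>r. \<gamma> * r ^ (k + 2)) (\<lambda>r. \<gamma> * (real k + 2) * r ^ Suc k)" for \<gamma>
    by (intro allI impI) (rule derivative_eq_intros refl | simp)+
  from this[of "\<beta> / (M * (real k + 2))"] show ?thesis by simp
qed

lemma relaxation_integrating_factor_tendsto_0:
  "0 < \<beta> \<Longrightarrow> M < 0 \<Longrightarrow> ((\<lambda>r. exp (\<beta> / (M * (real k + 2)) * r ^ (k + 2))) \<longlongrightarrow> 0) at_top"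
  by (intro tendsto_exp_power_0) (auto simp: divide_pos_neg mult_neg_pos)

lemma inverse_power_supersolution:
  assumes pos: "0 < a" "0 < \<beta>" "0 < M" and small: "2 * real k * M \<le> \<beta> * a ^ (k + 2)"
    and A: "0 \<le> A" "\<bar>g\<bar> \<le> A / r ^ k" and r: "a \<le> r"
  shows "0 \<le> 2 * A * (- real k / r ^ Suc k) + \<beta> * r ^ Suc k / M * (2 * A * (1 / r ^ k) - \<bar>g\<bar>)"
proof -
  have "\<beta> * a ^ (k + 2) \<le> \<beta> * r ^ (k + 2)" using r pos by (intro mult_left_mono power_mono) auto
  then have "2 * real k * M \<le> \<beta> * r ^ (k + 2)" using small by linarith
  then have "2 * real k \<le> \<beta> * r ^ (k + 2) / M" using pos by (simp only: pos_le_divide_eq)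
  then have "2 * real k / r ^ Suc k \<le> \<beta> * r ^ (k + 2) / M / r ^ Suc k"
    using r pos by (intro divide_right_mono) auto
  also have "\<dots> = \<beta> * r ^ Suc k / M * (1 / r ^ k)" using r pos by simp
  finally have "2 * real k / r ^ Suc k \<le> \<beta> * r ^ Suc k / M * (1 / r ^ k)" .
  then have "A * (2 * real k / r ^ Suc k) \<le> A * (\<beta> * r ^ Suc k / M * (1 / r ^ k))"
    by (rule mult_left_mono[OF _ A(1)])
  also have "\<dots> = \<beta> * r ^ Suc k / M * (2 * A * (1 / r ^ k) - A / r ^ k)"
    by (simp add: algebra_simps)
  also have "\<dots> \<le> \<beta> * r ^ Suc k / M * (2 * A * (1 / r ^ k) - \<bar>g\<bar>)"
    using A(2) pos r by (intro mult_left_mono) auto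
  finally show ?thesis by (simp add: algebra_simps)
qed

lemma relaxation_decaying_stable:
  assumes pos: "0 < a" "0 < \<beta>" "0 < M" and small: "2 * real k * M \<le> \<beta> * a ^ (k + 2)"
    and g: "decaying k a A g" and y: "deriv_from a y (\<lambda>r. - (\<beta> * r ^ Suc k / M) * (y r - g r))"
    and init: "\<bar>y a\<bar> \<le> 2 * A / a ^ k"
  shows "decaying k a (2 * A) y"
proof (rule decayingI[OF deriv_from_continuous_on[OF y]])
  fix x assume x: "a \<le> x"
  have W: "deriv_from a (\<lambda>r. 2 * A * (1 / r ^ k)) (\<lambda>r. 2 * A * (- real k / r ^ Suc k))"
    by (intro deriv_from_cmult deriv_from_inverse_power pos)
  have "\<bar>y x\<bar> \<le> 2 * A * (1 / x ^ k)"
  proof (rule abs_le_supersolution_stable[OF deriv_from_relaxation_exponent _ y W _ _ x])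
    show "0 \<le> 2 * A * (- real k / r ^ Suc k) + \<beta> * r ^ Suc k / M * (2 * A * (1 / r ^ k) - \<bar>g r\<bar>)"
      if "a \<le> r" for r
      using decaying_norm_le[OF g that]
      by (intro inverse_power_supersolution[where a = a] pos small decaying_const_nonneg[OF g] that) simp
  qed (use pos init in auto)
  then show "norm (y x) \<le> 2 * A / x ^ k" by simp
qed

lemma relaxation_decaying_unstable:
  assumes pos: "0 < a" "0 < \<beta>" and M: "M < 0" and g: "decaying k a A g"
    and y: "deriv_from a y (\<lambda>r. - (\<beta> * r ^ Suc k / M) * (y r - g r))" and bounded: "decaying 0 a B y"
  shows "decaying k a A y"
proof (rule decayingI[OF deriv_from_continuous_on[OF y]])
  fix x assume x: "a \<le> x"
  have A: "0 \<le> A" by (rule decaying_const_nonneg[OF g pos(1)])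
  have rate: "\<beta> * r ^ Suc k / M \<le> 0" if "a \<le> r" for r
    using that pos M by (simp add: divide_nonneg_neg)
  have W: "deriv_from a (\<lambda>r. A * (1 / r ^ k)) (\<lambda>r. A * (- real k / r ^ Suc k))"
    by (intro deriv_from_cmult deriv_from_inverse_power pos)
  have "decaying (0 + k) a (\<bar>A\<bar> * 1) (\<lambda>r. A * (1 / r ^ k))"
    by (simp only: add_0) (intro decaying_cmult decaying_inverse_power pos)
  note W_bounded = decaying_weaken[OF this pos(1)]
  have "\<bar>y x\<bar> \<le> A * (1 / x ^ k)"
  proof (rule abs_le_supersolution_unstable[OF deriv_from_relaxation_exponent rate y W _
        tendsto_0_mult_bounded[OF _ W_bounded] tendsto_0_mult_bounded[OF _ bounded] x])
    fix r assume r: "a \<le> r"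
    have "\<beta> * r ^ Suc k / M * (A * (1 / r ^ k) - \<bar>g r\<bar>) \<le> 0"
      using rate[OF r] decaying_norm_le[OF g r] by (intro mult_nonpos_nonneg) auto
    moreover have "A * (- real k / r ^ Suc k) \<le> 0" using A pos r by (simp add: mult_nonneg_nonpos)
    ultimately show "A * (- real k / r ^ Suc k) + \<beta> * r ^ Suc k / M * (A * (1 / r ^ k) - \<bar>g r\<bar>) \<le> 0"
      by linarith
  qed (rule relaxation_integrating_factor_tendsto_0[OF pos(2) M] | assumption)+
  then show "norm (y x) \<le> A / x ^ k" by simp
qed

lemma relaxation_decaying:
  assumes pos: "0 < a" "0 < \<beta>" "M \<noteq> 0" and small: "2 * real k * M \<le> \<beta> * a ^ (k + 2)"
    and g: "decaying k a A g" and y: "deriv_from a y (\<lambda>r. - (\<beta> * r ^ Suc k / M) * (y r - g r))"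
    and init: "0 < M \<Longrightarrow> \<bar>y a\<bar> \<le> 2 * A / a ^ k" and bounded: "decaying 0 a B y"
  shows "decaying k a (2 * A) y"
proof (cases "0 < M")
  case True
  then show ?thesis using relaxation_decaying_stable[OF pos(1,2) True small g y] init by blast
next
  case False
  then have "decaying k a A y"
    using relaxation_decaying_unstable[OF pos(1,2) _ g y bounded] pos(3) by simp
  then show ?thesis by (rule decaying_mono) (use decaying_const_nonneg[OF g] pos in auto)
qed

lemma relaxation_exists:
  assumes pos: "0 < a" "0 < \<beta>" "M \<noteq> 0" and small: "2 * real k * M \<le> \<beta> * a ^ (k + 2)"
    and g: "decaying k a A g" and y0: "0 < M \<Longrightarrow> \<bar>y0\<bar> \<le> 2 * A / a ^ k"
  obtains y where "deriv_from a y (\<lambda>r. - (\<beta> * r ^ Suc k / M) * (y r - g r))"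
    "0 < M \<longrightarrow> y a = y0" "decaying k a (2 * A) y"
proof -
  have cont: "continuous_on {a..} (\<lambda>r. \<beta> * r ^ Suc k / M)" using pos by (intro continuous_intros) auto
  note exponent = deriv_from_relaxation_exponent[of a \<beta> M k]
  show ?thesis
  proof (cases "0 < M")
    case True
    obtain y where "deriv_from a y (\<lambda>r. - (\<beta> * r ^ Suc k / M) * (y r - g r))" "y a = y0"
      using linear_initial_value_problem_exists[OF exponent cont decaying_continuous_on[OF g]] by metis
    then show ?thesis using that relaxation_decaying_stable[OF pos(1,2) True small g] y0[OF True] by blast
  next
    case False
    then have "M < 0" using pos(3) by simp
    then have rate: "\<beta> * r ^ Suc k / M \<le> 0" if "a \<le> r" for r
      using that pos by (simp add: divide_nonneg_neg)
    have "decaying 0 a (A / a ^ k) g" using decaying_weaken[of 0 k a A g] g pos by simp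
    then have "\<bar>g r\<bar> \<le> A / a ^ k" if "a \<le> r" for r using decaying_norm_le[OF _ that] by fastforce
    then obtain y where y: "deriv_from a y (\<lambda>r. - (\<beta> * r ^ Suc k / M) * (y r - g r))"
      "\<And>r. a \<le> r \<Longrightarrow> \<bar>y r\<bar> \<le> A / a ^ k"
      using linear_bounded_solution_exists[OF exponent relaxation_integrating_factor_tendsto_0 cont rate
          decaying_continuous_on[OF g]] pos(2) \<open>M < 0\<close> by metis
    then have "decaying 0 a (A / a ^ k) y" by (intro decayingI deriv_from_continuous_on[OF y(1)]) auto
    with relaxation_decaying[OF pos small g y(1)] False have "decaying k a (2 * A) y" by blast
    then show ?thesis using that y(1) False by blast
  qed
qed

section \<open>A contraction principle for decaying functions\<close>

text \<open>Functions on \<open>{a..}\<close> with the norm weighted by \<open>r ^ k\<close>, continued by a constant to the left of \<open>a\<close>.\<close>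

definition weighted_bcontfun :: "nat \<Rightarrow> real \<Rightarrow> (real \<Rightarrow> 'a::real_normed_vector) \<Rightarrow> real \<Rightarrow>\<^sub>C 'a" where
  "weighted_bcontfun k a f = Bcontfun (\<lambda>r. max a r ^ k *\<^sub>R f (max a r))"

definition unweighted_fun :: "nat \<Rightarrow> (real \<Rightarrow>\<^sub>C 'a) \<Rightarrow> real \<Rightarrow> 'a::real_normed_vector" where
  "unweighted_fun k x r = (1 / r ^ k) *\<^sub>R apply_bcontfun x r"

lemma apply_weighted_bcontfun:
  assumes f: "decaying k a A f" and a: "0 < a"
  shows "apply_bcontfun (weighted_bcontfun k a f) r = max a r ^ k *\<^sub>R f (max a r)"
proof -
  have "continuous_on UNIV (\<lambda>r. f (max a r))"
    by (rule continuous_on_compose2[OF decaying_continuous_on[OF f]]) (auto intro: continuous_intros)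
  then have "(\<lambda>r. max a r ^ k *\<^sub>R f (max a r)) \<in> bcontfun"
    using decaying_norm_le[OF f] a
    by (intro bcontfun_normI[where b = A] continuous_intros)
      (auto simp: pos_le_divide_eq mult.commute less_max_iff_disj)
  then show ?thesis by (simp add: weighted_bcontfun_def Bcontfun_inverse)
qed

lemma norm_weighted_bcontfun_le:
  assumes "decaying k a A f" "0 < a"
  shows "norm (weighted_bcontfun k a f) \<le> A"
proof (rule norm_bound)
  show "norm (apply_bcontfun (weighted_bcontfun k a f) r) \<le> A" for r
    using decaying_norm_le[OF assms(1), of "max a r"] assms(2)
    by (simp add: apply_weighted_bcontfun[OF assms] pos_le_divide_eq mult.commute less_max_iff_disj)
qed

lemma unweighted_weighted:
  "decaying k a A f \<Longrightarrow> 0 < a \<Longrightarrow> a \<le> r \<Longrightarrow> unweighted_fun k (weighted_bcontfun k a f) r = f r"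
  by (simp add: unweighted_fun_def apply_weighted_bcontfun max_def)

lemma dist_weighted_bcontfun_le:
  assumes f: "decaying k a A f" "decaying k a B g" and diff: "decaying k a D (\<lambda>r. f r - g r)" and a: "0 < a"
  shows "dist (weighted_bcontfun k a f) (weighted_bcontfun k a g) \<le> D"
proof (rule dist_bound)
  fix r
  have "max a r ^ k * norm (f (max a r) - g (max a r)) \<le> D"
    using decaying_norm_le[OF diff, of "max a r"] a by (simp add: pos_le_divide_eq mult.commute less_max_iff_disj)
  moreover have "max a r ^ k *\<^sub>R f (max a r) - max a r ^ k *\<^sub>R g (max a r)
      = max a r ^ k *\<^sub>R (f (max a r) - g (max a r))"
    by (simp add: scaleR_right_diff_distrib)
  ultimately show "dist (apply_bcontfun (weighted_bcontfun k a f) r) (apply_bcontfun (weighted_bcontfun k a g) r) \<le> D"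
    using a by (simp add: apply_weighted_bcontfun[OF f(1) a]
        apply_weighted_bcontfun[OF f(2) a] dist_norm less_max_iff_disj)
qed

lemma decaying_unweighted_diff:
  fixes x y :: "real \<Rightarrow>\<^sub>C 'a::real_normed_vector"
  assumes "0 < a"
  shows "decaying k a (dist x y) (\<lambda>r. unweighted_fun k x r - unweighted_fun k y r)"
proof (rule decayingI)
  show "continuous_on {a..} (\<lambda>r. unweighted_fun k x r - unweighted_fun k y r)"
    unfolding unweighted_fun_def using assms by (intro continuous_intros) auto
  show "norm (unweighted_fun k x r - unweighted_fun k y r) \<le> dist x y / r ^ k" if "a \<le> r" for r
    using dist_bounded[of x r y] assms that
    by (simp add: unweighted_fun_def dist_norm divide_right_mono flip: scaleR_right_diff_distrib)
qed

lemma decaying_contraction_fixed_point: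
  fixes step :: "(real \<Rightarrow> 'a::banach) \<Rightarrow> (real \<Rightarrow> 'a) \<Rightarrow> bool"
  assumes a: "0 < a" and A: "0 \<le> A"
    and ex: "\<And>f. decaying k a A f \<Longrightarrow> \<exists>g. decaying k a A g \<and> step f g"
    and cong: "\<And>f g h. step f g \<Longrightarrow> (\<And>r. a \<le> r \<Longrightarrow> g r = h r) \<Longrightarrow> step f h"
    and contraction: "\<And>f f' g g' D. decaying k a A f \<Longrightarrow> decaying k a A f' \<Longrightarrow> step f g \<Longrightarrow> step f' g' \<Longrightarrow>
      decaying k a D (\<lambda>r. f r - f' r) \<Longrightarrow> decaying k a (D / 2) (\<lambda>r. g r - g' r)"
  obtains f where "decaying k a A f" "step f f"
proof -
  define T where "T x = weighted_bcontfun k a (SOME g. decaying k a A g \<and> step (unweighted_fun k x) g)" for x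
  have unweighted: "decaying k a A (unweighted_fun k x)" if "x \<in> cball 0 A" for x :: "real \<Rightarrow>\<^sub>C 'a"
    using decaying_mono[OF decaying_unweighted_diff[OF a, of k x 0]] that a
    by (simp add: unweighted_fun_def[abs_def] dist_commute)
  have T: "\<exists>g. decaying k a A g \<and> step (unweighted_fun k x) g \<and> T x = weighted_bcontfun k a g" if "x \<in> cball 0 A" for x
    unfolding T_def using someI_ex[OF ex[OF unweighted[OF that]]] by blast
  have "T x \<in> cball 0 A" if "x \<in> cball 0 A" for x
    using T[OF that] norm_weighted_bcontfun_le[OF _ a] by fastforce
  moreover have "dist (T x) (T y) \<le> 1 / 2 * dist x y" if xy: "x \<in> cball 0 A" "y \<in> cball 0 A" for x y
  proof -
    obtain g h where g: "decaying k a A g" "step (unweighted_fun k x) g" "T x = weighted_bcontfun k a g"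
      and h: "decaying k a A h" "step (unweighted_fun k y) h" "T y = weighted_bcontfun k a h"
      using T xy by meson
    have "decaying k a (dist x y / 2) (\<lambda>r. g r - h r)"
      by (rule contraction[OF unweighted[OF xy(1)] unweighted[OF xy(2)] g(2) h(2) decaying_unweighted_diff[OF a]])
    from dist_weighted_bcontfun_le[OF g(1) h(1) this a] show ?thesis by (simp add: g(3) h(3))
  qed
  ultimately have "\<exists>!x\<in>cball 0 A. T x = x"
    using A by (intro Banach_fix[of _ "1 / 2"]) (auto simp: complete_eq_closed)
  then obtain x where x: "x \<in> cball 0 A" "T x = x" by blast
  obtain g where g: "decaying k a A g" "step (unweighted_fun k x) g" "x = weighted_bcontfun k a g"
    using T[OF x(1)] x(2) by metis
  have "g r = unweighted_fun k x r" if "a \<le> r" for r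
    unfolding g(3) by (simp add: unweighted_weighted[OF g(1) a that])
  then have "step (unweighted_fun k x) (unweighted_fun k x)" by (rule cong[OF g(2)])
  then show ?thesis by (rule that[OF unweighted[OF x(1)]])
qed

lemma decaying_eq_if_difference_contracts:
  assumes a: "0 < a"
    and contraction: "\<And>D. decaying k a D (\<lambda>r. f r - g r) \<Longrightarrow> decaying k a (D / 2) (\<lambda>r. f r - g r)"
    and f: "decaying k a A f" and g: "decaying k a B g" and r: "a \<le> r"
  shows "f r = g r"
proof -
  define D where "D = dist (weighted_bcontfun k a f) (weighted_bcontfun k a g)"
  have "decaying k a D (\<lambda>r. f r - g r)"
    unfolding D_def
    by (rule decaying_cong[OF decaying_unweighted_diff[OF a]])
      (simp add: unweighted_weighted[OF f a] unweighted_weighted[OF g a])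
  note half = contraction[OF this]
  then have "D \<le> D / 2" unfolding D_def by (rule dist_weighted_bcontfun_le[OF f g _ a])
  then have "D = 0" using zero_le_dist[of "weighted_bcontfun k a f" "weighted_bcontfun k a g"] by (simp add: D_def)
  then show ?thesis using decaying_norm_le[OF half r] by simp
qed

section \<open>Smooth functions on a set\<close>

primrec C_k_on :: "nat \<Rightarrow> real set \<Rightarrow> (real \<Rightarrow> real) \<Rightarrow> bool" where
  "C_k_on 0 S f \<longleftrightarrow> continuous_on S f"
| "C_k_on (Suc j) S f \<longleftrightarrow> (\<exists>f'. (\<forall>x\<in>S. (f has_real_derivative f' x) (at x within S)) \<and> C_k_on j S f')"

lemma C_k_on_SucI: "deriv_from a f f' \<Longrightarrow> C_k_on j {a..} f' \<Longrightarrow> C_k_on (Suc j) {a..} f"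
  by auto

lemma C_k_on_cong:
  assumes "C_k_on j S f" "\<And>x. x \<in> S \<Longrightarrow> f x = g x"
  shows "C_k_on j S g"
proof (cases j)
  case 0
  then show ?thesis using assms continuous_on_cong[of S S f g] by simp
next
  case (Suc i)
  then obtain f' where f': "\<forall>x\<in>S. (f has_real_derivative f' x) (at x within S)" "C_k_on i S f'"
    using assms(1) by auto
  have "(g has_real_derivative f' x) (at x within S)" if "x \<in> S" for x
    by (rule has_field_derivative_transform_within[of f _ x S 1]) (use f'(1) assms(2) that in auto)
  then show ?thesis using Suc f'(2) by auto
qed

lemma C_k_on_Suc_imp: "C_k_on (Suc j) S f \<Longrightarrow> C_k_on j S f"
proof (induction j arbitrary: f)
  case 0
  then show ?case by (auto intro: DERIV_continuous_on)
next
  case (Suc j)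
  then obtain f' where "\<forall>x\<in>S. (f has_real_derivative f' x) (at x within S)" "C_k_on (Suc j) S f'"
    using C_k_on.simps(2)[of "Suc j"] by blast
  then show ?case using Suc.IH by auto
qed

lemma C_k_on_const: "C_k_on j S (\<lambda>x. c)"
proof (induction j arbitrary: c)
  case (Suc j)
  show ?case using Suc[of 0] by (auto intro!: exI[of _ "\<lambda>x. 0"])
qed simp

lemma C_k_on_ident: "C_k_on j S (\<lambda>x. x)"
proof (cases j)
  case (Suc i)
  show ?thesis unfolding Suc using C_k_on_const[of i S 1] by (auto intro!: exI[of _ "\<lambda>x. 1"])
qed simp

lemma C_k_on_add: "C_k_on j S f \<Longrightarrow> C_k_on j S g \<Longrightarrow> C_k_on j S (\<lambda>x. f x + g x)"
proof (induction j arbitrary: f g)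
  case (Suc j)
  then obtain f' g' where
    "\<forall>x\<in>S. (f has_real_derivative f' x) (at x within S)" "C_k_on j S f'"
    "\<forall>x\<in>S. (g has_real_derivative g' x) (at x within S)" "C_k_on j S g'" by auto
  then show ?case using Suc.IH[of f' g']
    by (auto intro!: exI[of _ "\<lambda>x. f' x + g' x"] DERIV_add)
qed (auto intro: continuous_intros)

lemma C_k_on_mult: "C_k_on j S f \<Longrightarrow> C_k_on j S g \<Longrightarrow> C_k_on j S (\<lambda>x. f x * g x)"
proof (induction j arbitrary: f g)
  case (Suc j)
  then obtain f' g' where deriv:
    "\<forall>x\<in>S. (f has_real_derivative f' x) (at x within S)" "C_k_on j S f'"
    "\<forall>x\<in>S. (g has_real_derivative g' x) (at x within S)" "C_k_on j S g'" by auto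
  have "C_k_on j S (\<lambda>x. f' x * g x + g' x * f x)"
    by (intro C_k_on_add Suc.IH deriv C_k_on_Suc_imp[OF Suc.prems(1)] C_k_on_Suc_imp[OF Suc.prems(2)])
  then show ?case using deriv
    by (auto intro!: exI[of _ "\<lambda>x. f' x * g x + g' x * f x"] DERIV_mult)
qed (auto intro: continuous_intros)

lemma C_k_on_diff: "C_k_on j S f \<Longrightarrow> C_k_on j S g \<Longrightarrow> C_k_on j S (\<lambda>x. f x - g x)"
  using C_k_on_add[of j S f "\<lambda>x. (-1) * g x"] C_k_on_mult[OF C_k_on_const[of j S "-1"], of g] by simp

lemma C_k_on_power: "C_k_on j S f \<Longrightarrow> C_k_on j S (\<lambda>x. f x ^ i)"
  by (induction i) (simp_all add: C_k_on_const C_k_on_mult)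

lemma C_k_on_inverse:
  assumes "\<And>x. x \<in> S \<Longrightarrow> f x \<noteq> 0"
  shows "C_k_on j S f \<Longrightarrow> C_k_on j S (\<lambda>x. 1 / f x)"
proof (induction j)
  case 0
  then show ?case using assms by (auto intro!: continuous_intros)
next
  case (Suc j)
  then obtain f' where deriv: "\<forall>x\<in>S. (f has_real_derivative f' x) (at x within S)" "C_k_on j S f'" by auto
  have "C_k_on j S (\<lambda>x. (-1) * f' x * (1 / f x * (1 / f x)))"
    using deriv(2) Suc.IH[OF C_k_on_Suc_imp[OF Suc.prems]] by (intro C_k_on_mult C_k_on_const)
  moreover have "((\<lambda>x. 1 / f x) has_real_derivative (-1) * f' x * (1 / f x * (1 / f x))) (at x within S)"
    if "x \<in> S" for x
    using deriv assms that by (auto intro!: derivative_eq_intros)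
  ultimately show ?case
    unfolding C_k_on.simps by (intro exI[of _ "\<lambda>x. (-1) * f' x * (1 / f x * (1 / f x))"]) simp
qed

lemma C_k_on_divide:
  "C_k_on j S f \<Longrightarrow> C_k_on j S g \<Longrightarrow> (\<And>x. x \<in> S \<Longrightarrow> g x \<noteq> 0) \<Longrightarrow> C_k_on j S (\<lambda>x. f x / g x)"
  using C_k_on_mult[of j S f "\<lambda>x. 1 / g x"] C_k_on_inverse[of S g j] by simp

lemma C_infty_on_if_C_k_on:
  assumes smooth: "\<And>j. C_k_on j S f" and nontrivial: "\<And>x. x \<in> S \<Longrightarrow> at x within S \<noteq> bot"
  shows "C_infty_on S f"
proof -
  define d :: "(real \<Rightarrow> real) \<Rightarrow> real \<Rightarrow> real" where "d f x = vector_derivative f (at x within S)" for f x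
  have d_eq: "d f x = D" if "(f has_real_derivative D) (at x within S)" "x \<in> S" for f x D
    unfolding d_def using that nontrivial
    by (intro vector_derivative_within) (auto simp: has_real_derivative_iff_has_vector_derivative)
  have d_deriv: "(f has_real_derivative d f x) (at x within S)" if "C_k_on (Suc j) S f" "x \<in> S" for f x j
    using that d_eq by auto
  have d_smooth: "C_k_on j S (d f)" if f: "C_k_on (Suc j) S f" for f j
  proof -
    obtain f' where f': "\<forall>x\<in>S. (f has_real_derivative f' x) (at x within S)" "C_k_on j S f'" using f by auto
    show ?thesis by (rule C_k_on_cong[OF f'(2)]) (use f'(1) d_eq in auto)
  qed
  have iterates: "C_k_on j S ((d ^^ i) f)" for i j
  proof (induction i arbitrary: j)
    case (Suc i)
    show ?case using d_smooth[OF Suc[of "Suc j"]] by simp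
  qed (use smooth in simp)
  have "((d ^^ i) f has_real_derivative (d ^^ Suc i) f x) (at x within S)" if "x \<in> S" for i x
    using d_deriv[OF iterates that] by simp
  then show ?thesis
    unfolding C_infty_on_def by (intro exI[of _ "\<lambda>i. (d ^^ i) f"]) simp
qed

lemma C_infty_on_imp_C_k_on:
  assumes "C_infty_on S f"
  shows "C_k_on j S f"
proof -
  obtain D where D: "\<And>x. x \<in> S \<Longrightarrow> D 0 x = f x" "\<And>i x. x \<in> S \<Longrightarrow> (D i has_real_derivative D (Suc i) x) (at x within S)"
    using assms unfolding C_infty_on_def by auto
  have "C_k_on j S (D i)" for i
  proof (induction j arbitrary: i)
    case 0
    show ?case using D(2) by (auto intro: DERIV_continuous_on)
  next
    case (Suc j)
    show ?case using D(2) Suc[of "Suc i"] by auto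
  qed
  then show ?thesis by (rule C_k_on_cong[of j S "D 0"]) (rule D(1))
qed

lemma C_infty_on_atLeast_deriv_from:
  assumes "C_infty_on {a..} f"
  obtains f1 f2 where "deriv_from a f f1" "deriv_from a f1 f2"
  using C_infty_on_imp_C_k_on[OF assms, of 2] by (auto simp: numeral_2_eq_2)

lemma at_within_atLeast_neq_bot:
  fixes a r :: real
  assumes "a \<le> r"
  shows "at r within {a..} \<noteq> bot"
proof -
  have "at_right r \<le> at r within {a..}" using assms by (intro at_le) auto
  then show ?thesis using trivial_limit_at_right_real[of r] by (auto simp: bot_unique)
qed

section \<open>Stationary flows as solutions of a first-order system\<close>

lemma dr_eq:
  assumes "(f has_real_derivative D) (at r within {a..})" "a \<le> r"
  shows "dr a f r = D"
  unfolding dr_def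
  using assms at_within_atLeast_neq_bot
  by (intro vector_derivative_within) (auto simp: has_real_derivative_iff_has_vector_derivative)

lemma dr_eqI:
  assumes "deriv_from a g g'" "\<And>s. a \<le> s \<Longrightarrow> f s = g s" "a \<le> r"
  shows "dr a f r = g' r"
  using assms by (intro dr_eq[OF has_real_derivative_cong_atLeast[of g]]) auto

lemma has_real_derivative_0_iff:
  assumes "(f has_real_derivative D) (at r within {a..})" "a \<le> r"
  shows "(f has_real_derivative 0) (at r within {a..}) \<longleftrightarrow> D = 0"
  using assms dr_eq by metis

locale gas =
  fixes k :: nat and r0 cV R nu lam kappa vp tp :: real
  assumes k_pos: "0 < k" and r0_pos: "0 < r0" and R_pos: "0 < R" and mu_pos: "0 < 2 * nu + lam"
    and kappa_pos: "0 < kappa" and vp_pos: "0 < vp" and tp_pos: "0 < tp"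
begin

text \<open>The space dimension is \<open>n = k + 2\<close>, so \<open>m = n - 1\<close> and \<open>\<sigma> r = 1 / r ^ (n - 1)\<close>. The unknown is the
  specific volume \<open>v = 1 / \<rho>\<close>, with limit \<open>vp\<close>; for mass flux \<open>M\<close> the velocity is \<open>M v \<sigma>\<close>.\<close>

abbreviation mu :: real where "mu \<equiv> 2 * nu + lam"

abbreviation m :: real where "m \<equiv> real k + 1"

definition \<sigma> :: "real \<Rightarrow> real" where "\<sigma> r = 1 / r ^ Suc k"

text \<open>The inertial force is the derivative of \<open>M\<^sup>2 (v \<sigma>\<^sup>2 - m tail v)\<close>: the radial divergence leaves the
  remainder \<open>m v \<sigma>\<^sup>2 / r\<close>, which is not an exact derivative.\<close>

definition tail :: "(real \<Rightarrow> real) \<Rightarrow> real \<Rightarrow> real" where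
  "tail v = tail_integral (\<lambda>s. v s * (\<sigma> s)\<^sup>2 * (1 / s))"

definition viscous_stress :: "real \<Rightarrow> (real \<Rightarrow> real) \<Rightarrow> (real \<Rightarrow> real) \<Rightarrow> real \<Rightarrow> real" where
  "viscous_stress M v th r = R * th r * (1 / v r) - R * tp / vp + M\<^sup>2 * (v r * (\<sigma> r)\<^sup>2 - m * tail v r)"

definition heat_flux :: "real \<Rightarrow> (real \<Rightarrow> real) \<Rightarrow> (real \<Rightarrow> real) \<Rightarrow> real \<Rightarrow> real" where
  "heat_flux M v th r = M * cV * th r + M * (R * tp / vp) * v r
     + M ^ 3 * (m * v r * tail v r - (v r)\<^sup>2 * (\<sigma> r)\<^sup>2 * (1 / 2)) + 2 * nu * m * M\<^sup>2 * ((v r)\<^sup>2 * \<sigma> r * (1 / r))"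

definition first_order_system :: "real \<Rightarrow> (real \<Rightarrow> real) \<Rightarrow> (real \<Rightarrow> real) \<Rightarrow> bool" where
  "first_order_system M v th \<longleftrightarrow>
     deriv_from r0 v (\<lambda>r. viscous_stress M v th r / (mu * M * \<sigma> r)) \<and>
     (\<exists>E. deriv_from r0 th (\<lambda>r. (heat_flux M v th r - E) / (kappa * r ^ Suc k)))"

definition mass_equation :: "(real \<Rightarrow> real) \<Rightarrow> (real \<Rightarrow> real) \<Rightarrow> real \<Rightarrow> bool" where
  "mass_equation rho u r \<longleftrightarrow> dr r0 (\<lambda>s. s ^ Suc k * rho s * u s) r / r ^ Suc k = 0"

definition momentum_equation :: "(real \<Rightarrow> real) \<Rightarrow> (real \<Rightarrow> real) \<Rightarrow> (real \<Rightarrow> real) \<Rightarrow> real \<Rightarrow> bool" where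
  "momentum_equation rho u th r \<longleftrightarrow>
     dr r0 (\<lambda>s. s ^ Suc k * rho s * (u s)\<^sup>2) r / r ^ Suc k + dr r0 (\<lambda>s. R * rho s * th s) r
       = mu * dr r0 (\<lambda>s. dr r0 (\<lambda>t. t ^ Suc k * u t) s / s ^ Suc k) r"

definition energy_equation :: "(real \<Rightarrow> real) \<Rightarrow> (real \<Rightarrow> real) \<Rightarrow> (real \<Rightarrow> real) \<Rightarrow> real \<Rightarrow> bool" where
  "energy_equation rho u th r \<longleftrightarrow>
     dr r0 (\<lambda>s. s ^ Suc k * rho s * u s * (cV * th s + (u s)\<^sup>2 / 2)) r / r ^ Suc k
       + dr r0 (\<lambda>s. s ^ Suc k * (R * rho s * th s) * u s) r / r ^ Suc k
     = kappa * dr r0 (\<lambda>s. s ^ Suc k * dr r0 th s) r / r ^ Suc k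
       + mu * dr r0 (\<lambda>s. dr r0 (\<lambda>t. t ^ Suc k * u t) s / s ^ Suc k) r * u r
       + (2 * nu * (dr r0 u r)\<^sup>2 + 2 * nu * m * (u r / r)\<^sup>2 + lam * (dr r0 u r + m / r * u r)\<^sup>2)"

abbreviation stationary_flow :: "(real \<Rightarrow> real) \<Rightarrow> (real \<Rightarrow> real) \<Rightarrow> (real \<Rightarrow> real) \<Rightarrow> bool" where
  "stationary_flow \<equiv> stationary_sol (k + 2) r0 cV R nu lam kappa (1 / vp) 0 tp"

lemma stationary_flow_iff:
  "stationary_flow rho u th \<longleftrightarrow>
     C_infty_on {r0..} rho \<and> C_infty_on {r0..} u \<and> C_infty_on {r0..} th \<and> (\<forall>r\<ge>r0. rho r > 0 \<and> th r > 0) \<and>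
     (\<forall>r\<ge>r0. mass_equation rho u r \<and> momentum_equation rho u th r \<and> energy_equation rho u th r) \<and>
     (rho \<longlongrightarrow> 1 / vp) at_top \<and> (u \<longlongrightarrow> 0) at_top \<and> (th \<longlongrightarrow> tp) at_top"
proof -
  have n: "k + 2 - 1 = Suc k" "real (k + 2) - 1 = m" by simp_all
  show ?thesis
    unfolding stationary_sol_def Let_def mass_equation_def momentum_equation_def energy_equation_def n ..
qed

lemma power_mult_\<sigma>: "r0 \<le> r \<Longrightarrow> r ^ Suc k * \<sigma> r = 1"
  using r0_pos by (simp add: \<sigma>_def)

lemma deriv_from_\<sigma>: "deriv_from r0 \<sigma> (\<lambda>r. - m * \<sigma> r * (1 / r))"
  by (rule deriv_from_cong[OF deriv_from_inverse_power[OF r0_pos, of "Suc k"]])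
    (use r0_pos in \<open>auto simp: \<sigma>_def field_simps\<close>)

lemma \<sigma>_tendsto_0: "(\<sigma> \<longlongrightarrow> 0) at_top"
  unfolding \<sigma>_def[abs_def] by (rule tendsto_inverse_power_at_top) simp

lemma tail_decaying:
  assumes "decaying 0 r0 B v"
  shows "deriv_from r0 (tail v) (\<lambda>r. - (v r * (\<sigma> r)\<^sup>2 * (1 / r)))" "(tail v \<longlongrightarrow> 0) at_top"
    "decaying (2 * k + 2) r0 (B / (2 * k + 2)) (tail v)"
proof -
  have "decaying (0 + Suc (2 * k + 2)) r0 (B * 1) (\<lambda>r. v r * (1 / r ^ Suc (2 * k + 2)))"
    by (intro decaying_mult assms decaying_inverse_power r0_pos)
  moreover have "v r * (1 / r ^ Suc (2 * k + 2)) = v r * (\<sigma> r)\<^sup>2 * (1 / r)" for r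
    by (simp add: \<sigma>_def power2_eq_square power_add mult_2)
  ultimately have "decaying (Suc (2 * k + 2)) r0 B (\<lambda>r. v r * (\<sigma> r)\<^sup>2 * (1 / r))" by simp
  note tail_integral_decaying[OF this r0_pos, folded tail_def]
  then show "deriv_from r0 (tail v) (\<lambda>r. - (v r * (\<sigma> r)\<^sup>2 * (1 / r)))" "(tail v \<longlongrightarrow> 0) at_top"
    "decaying (2 * k + 2) r0 (B / (2 * k + 2)) (tail v)" by simp_all
qed

end

locale smooth_flow = gas +
  fixes M :: real and v v1 v2 th t1 t2 rho u :: "real \<Rightarrow> real"
  assumes v_deriv: "deriv_from r0 v v1" and v1_deriv: "deriv_from r0 v1 v2"
    and th_deriv: "deriv_from r0 th t1" and t1_deriv: "deriv_from r0 t1 t2"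
    and v_pos: "\<And>r. r0 \<le> r \<Longrightarrow> 0 < v r"
    and tail_deriv: "deriv_from r0 (tail v) (\<lambda>r. - (v r * (\<sigma> r)\<^sup>2 * (1 / r)))"
    and rho_eq: "\<And>r. r0 \<le> r \<Longrightarrow> rho r = 1 / v r" and u_eq: "\<And>r. r0 \<le> r \<Longrightarrow> u r = M * v r * \<sigma> r"
begin

definition u1 :: "real \<Rightarrow> real" where "u1 r = M * (v1 r * \<sigma> r - m * v r * \<sigma> r * (1 / r))"

definition div_u1 :: "real \<Rightarrow> real" where "div_u1 r = M * (v2 r * \<sigma> r - m * v1 r * \<sigma> r * (1 / r))"

definition heat1 :: "real \<Rightarrow> real" where "heat1 r = m * r ^ k * t1 r + r ^ Suc k * t2 r"

lemma derivs:
  assumes "r0 \<le> r"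
  shows "(v has_real_derivative v1 r) (at r within {r0..})" "(v1 has_real_derivative v2 r) (at r within {r0..})"
    "(th has_real_derivative t1 r) (at r within {r0..})" "(t1 has_real_derivative t2 r) (at r within {r0..})"
    "(\<sigma> has_real_derivative - m * \<sigma> r * (1 / r)) (at r within {r0..})"
    "(tail v has_real_derivative - (v r * (\<sigma> r)\<^sup>2 * (1 / r))) (at r within {r0..})"
    "((\<lambda>r. 1 / r) has_real_derivative - (1 / r)\<^sup>2) (at r within {r0..})"
    "((\<lambda>r. 1 / v r) has_real_derivative - v1 r * (1 / v r)\<^sup>2) (at r within {r0..})"
proof -
  show "((\<lambda>r. 1 / v r) has_real_derivative - v1 r * (1 / v r)\<^sup>2) (at r within {r0..})"
    using v_deriv assms v_pos[OF assms] by (auto intro!: derivative_eq_intros simp: power2_eq_square)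
qed (use v_deriv v1_deriv th_deriv t1_deriv deriv_from_\<sigma> tail_deriv deriv_from_inverse_power[OF r0_pos, of 1] assms
  in \<open>auto simp: power2_eq_square\<close>)

lemma deriv_from_u: "deriv_from r0 u u1"
proof -
  have "((\<lambda>r. M * v r * \<sigma> r) has_real_derivative u1 r) (at r within {r0..})" if "r0 \<le> r" for r
    by (rule derivs[OF that] derivative_eq_intros refl)+ (simp add: u1_def algebra_simps)
  then have "deriv_from r0 (\<lambda>r. M * v r * \<sigma> r) u1" by simp
  then show ?thesis by (rule deriv_from_cong) (simp_all add: u_eq)
qed

lemma deriv_from_divergence: "deriv_from r0 (\<lambda>r. M * v1 r * \<sigma> r) div_u1"
proof (intro allI impI)
  fix r assume r: "r0 \<le> r"
  show "((\<lambda>r. M * v1 r * \<sigma> r) has_real_derivative div_u1 r) (at r within {r0..})"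
    by (rule derivs[OF r] derivative_eq_intros refl)+ (simp add: div_u1_def algebra_simps)
qed

lemma deriv_from_heat: "deriv_from r0 (\<lambda>r. r ^ Suc k * t1 r) heat1"
proof (intro allI impI)
  fix r assume r: "r0 \<le> r"
  show "((\<lambda>r. r ^ Suc k * t1 r) has_real_derivative heat1 r) (at r within {r0..})"
    by (rule derivs[OF r] derivative_eq_intros refl)+ (simp add: heat1_def algebra_simps)
qed

lemma mass_flux_constant: "r0 \<le> r \<Longrightarrow> r ^ Suc k * rho r * u r = M"
  using power_mult_\<sigma>[of r] v_pos[of r] by (simp add: rho_eq u_eq mult_ac)

lemma mass_equation_holds: "r0 \<le> r \<Longrightarrow> mass_equation rho u r"
  unfolding mass_equation_def using dr_eqI[of r0 "\<lambda>r. M" "\<lambda>r. 0" "\<lambda>s. s ^ Suc k * rho s * u s" r]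
  by (simp add: mass_flux_constant del: power_Suc)

lemma dr_divergence:
  assumes "r0 \<le> r"
  shows "dr r0 (\<lambda>s. dr r0 (\<lambda>t. t ^ Suc k * u t) s / s ^ Suc k) r = div_u1 r"
proof (rule dr_eqI[OF deriv_from_divergence _ assms])
  fix s assume s: "r0 \<le> s"
  have "dr r0 (\<lambda>t. t ^ Suc k * u t) s = M * v1 s"
    by (rule dr_eqI[OF deriv_from_cmult[OF v_deriv, of M] _ s])
      (use power_mult_\<sigma> in \<open>simp add: u_eq mult_ac\<close>)
  then show "dr r0 (\<lambda>t. t ^ Suc k * u t) s / s ^ Suc k = M * v1 s * \<sigma> s" by (simp add: \<sigma>_def)
qed

lemma momentum_equation_iff_derivs:
  assumes r: "r0 \<le> r"
  shows "momentum_equation rho u th r \<longleftrightarrow>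
    M * u1 r * \<sigma> r + R * (t1 r * (1 / v r) - th r * v1 r * (1 / v r)\<^sup>2) = mu * div_u1 r"
proof -
  have "dr r0 (\<lambda>s. s ^ Suc k * rho s * (u s)\<^sup>2) r = M * u1 r"
    by (rule dr_eqI[OF deriv_from_cmult[OF deriv_from_u] _ r])
      (simp add: power2_eq_square mass_flux_constant del: power_Suc flip: mult.assoc)
  moreover have "((\<lambda>s. R * (th s * (1 / v s))) has_real_derivative
      R * (t1 s * (1 / v s) - th s * v1 s * (1 / v s)\<^sup>2)) (at s within {r0..})" if "r0 \<le> s" for s
    by (rule derivs[OF that] derivative_eq_intros refl)+ (simp add: algebra_simps)
  then have "dr r0 (\<lambda>s. R * rho s * th s) r = R * (t1 r * (1 / v r) - th r * v1 r * (1 / v r)\<^sup>2)"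
    by (intro dr_eqI[where g = "\<lambda>s. R * (th s * (1 / v s))"]) (simp_all add: rho_eq r)
  ultimately show ?thesis
    unfolding momentum_equation_def dr_divergence[OF r] by (simp add: \<sigma>_def del: power_Suc)
qed

lemma dr_energy_flux:
  assumes r: "r0 \<le> r"
  shows "dr r0 (\<lambda>s. s ^ Suc k * rho s * u s * (cV * th s + (u s)\<^sup>2 / 2)) r = M * (cV * t1 r + u r * u1 r)"
proof (rule dr_eqI[OF _ _ r])
  show "deriv_from r0 (\<lambda>s. M * (cV * th s + (u s)\<^sup>2 / 2)) (\<lambda>r. M * (cV * t1 r + u r * u1 r))"
    using th_deriv deriv_from_u by (auto intro!: derivative_eq_intros)
qed (simp only: mass_flux_constant)

lemma energy_equation_iff_derivs:
  assumes r: "r0 \<le> r"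
  shows "energy_equation rho u th r \<longleftrightarrow>
    M * (cV * t1 r + M * v r * \<sigma> r * u1 r) * \<sigma> r + M * R * t1 r * \<sigma> r
      = kappa * heat1 r * \<sigma> r + mu * div_u1 r * (M * v r * \<sigma> r)
        + (2 * nu * (u1 r)\<^sup>2 + 2 * nu * m * (M * v r * \<sigma> r * (1 / r))\<^sup>2 + lam * (M * v1 r * \<sigma> r)\<^sup>2)"
proof -
  have pressure_work: "dr r0 (\<lambda>s. s ^ Suc k * (R * rho s * th s) * u s) r = M * R * t1 r"
  proof (rule dr_eqI[OF deriv_from_cmult[OF th_deriv] _ r])
    show "s ^ Suc k * (R * rho s * th s) * u s = M * R * th s" if "r0 \<le> s" for s
      using arg_cong[OF mass_flux_constant[OF that], of "\<lambda>x. x * R * th s"] by (simp only: mult_ac)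
  qed
  have heat: "dr r0 (\<lambda>s. s ^ Suc k * dr r0 th s) r = heat1 r"
    by (rule dr_eqI[OF deriv_from_heat _ r]) (simp add: dr_eqI[OF th_deriv])
  have velocity: "dr r0 u r = u1 r" by (rule dr_eqI[OF deriv_from_u _ r]) simp
  have divergence: "u1 r + m / r * (M * v r * \<sigma> r) = M * v1 r * \<sigma> r"
    by (simp add: u1_def algebra_simps add_divide_distrib)
  have weight: "x / r ^ Suc k = x * \<sigma> r" "M * v r * \<sigma> r / r = M * v r * \<sigma> r * (1 / r)" for x
    by (simp_all add: \<sigma>_def)
  show ?thesis
    unfolding energy_equation_def dr_energy_flux[OF r] pressure_work heat velocity dr_divergence[OF r]
      u_eq[OF r] divergence weight ..
qed

lemma deriv_from_viscous_stress:
  "deriv_from r0 (viscous_stress M v th)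
     (\<lambda>r. R * (t1 r * (1 / v r) - th r * v1 r * (1 / v r)\<^sup>2) + M\<^sup>2 * (v1 r * (\<sigma> r)\<^sup>2 - m * v r * (\<sigma> r)\<^sup>2 * (1 / r)))"
    (is "deriv_from r0 _ ?stress'")
proof (intro allI impI)
  fix r assume r: "r0 \<le> r"
  show "(viscous_stress M v th has_real_derivative ?stress' r) (at r within {r0..})"
    unfolding viscous_stress_def[abs_def]
    by (rule derivs[OF r] derivative_eq_intros refl)+ (simp add: algebra_simps add_divide_distrib power2_eq_square)
qed

lemma deriv_from_heat_flux:
  "deriv_from r0 (heat_flux M v th) (\<lambda>r. M * cV * t1 r + M * (R * tp / vp) * v1 r
     + M ^ 3 * (m * v1 r * tail v r - v r * v1 r * (\<sigma> r)\<^sup>2)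
     + 2 * nu * m * M\<^sup>2 * (2 * v r * v1 r * \<sigma> r * (1 / r) - (m + 1) * (v r)\<^sup>2 * \<sigma> r * (1 / r)\<^sup>2))"
    (is "deriv_from r0 _ ?flux'")
proof (intro allI impI)
  fix r assume r: "r0 \<le> r"
  show "(heat_flux M v th has_real_derivative ?flux' r) (at r within {r0..})"
    unfolding heat_flux_def[abs_def]
    by (rule derivs[OF r] derivative_eq_intros refl)+ (simp add: algebra_simps add_divide_distrib power2_eq_square)
qed

lemma momentum_equation_iff_conservation:
  assumes r: "r0 \<le> r"
  shows "momentum_equation rho u th r \<longleftrightarrow>
    ((\<lambda>s. mu * (M * v1 s * \<sigma> s) - viscous_stress M v th s) has_real_derivative 0) (at r within {r0..})"
proof -
  note deriv = deriv_from_diff[OF deriv_from_cmult[OF deriv_from_divergence, of mu] deriv_from_viscous_stress,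
      rule_format, OF r]
  have "M * u1 r * \<sigma> r = M\<^sup>2 * (v1 r * (\<sigma> r)\<^sup>2 - m * v r * (\<sigma> r)\<^sup>2 * (1 / r))"
    by (simp add: u1_def algebra_simps power2_eq_square)
  then show ?thesis
    unfolding momentum_equation_iff_derivs[OF r] has_real_derivative_0_iff[OF deriv r] by auto
qed

text \<open>The terms with the temperature cancel because the pressure work \<open>p v\<close> is \<open>R th\<close>.\<close>

lemma energy_identity:
  fixes V S V1 T T1 I W Y P X :: real
  assumes vol: "V * S = 1" and stress: "mu * (M * V1 * W) = R * T * S - P + M\<^sup>2 * (V * W\<^sup>2 - m * I)"
    and momentum: "mu * X = R * (T1 * S - T * V1 * S\<^sup>2) + M\<^sup>2 * (V1 * W\<^sup>2 - m * V * W\<^sup>2 * Y)"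
  shows "M * (cV * T1 + M * V * W * (M * (V1 * W - m * V * W * Y))) * W + M * R * T1 * W
    = (M * cV * T1 + M * P * V1 + M ^ 3 * (m * V1 * I - V * V1 * W\<^sup>2)
        + 2 * nu * m * M\<^sup>2 * (2 * V * V1 * W * Y - (m + 1) * V\<^sup>2 * W * Y\<^sup>2)) * W
      + mu * X * (M * V * W)
      + (2 * nu * (M * (V1 * W - m * V * W * Y))\<^sup>2 + 2 * nu * m * (M * V * W * Y)\<^sup>2 + lam * (M * V1 * W)\<^sup>2)"
proof -
  have P: "P = R * T * S + M\<^sup>2 * (V * W\<^sup>2 - m * I) - mu * (M * V1 * W)" using stress by simp
  show ?thesis
    unfolding momentum unfolding P using vol by algebra
qed

lemma energy_equation_iff_conservation:
  assumes r: "r0 \<le> r" and stress: "mu * (M * v1 r * \<sigma> r) = viscous_stress M v th r"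
    and momentum: "momentum_equation rho u th r"
  shows "energy_equation rho u th r \<longleftrightarrow>
    ((\<lambda>s. kappa * (s ^ Suc k * t1 s) - heat_flux M v th s) has_real_derivative 0) (at r within {r0..})"
proof -
  note deriv = deriv_from_diff[OF deriv_from_cmult[OF deriv_from_heat, of kappa] deriv_from_heat_flux,
      rule_format, OF r]
  have vol: "v r * (1 / v r) = 1" using v_pos[OF r] by simp
  have "mu * div_u1 r = R * (t1 r * (1 / v r) - th r * v1 r * (1 / v r)\<^sup>2)
      + M\<^sup>2 * (v1 r * (\<sigma> r)\<^sup>2 - m * v r * (\<sigma> r)\<^sup>2 * (1 / r))"
    using momentum unfolding momentum_equation_iff_derivs[OF r]
    by (simp add: u1_def algebra_simps power2_eq_square)
  note identity = energy_identity[OF vol stress[unfolded viscous_stress_def] this, folded u1_def]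
  have "\<sigma> r \<noteq> 0" using power_mult_\<sigma>[OF r] by auto
  then show ?thesis
    unfolding energy_equation_iff_derivs[OF r] identity has_real_derivative_0_iff[OF deriv r] by auto
qed

end

context gas
begin

lemma C_k_on_\<sigma>: "C_k_on j {r0..} \<sigma>"
  unfolding \<sigma>_def[abs_def] using r0_pos by (intro C_k_on_inverse C_k_on_power C_k_on_ident) auto

lemma C_k_on_fluxes:
  assumes "C_k_on j {r0..} v" "C_k_on j {r0..} th" "C_k_on j {r0..} (tail v)" "\<And>r. r0 \<le> r \<Longrightarrow> 0 < v r"
  shows "C_k_on j {r0..} (viscous_stress M v th)" "C_k_on j {r0..} (heat_flux M v th)"
proof -
  have "v r \<noteq> 0" "r \<noteq> 0" if "r \<in> {r0..}" for r using assms(4)[of r] r0_pos that by auto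
  then show "C_k_on j {r0..} (viscous_stress M v th)" "C_k_on j {r0..} (heat_flux M v th)"
    unfolding viscous_stress_def[abs_def] heat_flux_def[abs_def]
    by (intro C_k_on_add C_k_on_diff C_k_on_mult C_k_on_power C_k_on_const C_k_on_inverse C_k_on_ident
        C_k_on_\<sigma> assms(1-3); blast)+
qed

lemma first_order_system_smooth:
  assumes sys: "first_order_system M v th" and M: "M \<noteq> 0"
    and v_pos: "\<And>r. r0 \<le> r \<Longrightarrow> 0 < v r" and v_bounded: "decaying 0 r0 B v"
  shows "C_k_on j {r0..} v \<and> C_k_on j {r0..} th \<and> C_k_on j {r0..} (tail v)"
proof -
  obtain E where deriv: "deriv_from r0 v (\<lambda>r. viscous_stress M v th r / (mu * M * \<sigma> r))"
    "deriv_from r0 th (\<lambda>r. (heat_flux M v th r - E) / (kappa * r ^ Suc k))"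
    using sys unfolding first_order_system_def by blast
  note deriv_tail = tail_decaying(1)[OF v_bounded]
  show ?thesis
  proof (induction j)
    case 0
    show ?case
      using deriv[THEN deriv_from_continuous_on] deriv_from_continuous_on[OF deriv_tail] by simp
  next
    case (Suc j)
    then have smooth: "C_k_on j {r0..} v" "C_k_on j {r0..} th" "C_k_on j {r0..} (tail v)" by auto
    have nz: "mu * M * \<sigma> r \<noteq> 0" "kappa * r ^ Suc k \<noteq> 0" if "r \<in> {r0..}" for r
      using that r0_pos mu_pos kappa_pos M power_mult_\<sigma>[of r] by auto
    have "C_k_on j {r0..} (\<lambda>r. viscous_stress M v th r / (mu * M * \<sigma> r))"
      by (intro C_k_on_divide C_k_on_fluxes C_k_on_mult C_k_on_const C_k_on_\<sigma> smooth v_pos nz)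
    moreover have "C_k_on j {r0..} (\<lambda>r. (heat_flux M v th r - E) / (kappa * r ^ Suc k))"
      by (intro C_k_on_divide C_k_on_diff C_k_on_fluxes C_k_on_mult C_k_on_const C_k_on_power C_k_on_ident
          smooth v_pos nz)
    moreover have "C_k_on j {r0..} (\<lambda>r. 0 - v r * (\<sigma> r)\<^sup>2 * (1 / r))"
      using r0_pos
      by (intro C_k_on_diff C_k_on_mult C_k_on_const C_k_on_power C_k_on_inverse C_k_on_ident C_k_on_\<sigma> smooth) auto
    ultimately show ?case
      using deriv deriv_tail by (intro conjI C_k_on_SucI) (assumption | simp)+
  qed
qed

theorem stationary_if_first_order_system:
  assumes sys: "first_order_system M v th" and M: "M \<noteq> 0"
    and v_pos: "\<And>r. r0 \<le> r \<Longrightarrow> 0 < v r" and v_bounded: "decaying 0 r0 B v"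
    and th_pos: "\<And>r. r0 \<le> r \<Longrightarrow> 0 < th r"
    and lim: "(v \<longlongrightarrow> vp) at_top" "(th \<longlongrightarrow> tp) at_top"
  shows "stationary_flow (\<lambda>r. 1 / v r) (\<lambda>r. M * v r * \<sigma> r) th"
proof -
  note smooth = first_order_system_smooth[OF sys M v_pos v_bounded]
  obtain E where v: "deriv_from r0 v (\<lambda>r. viscous_stress M v th r / (mu * M * \<sigma> r))" (is "deriv_from r0 v ?v1")
    and th: "deriv_from r0 th (\<lambda>r. (heat_flux M v th r - E) / (kappa * r ^ Suc k))" (is "deriv_from r0 th ?t1")
    using sys unfolding first_order_system_def by blast
  have nz: "mu * M * \<sigma> r \<noteq> 0" "kappa * r ^ Suc k \<noteq> 0" if "r \<in> {r0..}" for r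
    using that r0_pos mu_pos kappa_pos M power_mult_\<sigma>[of r] by auto
  have "C_k_on 1 {r0..} ?v1" "C_k_on 1 {r0..} ?t1"
    using smooth v_pos nz
    by (auto intro!: C_k_on_divide C_k_on_diff C_k_on_fluxes C_k_on_mult C_k_on_const C_k_on_power C_k_on_ident
        C_k_on_\<sigma> simp del: power_Suc C_k_on.simps)
  then obtain v2 t2 where v1: "deriv_from r0 ?v1 v2" and t1: "deriv_from r0 ?t1 t2" by auto
  interpret smooth_flow k r0 cV R nu lam kappa vp tp M v ?v1 v2 th ?t1 t2 "\<lambda>r. 1 / v r" "\<lambda>r. M * v r * \<sigma> r"
    by unfold_locales (use v v1 th t1 v_pos tail_decaying(1)[OF v_bounded] in simp_all)
  have stress: "mu * (M * ?v1 r * \<sigma> r) = viscous_stress M v th r"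
    and flux: "kappa * (r ^ Suc k * ?t1 r) - heat_flux M v th r = - E" if "r0 \<le> r" for r
    using nz[of r] that by (simp_all del: power_Suc add: mult_ac)
  have momentum: "momentum_equation (\<lambda>r. 1 / v r) (\<lambda>r. M * v r * \<sigma> r) th r" if "r0 \<le> r" for r
    unfolding momentum_equation_iff_conservation[OF that]
    by (rule has_real_derivative_cong_atLeast[OF DERIV_const[of 0] _ that]) (simp only: stress diff_self)
  have energy: "energy_equation (\<lambda>r. 1 / v r) (\<lambda>r. M * v r * \<sigma> r) th r" if "r0 \<le> r" for r
    unfolding energy_equation_iff_conservation[OF that stress[OF that] momentum[OF that]]
    by (rule has_real_derivative_cong_atLeast[OF DERIV_const[of "- E"] _ that]) (simp only: flux)
  have "C_infty_on {r0..} (\<lambda>r. 1 / v r)" "C_infty_on {r0..} (\<lambda>r. M * v r * \<sigma> r)" "C_infty_on {r0..} th"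
    using smooth v_pos at_within_atLeast_neq_bot
    by (auto intro!: C_infty_on_if_C_k_on C_k_on_inverse C_k_on_mult C_k_on_const C_k_on_\<sigma>
      simp: less_imp_neq[symmetric])
  moreover have "((\<lambda>r. 1 / v r) \<longlongrightarrow> 1 / vp) at_top" "((\<lambda>r. M * v r * \<sigma> r) \<longlongrightarrow> 0) at_top"
    using tendsto_divide[OF tendsto_const lim(1)] vp_pos
      tendsto_mult[OF tendsto_mult[OF tendsto_const lim(1)] \<sigma>_tendsto_0] by auto
  ultimately show ?thesis
    unfolding stationary_flow_iff using v_pos th_pos lim(2) mass_equation_holds momentum energy by simp
qed

lemma stationary_flow_mass_flux:
  assumes flow: "stationary_flow rho u th" and r: "r0 \<le> r"
  shows "r ^ Suc k * rho r * u r = r0 ^ Suc k * rho r0 * u r0"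
proof (rule constant_if_deriv_zero[OF _ r])
  note S = flow[unfolded stationary_flow_iff]
  obtain rho1 rho2 where rho: "deriv_from r0 rho rho1" "deriv_from r0 rho1 rho2"
    using C_infty_on_atLeast_deriv_from S by blast
  obtain u1 u2 where u: "deriv_from r0 u u1" "deriv_from r0 u1 u2"
    using C_infty_on_atLeast_deriv_from S by blast
  show "deriv_from r0 (\<lambda>s. s ^ Suc k * rho s * u s) (\<lambda>r. 0)"
  proof (intro allI impI)
    fix s assume s: "r0 \<le> s"
    note deriv = DERIV_mult[OF DERIV_mult[OF DERIV_pow rho(1)[rule_format, OF s]] u(1)[rule_format, OF s], of "Suc k"]
    have "mass_equation rho u s" using S s by blast
    then have "dr r0 (\<lambda>s. s ^ Suc k * rho s * u s) s = 0"
      using s r0_pos by (simp add: mass_equation_def)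
    then show "((\<lambda>s. s ^ Suc k * rho s * u s) has_real_derivative 0) (at s within {r0..})"
      using deriv dr_eq[OF deriv s] by simp
  qed
qed

lemma stationary_flow_velocity:
  assumes flow: "stationary_flow rho u th" and r: "r0 \<le> r"
  shows "u r = r0 ^ Suc k * rho r0 * u r0 * (1 / rho r) * \<sigma> r"
proof -
  have "0 < rho r" using flow r unfolding stationary_flow_iff by blast
  then have "r ^ Suc k * rho r * u r * (1 / rho r) * \<sigma> r = r ^ Suc k * \<sigma> r * u r" by simp
  then show ?thesis
    unfolding stationary_flow_mass_flux[OF flow r] power_mult_\<sigma>[OF r] by simp
qed

end

context smooth_flow
begin

lemma viscous_stress_tendsto_0:
  assumes "(v \<longlongrightarrow> vp) at_top" "(th \<longlongrightarrow> tp) at_top" "(tail v \<longlongrightarrow> 0) at_top"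
  shows "(viscous_stress M v th \<longlongrightarrow> 0) at_top"
proof -
  have "(viscous_stress M v th \<longlongrightarrow> R * tp * (1 / vp) - R * tp / vp + M\<^sup>2 * (vp * 0\<^sup>2 - m * 0)) at_top"
    unfolding viscous_stress_def[abs_def] using vp_pos by (intro tendsto_intros assms \<sigma>_tendsto_0) auto
  then show ?thesis by simp
qed

text \<open>The constant of integration is the limit of \<open>mu M v' \<sigma>\<close>, which vanishes because \<open>v\<close> converges.\<close>

lemma integrated_momentum_equation:
  assumes momentum: "\<And>r. r0 \<le> r \<Longrightarrow> momentum_equation rho u th r" and M: "M \<noteq> 0"
    and lim: "(v \<longlongrightarrow> vp) at_top" "(th \<longlongrightarrow> tp) at_top" "(tail v \<longlongrightarrow> 0) at_top" and r: "r0 \<le> r"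
  shows "mu * (M * v1 r * \<sigma> r) = viscous_stress M v th r"
proof -
  define defect where "defect r = mu * (M * v1 r * \<sigma> r) - viscous_stress M v th r" for r
  have const: "defect r = defect r0" if "r0 \<le> r" for r
    using momentum momentum_equation_iff_conservation
    by (intro constant_if_deriv_zero[OF _ that]) (simp add: defect_def[abs_def])
  have "((\<lambda>r. (defect r0 + viscous_stress M v th r) / (mu * M)) \<longlongrightarrow> (defect r0 + 0) / (mu * M)) at_top"
    using mu_pos M by (intro tendsto_intros viscous_stress_tendsto_0 lim) auto
  moreover have "\<forall>\<^sub>F r in at_top. (defect r0 + viscous_stress M v th r) / (mu * M) = v1 r / r ^ Suc k"
  proof (rule eventually_mono[OF eventually_ge_at_top[of r0]])
    fix r assume "r0 \<le> r"
    then have "defect r0 + viscous_stress M v th r = mu * M * (v1 r * \<sigma> r)"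
      using const[of r] by (simp add: defect_def)
    then show "(defect r0 + viscous_stress M v th r) / (mu * M) = v1 r / r ^ Suc k"
      using mu_pos M by (simp add: \<sigma>_def)
  qed
  ultimately have "((\<lambda>r. v1 r / r ^ Suc k) \<longlongrightarrow> (defect r0 + 0) / (mu * M)) at_top"
    by (rule Lim_transform_eventually)
  from deriv_over_power_tendsto_imp_0[OF v_deriv lim(1) this] have "defect r0 = 0" using mu_pos M by simp
  then show ?thesis using const[OF r] by (simp add: defect_def)
qed

lemma first_order_system_if_equations:
  assumes momentum: "\<And>r. r0 \<le> r \<Longrightarrow> momentum_equation rho u th r"
    and energy: "\<And>r. r0 \<le> r \<Longrightarrow> energy_equation rho u th r" and M: "M \<noteq> 0"
    and lim: "(v \<longlongrightarrow> vp) at_top" "(th \<longlongrightarrow> tp) at_top" "(tail v \<longlongrightarrow> 0) at_top"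
  shows "first_order_system M v th"
proof -
  have stress: "mu * (M * v1 r * \<sigma> r) = viscous_stress M v th r" if "r0 \<le> r" for r
    by (rule integrated_momentum_equation[OF momentum M lim that])
  define E where "E = - (kappa * (r0 ^ Suc k * t1 r0) - heat_flux M v th r0)"
  have flux: "kappa * (r ^ Suc k * t1 r) - heat_flux M v th r = - E" if "r0 \<le> r" for r
    unfolding E_def minus_minus using energy energy_equation_iff_conservation momentum stress
    by (intro constant_if_deriv_zero[OF _ that]) simp
  have "deriv_from r0 v (\<lambda>r. viscous_stress M v th r / (mu * M * \<sigma> r))"
    using v_deriv
  proof (rule deriv_from_cong)
    show "v1 r = viscous_stress M v th r / (mu * M * \<sigma> r)" if "r0 \<le> r" for r
      using stress[OF that, symmetric] mu_pos M power_mult_\<sigma>[OF that] by auto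
  qed simp
  moreover have "deriv_from r0 th (\<lambda>r. (heat_flux M v th r - E) / (kappa * r ^ Suc k))"
    using th_deriv
  proof (rule deriv_from_cong)
    fix r assume r: "r0 \<le> r"
    have "heat_flux M v th r - E = kappa * r ^ Suc k * t1 r" using flux[OF r] by (simp add: mult.assoc)
    then show "t1 r = (heat_flux M v th r - E) / (kappa * r ^ Suc k)" using kappa_pos r0_pos r by simp
  qed simp
  ultimately show ?thesis
    unfolding first_order_system_def by blast
qed

end

theorem (in gas) first_order_system_if_stationary:
  assumes flow: "stationary_flow rho u th" and u0: "u r0 \<noteq> 0" and bounded: "decaying 0 r0 B (\<lambda>r. 1 / rho r)"
  shows "first_order_system (r0 ^ Suc k * rho r0 * u r0) (\<lambda>r. 1 / rho r) th"
proof -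
  note S = flow[unfolded stationary_flow_iff]
  have rho_pos: "0 < rho r" if "r0 \<le> r" for r using S that by blast
  have "C_k_on 2 {r0..} (\<lambda>r. 1 / rho r)"
    using S rho_pos C_infty_on_imp_C_k_on[of "{r0..}" rho]
    by (intro C_k_on_inverse) (auto simp: less_imp_neq[symmetric])
  then obtain v1 v2 where v: "deriv_from r0 (\<lambda>r. 1 / rho r) v1" "deriv_from r0 v1 v2"
    by (auto simp: numeral_2_eq_2)
  obtain t1 t2 where th: "deriv_from r0 th t1" "deriv_from r0 t1 t2"
    using C_infty_on_atLeast_deriv_from S by blast
  interpret smooth_flow k r0 cV R nu lam kappa vp tp "r0 ^ Suc k * rho r0 * u r0" "\<lambda>r. 1 / rho r" v1 v2 th t1 t2 rho u
  proof unfold_locales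
    show "u r = r0 ^ Suc k * rho r0 * u r0 * (1 / rho r) * \<sigma> r" if "r0 \<le> r" for r
      by (rule stationary_flow_velocity[OF flow that])
  qed (use v th rho_pos tail_decaying(1)[OF bounded] in simp_all)
  show ?thesis
  proof (rule first_order_system_if_equations)
    show "r0 ^ Suc k * rho r0 * u r0 \<noteq> 0" using u0 r0_pos rho_pos[of r0] by simp
    show "((\<lambda>r. 1 / rho r) \<longlongrightarrow> vp) at_top"
      using S vp_pos tendsto_divide[OF tendsto_const[of 1], of rho "1 / vp" at_top] by simp
  qed (use S tail_decaying(2)[OF bounded] in blast)+
qed

section \<open>Lipschitz functionals of the state\<close>

context gas
begin

text \<open>A state \<open>y\<close> consists of the deviations of the specific volume and the temperature from their limits.\<close>

definition vol :: "(real \<Rightarrow> real \<times> real) \<Rightarrow> real \<Rightarrow> real" where "vol y r = vp + fst (y r)"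

definition temp :: "(real \<Rightarrow> real \<times> real) \<Rightarrow> real \<Rightarrow> real" where "temp y r = tp + snd (y r)"

abbreviation admissible :: "(real \<Rightarrow> real \<times> real) \<Rightarrow> bool" where
  "admissible \<equiv> decaying 0 r0 (min vp tp / 2)"

lemma admissible_bounds:
  assumes "admissible y" "r0 \<le> r"
  shows "vp / 2 \<le> vol y r" "vol y r \<le> 3 * vp / 2" "0 < vol y r" "0 < temp y r"
proof -
  have "\<bar>fst (y r)\<bar> \<le> vp / 2" "\<bar>snd (y r)\<bar> \<le> tp / 2"
    using decaying_norm_le[OF assms] norm_fst_le_norm[of "y r"] norm_snd_le_norm[of "y r"] by auto
  then show "vp / 2 \<le> vol y r" "vol y r \<le> 3 * vp / 2" "0 < vol y r" "0 < temp y r"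
    using vp_pos tp_pos by (auto simp: vol_def temp_def)
qed

definition lipschitz_bound :: "nat \<Rightarrow> real \<Rightarrow> (real \<Rightarrow> (real \<Rightarrow> real \<times> real) \<Rightarrow> real \<Rightarrow> real) \<Rightarrow> bool" where
  "lipschitz_bound j c F \<longleftrightarrow>
     (\<forall>u y. \<bar>u\<bar> \<le> 1 \<longrightarrow> admissible y \<longrightarrow> decaying j r0 c (F u y)) \<and>
     (\<forall>u y y' D. \<bar>u\<bar> \<le> 1 \<longrightarrow> admissible y \<longrightarrow> admissible y' \<longrightarrow> decaying k r0 D (\<lambda>r. y r - y' r) \<longrightarrow>
        decaying j r0 (c * D) (\<lambda>r. F u y r - F u y' r))"

lemma lipschitz_boundI:
  assumes "\<And>u y. \<bar>u\<bar> \<le> 1 \<Longrightarrow> admissible y \<Longrightarrow> decaying j r0 c (F u y)"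
    and "\<And>u y y' D. \<bar>u\<bar> \<le> 1 \<Longrightarrow> admissible y \<Longrightarrow> admissible y' \<Longrightarrow> 0 \<le> D \<Longrightarrow>
      decaying k r0 D (\<lambda>r. y r - y' r) \<Longrightarrow> decaying j r0 (c * D) (\<lambda>r. F u y r - F u y' r)"
  shows "lipschitz_bound j c F"
  using assms decaying_const_nonneg[OF _ r0_pos] unfolding lipschitz_bound_def by blast

lemma lipschitz_boundD:
  assumes "lipschitz_bound j c F" "\<bar>u\<bar> \<le> 1" "admissible y"
  shows "decaying j r0 c (F u y)"
    and "admissible y' \<Longrightarrow> decaying k r0 D (\<lambda>r. y r - y' r) \<Longrightarrow> decaying j r0 (c * D) (\<lambda>r. F u y r - F u y' r)"
  using assms unfolding lipschitz_bound_def by blast+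

lemma lipschitz_bound_nonneg:
  assumes "lipschitz_bound j c F"
  shows "0 \<le> c"
proof -
  have "admissible (\<lambda>r. 0)" using vp_pos tp_pos r0_pos by (intro decaying_zero) auto
  then have "decaying j r0 c (F 0 (\<lambda>r. 0))" by (intro lipschitz_boundD(1)[OF assms]) auto
  then show ?thesis by (rule decaying_const_nonneg[OF _ r0_pos])
qed

lemma lipschitz_bound_mono:
  assumes "lipschitz_bound j c F" "c \<le> c'"
  shows "lipschitz_bound j c' F"
proof (rule lipschitz_boundI)
  fix u :: real and y assume y: "\<bar>u\<bar> \<le> 1" "admissible y"
  show "decaying j r0 c' (F u y)"
    by (rule decaying_mono[OF lipschitz_boundD(1)[OF assms(1) y] assms(2) r0_pos])
  fix y' D assume y': "admissible y'" and D: "0 \<le> D" "decaying k r0 D (\<lambda>r. y r - y' r)"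
  show "decaying j r0 (c' * D) (\<lambda>r. F u y r - F u y' r)"
    by (rule decaying_mono[OF lipschitz_boundD(2)[OF assms(1) y y' D(2)] mult_right_mono[OF assms(2) D(1)] r0_pos])
qed

definition lipschitz_decay :: "nat \<Rightarrow> (real \<Rightarrow> (real \<Rightarrow> real \<times> real) \<Rightarrow> real \<Rightarrow> real) \<Rightarrow> bool" where
  "lipschitz_decay j F \<longleftrightarrow> (\<exists>c. lipschitz_bound j c F)"

lemma lipschitz_decayI: "lipschitz_bound j c F \<Longrightarrow> lipschitz_decay j F"
  by (auto simp: lipschitz_decay_def)

lemma lipschitz_decay_weaken:
  assumes "lipschitz_decay j F" "i \<le> j"
  shows "lipschitz_decay i F"
proof -
  obtain l where l: "j = i + l" using assms(2) le_Suc_ex by blast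
  obtain c where c: "lipschitz_bound (i + l) c F" using assms(1) by (auto simp: lipschitz_decay_def l)
  show ?thesis
  proof (rule lipschitz_decayI[OF lipschitz_boundI])
    fix u :: real and y assume y: "\<bar>u\<bar> \<le> 1" "admissible y"
    show "decaying i r0 (c / r0 ^ l) (F u y)"
      by (rule decaying_weaken[OF lipschitz_boundD(1)[OF c y] r0_pos])
    fix y' D assume y': "admissible y'" and D: "decaying k r0 D (\<lambda>r. y r - y' r)"
    show "decaying i r0 (c / r0 ^ l * D) (\<lambda>r. F u y r - F u y' r)"
      using decaying_weaken[OF lipschitz_boundD(2)[OF c y y' D] r0_pos] by simp
  qed
qed

lemma lipschitz_decay_const: "lipschitz_decay 0 (\<lambda>u y r. a)"
  by (rule lipschitz_decayI[OF lipschitz_boundI[where c = "\<bar>a\<bar>"]]) (auto simp: decaying_def)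

lemma lipschitz_decay_velocity: "lipschitz_decay 0 (\<lambda>u y r. u)"
  by (rule lipschitz_decayI[OF lipschitz_boundI[where c = 1]]) (auto simp: decaying_def)

lemma lipschitz_decay_inverse_power: "lipschitz_decay j (\<lambda>u y r. 1 / r ^ j)"
  by (rule lipschitz_decayI[OF lipschitz_boundI[where c = 1]])
    (auto intro!: decaying_zero decaying_inverse_power r0_pos)

lemma lipschitz_decay_\<sigma>: "lipschitz_decay (Suc k) (\<lambda>u y r. \<sigma> r)"
  unfolding \<sigma>_def by (rule lipschitz_decay_inverse_power)

lemma lipschitz_decay_fst: "lipschitz_decay 0 (\<lambda>u y r. fst (y r))"
  and lipschitz_decay_snd: "lipschitz_decay 0 (\<lambda>u y r. snd (y r))"
proof -
  let ?c = "min vp tp / 2 + 1 / r0 ^ k"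
  have bound: "decaying 0 r0 ?c y" if "admissible y" for y
    by (rule decaying_mono[OF that _ r0_pos]) (use r0_pos in simp)
  have diff: "decaying 0 r0 (?c * D) (\<lambda>r. y r - y' r)" if "0 \<le> D" "decaying k r0 D (\<lambda>r. y r - y' r)"
    for D and y y' :: "real \<Rightarrow> real \<times> real"
  proof (rule decaying_mono[OF decaying_weaken_0[OF that(2) r0_pos] _ r0_pos])
    show "D / r0 ^ k \<le> ?c * D"
      using mult_right_mono[of "1 / r0 ^ k" ?c D] that(1) vp_pos tp_pos by simp
  qed
  show "lipschitz_decay 0 (\<lambda>u y r. fst (y r))"
    using bound[THEN decaying_fst] diff[THEN decaying_fst] by (intro lipschitz_decayI[OF lipschitz_boundI]) simp_all
  show "lipschitz_decay 0 (\<lambda>u y r. snd (y r))"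
    using bound[THEN decaying_snd] diff[THEN decaying_snd] by (intro lipschitz_decayI[OF lipschitz_boundI]) simp_all
qed

lemma lipschitz_decay_add:
  assumes "lipschitz_decay j F" "lipschitz_decay j G"
  shows "lipschitz_decay j (\<lambda>u y r. F u y r + G u y r)"
proof -
  obtain c d where c: "lipschitz_bound j c F" and d: "lipschitz_bound j d G"
    using assms by (auto simp: lipschitz_decay_def)
  show ?thesis
  proof (rule lipschitz_decayI[OF lipschitz_boundI])
    fix u :: real and y assume y: "\<bar>u\<bar> \<le> 1" "admissible y"
    note F = lipschitz_boundD[OF c y] and G = lipschitz_boundD[OF d y]
    show "decaying j r0 (c + d) (\<lambda>r. F u y r + G u y r)" by (rule decaying_add[OF F(1) G(1)])
    fix y' D assume y': "admissible y'" and D: "decaying k r0 D (\<lambda>r. y r - y' r)"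
    show "decaying j r0 ((c + d) * D) (\<lambda>r. F u y r + G u y r - (F u y' r + G u y' r))"
      using decaying_add[OF F(2)[OF y' D] G(2)[OF y' D]] by (simp add: distrib_right add_diff_add)
  qed
qed

lemma lipschitz_decay_mult:
  assumes "lipschitz_decay i F" "lipschitz_decay j G" "l \<le> i + j"
  shows "lipschitz_decay l (\<lambda>u y r. F u y r * G u y r)"
proof -
  obtain c d where c: "lipschitz_bound i c F" and d: "lipschitz_bound j d G"
    using assms by (auto simp: lipschitz_decay_def)
  have "lipschitz_bound (i + j) (2 * c * d) (\<lambda>u y r. F u y r * G u y r)"
  proof (rule lipschitz_boundI)
    fix u :: real and y assume y: "\<bar>u\<bar> \<le> 1" "admissible y"
    note F = lipschitz_boundD[OF c y] and G = lipschitz_boundD[OF d y]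
    show "decaying (i + j) r0 (2 * c * d) (\<lambda>r. F u y r * G u y r)"
      by (rule decaying_mono[OF decaying_mult[OF F(1) G(1)] _ r0_pos])
        (use c d lipschitz_bound_nonneg in simp)
    fix y' D assume y': "admissible y'" and D: "decaying k r0 D (\<lambda>r. y r - y' r)"
    show "decaying (i + j) r0 (2 * c * d * D) (\<lambda>r. F u y r * G u y r - F u y' r * G u y' r)"
      using decaying_mult_diff[OF F(1) lipschitz_boundD(1)[OF d y(1) y'] F(2)[OF y' D] G(2)[OF y' D]]
      by (simp add: algebra_simps)
  qed
  then show ?thesis using assms(3) by (blast intro: lipschitz_decayI lipschitz_decay_weaken)
qed

lemma lipschitz_decay_diff:
  assumes "lipschitz_decay j F" "lipschitz_decay j G"
  shows "lipschitz_decay j (\<lambda>u y r. F u y r - G u y r)"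
  using lipschitz_decay_add[OF assms(1) lipschitz_decay_mult[OF lipschitz_decay_const[of "-1"] assms(2), of j]] by simp

lemma lipschitz_decay_square:
  "lipschitz_decay j F \<Longrightarrow> l \<le> j + j \<Longrightarrow> lipschitz_decay l (\<lambda>u y r. (F u y r)\<^sup>2)"
  unfolding power2_eq_square by (rule lipschitz_decay_mult)

lemma lipschitz_decay_at_boundary:
  assumes "lipschitz_decay 0 F"
  shows "lipschitz_decay 0 (\<lambda>u y r. F u y r0)"
proof -
  obtain c where c: "lipschitz_bound 0 c F" using assms by (auto simp: lipschitz_decay_def)
  show ?thesis
  proof (rule lipschitz_decayI[OF lipschitz_boundI])
    fix u :: real and y assume y: "\<bar>u\<bar> \<le> 1" "admissible y"
    note F = lipschitz_boundD[OF c y]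
    show "decaying 0 r0 c (\<lambda>r. F u y r0)"
      using decaying_norm_le[OF F(1), of r0] by (simp add: decaying_def)
    fix y' D assume y': "admissible y'" and D: "decaying k r0 D (\<lambda>r. y r - y' r)"
    show "decaying 0 r0 (c * D) (\<lambda>r. F u y r0 - F u y' r0)"
      using decaying_norm_le[OF F(2)[OF y' D], of r0] by (simp add: decaying_def)
  qed
qed

lemma lipschitz_decay_tail_integral:
  assumes F: "lipschitz_decay (Suc j) F" and j: "0 < j"
  shows "lipschitz_decay j (\<lambda>u y. tail_integral (F u y))"
proof -
  obtain c where c: "lipschitz_bound (Suc j) c F" using assms by (auto simp: lipschitz_decay_def)
  show ?thesis
  proof (rule lipschitz_decayI[OF lipschitz_boundI])
    fix u :: real and y assume y: "\<bar>u\<bar> \<le> 1" "admissible y"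
    show "decaying j r0 (c / j) (tail_integral (F u y))"
      by (rule tail_integral_decaying(3)[OF lipschitz_boundD(1)[OF c y] r0_pos j])
    fix y' D assume y': "admissible y'" and D: "decaying k r0 D (\<lambda>r. y r - y' r)"
    have "decaying j r0 (c * D / j) (tail_integral (\<lambda>r. F u y r - F u y' r))"
      by (rule tail_integral_decaying(3)[OF lipschitz_boundD(2)[OF c y y' D] r0_pos j])
    then have "decaying j r0 (c * D / j) (\<lambda>r. tail_integral (F u y) r - tail_integral (F u y') r)"
      by (rule decaying_cong)
        (rule tail_integral_diff[OF lipschitz_boundD(1)[OF c y] lipschitz_boundD(1)[OF c y(1) y'] r0_pos j])
    then show "decaying j r0 (c / j * D) (\<lambda>r. tail_integral (F u y) r - tail_integral (F u y') r)" by simp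
  qed
qed

lemma lipschitz_decay_vol: "lipschitz_decay 0 (\<lambda>u y. vol y)"
  unfolding vol_def[abs_def] by (intro lipschitz_decay_add lipschitz_decay_const lipschitz_decay_fst)

lemma inverse_vol_decaying:
  assumes "admissible y"
  shows "decaying 0 r0 (2 / vp) (\<lambda>r. 1 / vol y r)"
proof (rule decayingI)
  have "vol y r \<noteq> 0" if "r0 \<le> r" for r using admissible_bounds(3)[OF assms that] by simp
  moreover have "continuous_on {r0..} (vol y)"
    unfolding vol_def[abs_def] by (intro continuous_intros decaying_continuous_on[OF assms])
  ultimately show "continuous_on {r0..} (\<lambda>r. 1 / vol y r)" by (intro continuous_intros) auto
  show "norm (1 / vol y r) \<le> 2 / vp / r ^ 0" if "r0 \<le> r" for r
    using admissible_bounds[OF assms that] vp_pos by (simp add: field_simps)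
qed

lemma lipschitz_decay_inverse_vol: "lipschitz_decay 0 (\<lambda>u y r. 1 / vol y r)"
proof -
  define c where "c = 2 / vp * (2 / vp) * (1 / r0 ^ k)"
  have c: "0 \<le> c" using vp_pos r0_pos by (simp add: c_def)
  show ?thesis
  proof (rule lipschitz_decayI[OF lipschitz_boundI])
    fix y assume y: "admissible y"
    show "decaying 0 r0 (2 / vp + c) (\<lambda>r. 1 / vol y r)"
      using inverse_vol_decaying[OF y] by (rule decaying_mono) (use c r0_pos in auto)
    fix y' D assume y': "admissible y'" and D: "0 \<le> D" "decaying k r0 D (\<lambda>r. y r - y' r)"
    have "decaying 0 r0 (D / r0 ^ k) (\<lambda>r. - (fst (y r - y' r)))"
      by (intro decaying_minus decaying_fst decaying_weaken_0 D r0_pos)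
    with inverse_vol_decaying[OF y] inverse_vol_decaying[OF y']
    have "decaying (0 + 0 + 0) r0 (2 / vp * (2 / vp) * (D / r0 ^ k))
        (\<lambda>r. 1 / vol y r * (1 / vol y' r) * - (fst (y r - y' r)))"
      by (intro decaying_mult)
    then have "decaying 0 r0 (c * D) (\<lambda>r. 1 / vol y r * (1 / vol y' r) * - (fst (y r - y' r)))"
      by (simp add: c_def)
    then have "decaying 0 r0 (c * D) (\<lambda>r. 1 / vol y r - 1 / vol y' r)"
    proof (rule decaying_cong)
      show "1 / vol y r * (1 / vol y' r) * - (fst (y r - y' r)) = 1 / vol y r - 1 / vol y' r" if "r0 \<le> r" for r
        using admissible_bounds(3)[OF y that] admissible_bounds(3)[OF y' that]
        by (simp add: vol_def field_simps)
    qed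
    moreover have "c * D \<le> (2 / vp + c) * D" using vp_pos D(1) by (intro mult_right_mono) auto
    ultimately show "decaying 0 r0 ((2 / vp + c) * D) (\<lambda>r. 1 / vol y r - 1 / vol y' r)"
      using r0_pos by (rule decaying_mono)
  qed
qed

lemma lipschitz_decay_tail: "lipschitz_decay (2 * k + 2) (\<lambda>u y. tail (vol y))"
proof -
  have "lipschitz_decay (2 * k + 2) (\<lambda>u y r. (\<sigma> r)\<^sup>2)"
    by (rule lipschitz_decay_square[OF lipschitz_decay_\<sigma>]) simp
  then have "lipschitz_decay (2 * k + 2) (\<lambda>u y r. vol y r * (\<sigma> r)\<^sup>2)"
    by (rule lipschitz_decay_mult[OF lipschitz_decay_vol]) simp
  then have "lipschitz_decay (Suc (2 * k + 2)) (\<lambda>u y r. vol y r * (\<sigma> r)\<^sup>2 * (1 / r))"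
    by (rule lipschitz_decay_mult[OF _ lipschitz_decay_inverse_power[of 1, unfolded power_one_right]]) simp
  then show ?thesis
    unfolding tail_def by (rule lipschitz_decay_tail_integral) simp
qed

text \<open>In the outflow problem the density at the boundary, and with it the mass flux,
  is an unknown, read off from the state.\<close>

definition unit_mass_flux :: "(real \<Rightarrow> real \<times> real) \<Rightarrow> real" where
  "unit_mass_flux y = r0 ^ Suc k * (1 / vol y r0)"

definition mass_flux :: "real \<Rightarrow> (real \<Rightarrow> real \<times> real) \<Rightarrow> real" where
  "mass_flux u y = u * unit_mass_flux y"

definition heat_source :: "real \<Rightarrow> (real \<Rightarrow> real \<times> real) \<Rightarrow> real \<Rightarrow> real" where
  "heat_source u y r = unit_mass_flux y * (cV * snd (y r) + R * tp / vp * fst (y r)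
     + (mass_flux u y)\<^sup>2 * (m * vol y r * tail (vol y) r - (vol y r)\<^sup>2 * (\<sigma> r)\<^sup>2 * (1 / 2))
     + 2 * nu * m * mass_flux u y * ((vol y r)\<^sup>2 * \<sigma> r * (1 / r)))"

definition inertia :: "(real \<Rightarrow> real \<times> real) \<Rightarrow> real \<Rightarrow> real" where
  "inertia y r = (unit_mass_flux y)\<^sup>2 * (vol y r * (\<sigma> r)\<^sup>2 - m * tail (vol y) r)"

lemma unit_mass_flux_pos: "admissible y \<Longrightarrow> 0 < unit_mass_flux y"
  using admissible_bounds(3)[of y r0] r0_pos by (simp add: unit_mass_flux_def)

lemma lipschitz_decay_unit_mass_flux: "lipschitz_decay 0 (\<lambda>u y r. unit_mass_flux y)"
  unfolding unit_mass_flux_def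
  by (rule lipschitz_decay_mult[OF lipschitz_decay_const
      lipschitz_decay_at_boundary[OF lipschitz_decay_inverse_vol]]) simp

lemma lipschitz_decay_inertia: "lipschitz_decay k (\<lambda>u y. inertia y)"
proof -
  have "lipschitz_decay k (\<lambda>u y r. vol y r * (\<sigma> r)\<^sup>2)"
    by (rule lipschitz_decay_mult[OF lipschitz_decay_vol lipschitz_decay_square[OF lipschitz_decay_\<sigma>, of k]]) auto
  moreover have "lipschitz_decay k (\<lambda>u y r. m * tail (vol y) r)"
    by (rule lipschitz_decay_mult[OF lipschitz_decay_const lipschitz_decay_tail]) simp
  ultimately have "lipschitz_decay k (\<lambda>u y r. vol y r * (\<sigma> r)\<^sup>2 - m * tail (vol y) r)"
    by (rule lipschitz_decay_diff)
  then show ?thesis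
    unfolding inertia_def[abs_def]
    by (rule lipschitz_decay_mult[OF lipschitz_decay_square[OF lipschitz_decay_unit_mass_flux le0]]) simp
qed

lemma lipschitz_decay_heat_source: "lipschitz_decay 0 heat_source"
proof -
  note [intro] = lipschitz_decay_const lipschitz_decay_velocity lipschitz_decay_fst lipschitz_decay_snd
    lipschitz_decay_vol lipschitz_decay_unit_mass_flux lipschitz_decay_weaken[OF lipschitz_decay_tail le0]
    lipschitz_decay_weaken[OF lipschitz_decay_\<sigma> le0]
    lipschitz_decay_weaken[OF lipschitz_decay_inverse_power[of 1, unfolded power_one_right] le0]
  show ?thesis
    unfolding heat_source_def[abs_def] mass_flux_def
    by (intro lipschitz_decay_add lipschitz_decay_diff lipschitz_decay_mult[of 0 _ 0 _ 0]
        lipschitz_decay_square[of 0 _ 0]) auto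
qed

end

section \<open>The linearised problem\<close>

context gas
begin

definition \<beta> :: real where "\<beta> = R * tp / (mu * vp\<^sup>2)"

lemma \<beta>_pos: "0 < \<beta>"
  using R_pos tp_pos mu_pos vp_pos by (simp add: \<beta>_def)

text \<open>The forcing makes the integrated momentum equation a relaxation equation for the deviation of the volume,
  which enters the forcing only quadratically or multiplied by the squared velocity. The temperature of the new
  state is used there since its coefficient is not small.\<close>

definition quadratic_forcing :: "(real \<Rightarrow> real \<times> real) \<Rightarrow> real \<Rightarrow> real" where
  "quadratic_forcing y r = fst (y r) * fst (y r) * (1 / vol y r)"

definition thermal_forcing :: "(real \<Rightarrow> real \<times> real) \<Rightarrow> (real \<Rightarrow> real) \<Rightarrow> real \<Rightarrow> real" where
  "thermal_forcing y Q r = vp\<^sup>2 / tp * (Q r * (1 / vol y r))"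

definition inertial_forcing :: "real \<Rightarrow> (real \<Rightarrow> real \<times> real) \<Rightarrow> real \<Rightarrow> real" where
  "inertial_forcing u y r = vp\<^sup>2 / (R * tp) * (u * u * inertia y r)"

definition forcing :: "real \<Rightarrow> (real \<Rightarrow> real \<times> real) \<Rightarrow> (real \<Rightarrow> real) \<Rightarrow> real \<Rightarrow> real" where
  "forcing u y Q r = quadratic_forcing y r + thermal_forcing y Q r + inertial_forcing u y r"

text \<open>Only for inflow is the relaxation equation stable, so that the boundary value of the volume may be prescribed;
  for outflow boundedness selects the solution.\<close>

definition linearized :: "real \<Rightarrow> real \<Rightarrow> real \<Rightarrow> (real \<Rightarrow> real \<times> real) \<Rightarrow> (real \<Rightarrow> real \<times> real) \<Rightarrow> bool" where
  "linearized u p0 q0 y Y \<longleftrightarrow>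
     (\<exists>B. decaying k r0 B Y) \<and> (0 < u \<longrightarrow> fst (Y r0) = p0) \<and> snd (Y r0) = q0 \<and>
     deriv_from r0 (\<lambda>r. fst (Y r)) (\<lambda>r. - (\<beta> * r ^ Suc k / mass_flux u y) * (fst (Y r) - forcing u y (snd \<circ> Y) r)) \<and>
     (\<exists>E. deriv_from r0 (\<lambda>r. snd (Y r)) (\<lambda>r. (u * heat_source u y r - E) / (kappa * r ^ Suc k)))"

lemma viscous_stress_of_state:
  assumes y: "admissible y" and r: "r0 \<le> r"
  shows "viscous_stress (mass_flux u y) (vol y) (temp y) r = mu * \<beta> * (forcing u y (snd \<circ> y) r - fst (y r))"
proof -
  define s where "s = 1 / vol y r"
  define J where "J = (mass_flux u y)\<^sup>2 * (vol y r * (\<sigma> r)\<^sup>2 - m * tail (vol y) r)"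
  have vol: "(vp + fst (y r)) * s = 1" using admissible_bounds(3)[OF assms] by (simp add: s_def vol_def)
  have "fst (y r) * fst (y r) * s - fst (y r) - vp * (vp * s - 1)
      = (fst (y r) - vp) * ((vp + fst (y r)) * s - 1)"
    by (simp add: algebra_simps)
  then have quadratic: "fst (y r) * fst (y r) * s - fst (y r) = vp * (vp * s - 1)" by (simp add: vol)
  have "u * u * inertia y r = J" by (simp add: J_def inertia_def mass_flux_def power2_eq_square)
  then have "forcing u y (snd \<circ> y) r - fst (y r)
      = vp * (vp * s - 1) + vp\<^sup>2 / tp * (snd (y r) * s) + vp\<^sup>2 / (R * tp) * J"
    by (simp add: forcing_def quadratic_forcing_def thermal_forcing_def inertial_forcing_def
      quadratic[symmetric] flip: s_def)
  moreover have "mu * \<beta> = R * tp / vp\<^sup>2" using mu_pos by (simp add: \<beta>_def)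
  moreover have "R * tp / vp\<^sup>2 * (vp * (vp * s - 1) + vp\<^sup>2 / tp * (snd (y r) * s) + vp\<^sup>2 / (R * tp) * J)
      = R * (tp + snd (y r)) * s - R * tp / vp + J"
    using R_pos tp_pos vp_pos by (simp add: field_simps power2_eq_square)
  ultimately have "mu * \<beta> * (forcing u y (snd \<circ> y) r - fst (y r)) = R * (tp + snd (y r)) * s - R * tp / vp + J"
    by (simp only:)
  then show ?thesis by (simp add: viscous_stress_def temp_def J_def s_def)
qed

lemma heat_flux_of_state:
  "heat_flux (mass_flux u y) (vol y) (temp y) r
     = u * heat_source u y r + mass_flux u y * (cV * tp + R * tp / vp * vp)"
  by (simp add: heat_flux_def heat_source_def vol_def[of y r] temp_def mass_flux_def algebra_simps add_divide_distrib
      power2_eq_square power3_eq_cube)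

lemma mass_flux_nonzero: "admissible y \<Longrightarrow> u \<noteq> 0 \<Longrightarrow> mass_flux u y \<noteq> 0"
  and mass_flux_pos_iff: "admissible y \<Longrightarrow> 0 < mass_flux u y \<longleftrightarrow> 0 < u"
  using unit_mass_flux_pos[of y] by (auto simp: mass_flux_def zero_less_mult_iff)

lemma linearized_self_iff:
  assumes y: "admissible y"
  shows "linearized u p0 q0 y y \<longleftrightarrow> (\<exists>B. decaying k r0 B y) \<and> (0 < u \<longrightarrow> fst (y r0) = p0) \<and> snd (y r0) = q0 \<and>
    first_order_system (mass_flux u y) (vol y) (temp y)"
proof -
  let ?M = "mass_flux u y"
  have "viscous_stress ?M (vol y) (temp y) r / (mu * ?M * \<sigma> r)
      = - (\<beta> * r ^ Suc k / ?M) * (fst (y r) - forcing u y (snd \<circ> y) r)" if "r0 \<le> r" for r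
  proof -
    have "viscous_stress ?M (vol y) (temp y) r / (mu * ?M * \<sigma> r)
        = \<beta> * (forcing u y (snd \<circ> y) r - fst (y r)) / (?M * \<sigma> r)"
      using mu_pos by (simp add: viscous_stress_of_state[OF y that])
    then show ?thesis by (simp add: \<sigma>_def algebra_simps diff_divide_distrib)
  qed
  then have "deriv_from r0 (\<lambda>r. fst (y r)) (\<lambda>r. - (\<beta> * r ^ Suc k / ?M) * (fst (y r) - forcing u y (snd \<circ> y) r)) \<longleftrightarrow>
      deriv_from r0 (vol y) (\<lambda>r. viscous_stress ?M (vol y) (temp y) r / (mu * ?M * \<sigma> r))"
    unfolding vol_def[abs_def] deriv_from_const_add_iff by simp
  moreover have "(\<exists>E. deriv_from r0 (\<lambda>r. snd (y r)) (\<lambda>r. (u * heat_source u y r - E) / (kappa * r ^ Suc k))) \<longleftrightarrow>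
      (\<exists>E. deriv_from r0 (temp y) (\<lambda>r. (heat_flux ?M (vol y) (temp y) r - E) / (kappa * r ^ Suc k)))"
    (is "(\<exists>E. ?heat E) \<longleftrightarrow> (\<exists>E. ?flux E)")
  proof -
    have "?flux (E + ?M * (cV * tp + R * tp / vp * vp)) \<longleftrightarrow> ?heat E" for E
      unfolding temp_def[abs_def] deriv_from_const_add_iff heat_flux_of_state[unfolded temp_def[abs_def]] by simp
    then show ?thesis by (metis diff_add_cancel)
  qed
  ultimately show ?thesis unfolding linearized_def first_order_system_def by blast
qed

lemma linearized_cong:
  assumes "linearized u p0 q0 y Y" "\<And>r. r0 \<le> r \<Longrightarrow> Y r = Z r"
  shows "linearized u p0 q0 y Z"
proof -
  have forcing: "forcing u y (snd \<circ> Y) r = forcing u y (snd \<circ> Z) r" if "r0 \<le> r" for r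
    using assms(2)[OF that] by (simp add: forcing_def thermal_forcing_def)
  have "deriv_from r0 (\<lambda>r. fst (Y r)) (\<lambda>r. - (\<beta> * r ^ Suc k / mass_flux u y) * (fst (Y r) - forcing u y (snd \<circ> Y) r))"
    using assms(1) unfolding linearized_def by blast
  then have "deriv_from r0 (\<lambda>r. fst (Z r))
      (\<lambda>r. - (\<beta> * r ^ Suc k / mass_flux u y) * (fst (Z r) - forcing u y (snd \<circ> Z) r))"
    by (rule deriv_from_cong) (simp_all only: assms(2) forcing)
  moreover obtain E where "deriv_from r0 (\<lambda>r. snd (Y r)) (\<lambda>r. (u * heat_source u y r - E) / (kappa * r ^ Suc k))"
    using assms(1) unfolding linearized_def by blast
  then have "deriv_from r0 (\<lambda>r. snd (Z r)) (\<lambda>r. (u * heat_source u y r - E) / (kappa * r ^ Suc k))"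
    by (rule deriv_from_cong) (simp_all add: assms(2))
  moreover obtain B where "decaying k r0 B Y" using assms(1) unfolding linearized_def by blast
  then have "decaying k r0 B Z" by (rule decaying_cong) (rule assms(2))
  moreover have "0 < u \<longrightarrow> fst (Z r0) = p0" "snd (Z r0) = q0"
    using assms by (simp_all add: linearized_def)
  ultimately show ?thesis unfolding linearized_def by blast
qed

end

locale gas_bounds = gas +
  fixes c :: real
  assumes c_ge_1: "1 \<le> c" and c_ge_r0_power: "r0 ^ k \<le> c" and c_ge_inverse_r0_power: "1 / r0 ^ k \<le> c"
    and c_ge_area: "3 * r0 ^ Suc k \<le> c" and c_ge_inverse_area: "3 / r0 ^ Suc k \<le> c"
    and c_ge_conductivity: "2 / (kappa * k) \<le> c" and c_ge_thermal: "vp\<^sup>2 / tp \<le> c"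
    and c_ge_inertial: "vp\<^sup>2 / (R * tp) \<le> c" and c_ge_relaxation: "2 * real k / (\<beta> * r0 ^ (k + 2)) \<le> c"
    and c_ge_limits: "2 / min vp tp \<le> c" and c_ge_vp: "2 * vp \<le> c" and c_ge_vp_square: "2 * vp\<^sup>2 \<le> c"
    and c_ge_inverse_vp_square: "2 / vp\<^sup>2 \<le> c"
    and bound_heat_source: "lipschitz_bound 0 c heat_source" and bound_inertia: "lipschitz_bound k c (\<lambda>u y. inertia y)"
    and bound_inverse_vol: "lipschitz_bound 0 c (\<lambda>u y r. 1 / vol y r)"
    and bound_unit_mass_flux: "lipschitz_bound 0 c (\<lambda>u y r. unit_mass_flux y)"

context gas_bounds
begin

definition radius :: real where "radius = 1 / (32 * c\<^sup>2)"

lemma c_pos: "0 < c" using c_ge_1 by simp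

lemma c_power_mono: "i \<le> j \<Longrightarrow> c ^ i \<le> c ^ j" using c_ge_1 by (rule power_increasing[rotated])

lemma radius_pos: "0 < radius" using c_pos by (simp add: radius_def)

lemma c_radius: "c * c * radius = 1 / 32" "c * radius \<le> 1 / 32" "radius \<le> 1 / 32"
proof -
  show square: "c * c * radius = 1 / 32" using c_pos by (simp add: radius_def power2_eq_square)
  have "1 * radius \<le> c * radius" using c_ge_1 radius_pos by (intro mult_right_mono) auto
  moreover have "1 * (c * radius) \<le> c * (c * radius)" using c_ge_1 radius_pos by (intro mult_right_mono) auto
  ultimately show "c * radius \<le> 1 / 32" "radius \<le> 1 / 32" using square by (auto simp: mult.assoc)
qed

lemma admissible_if_decaying_radius:
  assumes "decaying k r0 radius y"
  shows "admissible y"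
proof (rule decaying_mono[OF decaying_weaken_0[OF assms r0_pos] _ r0_pos])
  have "radius * (1 / r0 ^ k) \<le> radius * c" using c_ge_inverse_r0_power radius_pos by (intro mult_left_mono) auto
  also have "\<dots> = 1 / (32 * c)" using c_pos by (simp add: radius_def power2_eq_square)
  also have "\<dots> \<le> min vp tp / 2"
  proof -
    have half: "1 / (32 * c) \<le> w / 2" if "2 / w \<le> c" "0 < w" for w
      using that c_pos by (simp add: field_simps)
    show ?thesis by (intro half c_ge_limits) (simp add: vp_pos tp_pos)
  qed
  finally show "radius / r0 ^ k \<le> min vp tp / 2" by simp
qed

lemma decaying_0_if_decaying:
  assumes "decaying k r0 B f"
  shows "decaying 0 r0 (c * B) f"
proof (rule decaying_mono[OF decaying_weaken_0[OF assms r0_pos] _ r0_pos])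
  show "B / r0 ^ k \<le> c * B"
    using mult_right_mono[OF c_ge_inverse_r0_power decaying_const_nonneg[OF assms r0_pos]] by simp
qed

end

locale small_data = gas_bounds +
  fixes \<delta> u p0 q0 :: real
  assumes u: "u \<noteq> 0" "\<bar>u\<bar> \<le> \<delta>" and p0: "0 < u \<Longrightarrow> \<bar>p0\<bar> \<le> \<delta>" and q0: "\<bar>q0\<bar> \<le> \<delta>"
    and small: "512 * c ^ 6 * \<delta> \<le> 1"
begin

lemma \<delta>_pos: "0 < \<delta>" using u by linarith

lemma c_power_\<delta>: "i \<le> 6 \<Longrightarrow> c ^ i * \<delta> \<le> 1 / 512"
proof -
  assume "i \<le> 6"
  then have "c ^ i * \<delta> \<le> c ^ 6 * \<delta>" using \<delta>_pos by (intro mult_right_mono c_power_mono) auto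
  then show ?thesis using small by linarith
qed

lemma abs_u_le_1: "\<bar>u\<bar> \<le> 1" using u(2) c_power_\<delta>[of 0] by simp

lemma relaxation_rate_small:
  assumes "admissible y"
  shows "2 * real k * mass_flux u y \<le> \<beta> * r0 ^ (k + 2)"
proof -
  have "\<bar>unit_mass_flux y\<bar> \<le> c"
    using decaying_norm_le[OF lipschitz_boundD(1)[OF bound_unit_mass_flux abs_u_le_1 assms], of r0] by simp
  then have "\<bar>mass_flux u y\<bar> \<le> \<delta> * c"
    unfolding mass_flux_def abs_mult using u by (intro mult_mono) auto
  then have "2 * real k * mass_flux u y \<le> 2 * real k * (\<delta> * c)" by (intro mult_left_mono) auto
  also have "\<dots> \<le> (c * (\<beta> * r0 ^ (k + 2))) * (\<delta> * c)"
    using c_ge_relaxation \<beta>_pos r0_pos \<delta>_pos c_pos by (intro mult_right_mono) (auto simp: pos_divide_le_eq)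
  also have "\<dots> = (c\<^sup>2 * \<delta>) * (\<beta> * r0 ^ (k + 2))" by (simp add: power2_eq_square mult_ac)
  also have "\<dots> \<le> 1 * (\<beta> * r0 ^ (k + 2))"
    using c_power_\<delta>[of 2] \<beta>_pos r0_pos by (intro mult_right_mono) auto
  finally show ?thesis by simp
qed

lemma heat_source_decaying: "admissible y \<Longrightarrow> decaying 0 r0 (\<delta> * c) (\<lambda>r. u * heat_source u y r)"
  using decaying_mono[OF decaying_cmult[OF lipschitz_boundD(1)[OF bound_heat_source abs_u_le_1], of y u], of "\<delta> * c"]
    u(2) c_pos r0_pos by simp

lemma temperature_decaying:
  assumes "admissible y" "Q r0 = q0" "(Q \<longlongrightarrow> 0) at_top"
    "deriv_from r0 Q (\<lambda>r. (u * heat_source u y r - E) / (kappa * r ^ Suc k))"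
  shows "decaying k r0 (2 * c\<^sup>2 * \<delta>) Q"
proof -
  have "decaying k r0 (r0 ^ k * \<bar>Q r0\<bar> + 2 * (\<delta> * c) / (kappa * k)) Q"
    by (rule heat_equation_decaying[OF heat_source_decaying r0_pos k_pos kappa_pos]) (fact assms)+
  moreover have "r0 ^ k * \<bar>Q r0\<bar> + 2 * (\<delta> * c) / (kappa * k) \<le> 2 * c\<^sup>2 * \<delta>"
  proof -
    have "r0 ^ k * \<bar>Q r0\<bar> \<le> c * \<delta>"
      using c_ge_r0_power q0 assms(2) r0_pos c_pos by (intro mult_mono) auto
    also have "\<dots> \<le> c\<^sup>2 * \<delta>" using c_power_mono[of 1 2] \<delta>_pos by (intro mult_right_mono) auto
    finally have "r0 ^ k * \<bar>Q r0\<bar> \<le> c\<^sup>2 * \<delta>" .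
    moreover have "2 / (kappa * k) * (\<delta> * c) \<le> c * (\<delta> * c)"
      using c_ge_conductivity \<delta>_pos c_pos by (intro mult_right_mono) auto
    ultimately show ?thesis by (simp add: power2_eq_square mult_ac)
  qed
  ultimately show ?thesis using r0_pos by (rule decaying_mono)
qed

lemma quadratic_forcing_decaying:
  assumes rad: "decaying k r0 radius y" and B: "decaying k r0 B y"
  shows "decaying k r0 (B / 32) (quadratic_forcing y)"
proof -
  note s = lipschitz_boundD(1)[OF bound_inverse_vol abs_u_le_1 admissible_if_decaying_radius[OF rad]]
  have "decaying (0 + k + 0) r0 (c * radius * B * c) (quadratic_forcing y)"
    unfolding quadratic_forcing_def[abs_def] by (intro decaying_mult decaying_fst s B decaying_0_if_decaying rad)
  moreover have "c * radius * B * c = B / 32" using c_radius(1) by (simp add: mult_ac)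
  ultimately show ?thesis by simp
qed

lemma thermal_forcing_decaying:
  assumes y: "admissible y" and Q: "decaying k r0 (2 * c\<^sup>2 * \<delta>) Q"
  shows "decaying k r0 (2 * c ^ 4 * \<delta>) (thermal_forcing y Q)"
proof -
  have bound: "decaying (k + 0) r0 (\<bar>vp\<^sup>2 / tp\<bar> * (2 * c\<^sup>2 * \<delta> * c)) (thermal_forcing y Q)"
    unfolding thermal_forcing_def[abs_def]
    by (intro decaying_cmult decaying_mult lipschitz_boundD(1)[OF bound_inverse_vol abs_u_le_1 y] Q)
  have "\<bar>vp\<^sup>2 / tp\<bar> * (2 * c\<^sup>2 * \<delta> * c) \<le> c * (2 * c\<^sup>2 * \<delta> * c)"
    using c_ge_thermal tp_pos c_pos \<delta>_pos by (intro mult_right_mono) auto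
  also have "\<dots> = 2 * c ^ 4 * \<delta>" by (simp add: power2_eq_square power4_eq_xxxx mult_ac)
  finally show ?thesis by (rule decaying_mono[OF bound[unfolded add_0_right] _ r0_pos])
qed

lemma decaying_inertial_factor:
  assumes F: "decaying k r0 (c * X) F" and X: "0 \<le> X"
  shows "decaying k r0 (c\<^sup>2 * \<delta> * X) (\<lambda>r. vp\<^sup>2 / (R * tp) * (u * u * F r))"
proof -
  have "\<bar>vp\<^sup>2 / (R * tp)\<bar> * (\<bar>u * u\<bar> * (c * X)) \<le> c * (1 * \<delta> * (c * X))"
    unfolding abs_mult using c_ge_inertial R_pos tp_pos c_pos u abs_u_le_1 X by (intro mult_mono) auto
  also have "\<dots> = c\<^sup>2 * \<delta> * X" by (simp add: power2_eq_square mult_ac)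
  finally show ?thesis
    using decaying_cmult[OF decaying_cmult[OF F]] r0_pos by (metis decaying_mono)
qed

lemma inertial_forcing_decaying:
  assumes "admissible y"
  shows "decaying k r0 (c\<^sup>2 * \<delta>) (inertial_forcing u y)"
  using decaying_inertial_factor[of 1 "inertia y"] lipschitz_boundD(1)[OF bound_inertia abs_u_le_1 assms]
  by (simp add: inertial_forcing_def[abs_def])

lemma forcing_decaying:
  assumes rad: "decaying k r0 radius y" and B: "decaying k r0 B y" and Q: "decaying k r0 (2 * c\<^sup>2 * \<delta>) Q"
  shows "decaying k r0 (B / 32 + 3 * c ^ 4 * \<delta>) (forcing u y Q)"
proof -
  note y = admissible_if_decaying_radius[OF rad]
  have "c\<^sup>2 * \<delta> \<le> c ^ 4 * \<delta>" using \<delta>_pos by (intro mult_right_mono c_power_mono) auto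
  then have "B / 32 + 2 * c ^ 4 * \<delta> + c\<^sup>2 * \<delta> \<le> B / 32 + 3 * c ^ 4 * \<delta>" by linarith
  then show ?thesis
    unfolding forcing_def[abs_def] using r0_pos
    by (intro decaying_mono[OF decaying_add[OF decaying_add[OF quadratic_forcing_decaying[OF rad B]
            thermal_forcing_decaying[OF y Q]] inertial_forcing_decaying[OF y]]])
qed

lemma boundary_volume_le:
  assumes "0 < u" "0 \<le> B"
  shows "\<bar>p0\<bar> \<le> 2 * (B / 32 + 3 * c ^ 4 * \<delta>) / r0 ^ k"
proof -
  have "\<bar>p0\<bar> * r0 ^ k \<le> \<delta> * c" using p0[OF assms(1)] c_ge_r0_power r0_pos \<delta>_pos by (intro mult_mono) auto
  also have "\<dots> \<le> c ^ 4 * \<delta>" using mult_right_mono[OF c_power_mono[of 1 4], of \<delta>] \<delta>_pos by (simp add: mult.commute)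
  also have "\<dots> \<le> 2 * (B / 32 + 3 * c ^ 4 * \<delta>)"
    using assms(2) mult_nonneg_nonneg[of "c ^ 4" \<delta>] c_pos \<delta>_pos by simp
  finally show ?thesis using r0_pos by (simp add: pos_le_divide_eq)
qed

lemma state_decaying:
  assumes Q: "decaying k r0 (2 * c\<^sup>2 * \<delta>) (\<lambda>r. snd (Y r))"
    and P: "decaying k r0 (2 * (B / 32 + 3 * c ^ 4 * \<delta>)) (\<lambda>r. fst (Y r))"
    and B: "0 \<le> B"
  shows "decaying k r0 (B / 2 + 8 * c ^ 4 * \<delta>) Y"
proof (rule decaying_mono[OF decaying_Pair[OF P Q] _ r0_pos])
  have "c\<^sup>2 * \<delta> \<le> c ^ 4 * \<delta>" using c_power_mono[of 2 4] \<delta>_pos by (intro mult_right_mono) auto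
  then show "2 * (B / 32 + 3 * c ^ 4 * \<delta>) + 2 * c\<^sup>2 * \<delta> \<le> B / 2 + 8 * c ^ 4 * \<delta>"
    using B unfolding distrib_left by linarith
qed

lemma linearized_temperature_decaying:
  assumes "admissible y" "linearized u p0 q0 y Y"
  shows "decaying k r0 (2 * c\<^sup>2 * \<delta>) (\<lambda>r. snd (Y r))"
proof -
  obtain B where "decaying k r0 B Y" using assms(2) unfolding linearized_def by blast
  then have "((\<lambda>r. snd (Y r)) \<longlongrightarrow> 0) at_top" by (rule decaying_tendsto_0[OF decaying_snd k_pos])
  moreover obtain E where "deriv_from r0 (\<lambda>r. snd (Y r)) (\<lambda>r. (u * heat_source u y r - E) / (kappa * r ^ Suc k))"
    "snd (Y r0) = q0"
    using assms(2) unfolding linearized_def by blast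
  ultimately show ?thesis by (intro temperature_decaying[OF assms(1)])
qed

lemma linearized_volume_decaying:
  assumes rad: "decaying k r0 radius y" and B: "decaying k r0 B y" and lin: "linearized u p0 q0 y Y"
  shows "decaying k r0 (2 * (B / 32 + 3 * c ^ 4 * \<delta>)) (\<lambda>r. fst (Y r))"
proof -
  note y = admissible_if_decaying_radius[OF rad]
  note forcing = forcing_decaying[OF rad B linearized_temperature_decaying[OF y lin, folded comp_def]]
  obtain C where "decaying k r0 C Y" using lin unfolding linearized_def by blast
  note bounded = decaying_weaken_0[OF decaying_fst[OF this] r0_pos]
  have eq: "deriv_from r0 (\<lambda>r. fst (Y r))
      (\<lambda>r. - (\<beta> * r ^ Suc k / mass_flux u y) * (fst (Y r) - forcing u y (snd \<circ> Y) r))"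
    using lin unfolding linearized_def by blast
  have "\<bar>fst (Y r0)\<bar> \<le> 2 * (B / 32 + 3 * c ^ 4 * \<delta>) / r0 ^ k" if "0 < mass_flux u y"
    using that lin boundary_volume_le[OF _ decaying_const_nonneg[OF B r0_pos]] mass_flux_pos_iff[OF y]
    unfolding linearized_def by simp
  then show ?thesis
    by (rule relaxation_decaying[OF r0_pos \<beta>_pos mass_flux_nonzero[OF y u(1)]
        relaxation_rate_small[OF y] forcing eq _ bounded])
qed

lemma linearized_exists:
  assumes rad: "decaying k r0 radius y" and B: "decaying k r0 B y"
  obtains Y where "linearized u p0 q0 y Y" "decaying k r0 (B / 2 + 8 * c ^ 4 * \<delta>) Y"
proof -
  note y = admissible_if_decaying_radius[OF rad]
  obtain Q E where Q: "Q r0 = q0" "deriv_from r0 Q (\<lambda>r. (u * heat_source u y r - E) / (kappa * r ^ Suc k))"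
    "(Q \<longlongrightarrow> 0) at_top"
    using heat_equation_exists[OF heat_source_decaying[OF y] r0_pos k_pos kappa_pos] by metis
  note Q_decay = temperature_decaying[OF y Q(1,3,2)]
  obtain P where P: "deriv_from r0 P (\<lambda>r. - (\<beta> * r ^ Suc k / mass_flux u y) * (P r - forcing u y Q r))"
    "0 < mass_flux u y \<longrightarrow> P r0 = p0" "decaying k r0 (2 * (B / 32 + 3 * c ^ 4 * \<delta>)) P"
    using relaxation_exists[OF r0_pos \<beta>_pos mass_flux_nonzero[OF y u(1)] relaxation_rate_small[OF y]
        forcing_decaying[OF rad B Q_decay]]
      boundary_volume_le[OF _ decaying_const_nonneg[OF B r0_pos]] mass_flux_pos_iff[OF y] by metis
  define Y where "Y r = (P r, Q r)" for r
  have decay: "decaying k r0 (B / 2 + 8 * c ^ 4 * \<delta>) Y"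
    using Q_decay P(3) decaying_const_nonneg[OF B r0_pos] by (intro state_decaying) (simp_all add: Y_def)
  moreover have "snd \<circ> Y = Q" by (simp add: Y_def o_def)
  then have "linearized u p0 q0 y Y"
    unfolding linearized_def using decay P(1,2) Q(1,2) mass_flux_pos_iff[OF y] by (auto simp: Y_def)
  ultimately show ?thesis using that by blast
qed

lemma linearized_temperature_contraction:
  assumes y: "admissible y" "admissible y'" and lin: "linearized u p0 q0 y Y" "linearized u p0 q0 y' Y'"
    and D: "decaying k r0 D (\<lambda>r. y r - y' r)"
  shows "decaying k r0 (c\<^sup>2 * \<delta> * D) (\<lambda>r. snd (Y r) - snd (Y' r))"
proof -
  have D0: "0 \<le> D" by (rule decaying_const_nonneg[OF D r0_pos])
  obtain E E' where
    eq: "deriv_from r0 (\<lambda>r. snd (Y r)) (\<lambda>r. (u * heat_source u y r - E) / (kappa * r ^ Suc k))"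
      "deriv_from r0 (\<lambda>r. snd (Y' r)) (\<lambda>r. (u * heat_source u y' r - E') / (kappa * r ^ Suc k))"
    and init: "snd (Y r0) = snd (Y' r0)"
    using lin unfolding linearized_def by metis
  have lim: "((\<lambda>r. snd (Y r) - snd (Y' r)) \<longlongrightarrow> 0) at_top"
    using linearized_temperature_decaying[OF y(1) lin(1)] linearized_temperature_decaying[OF y(2) lin(2)]
    by (rule decaying_tendsto_0[OF decaying_diff k_pos])
  have "deriv_from r0 (\<lambda>r. snd (Y r) - snd (Y' r))
      (\<lambda>r. (u * (heat_source u y r - heat_source u y' r) - (E - E')) / (kappa * r ^ Suc k))"
    using deriv_from_diff[OF eq] by (rule deriv_from_cong) (simp_all add: right_diff_distrib flip: diff_divide_distrib)
  from heat_equation_decaying[OF decaying_cmult[OF lipschitz_boundD(2)[OF bound_heat_source abs_u_le_1 y D]]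
      r0_pos k_pos kappa_pos this lim]
  have "decaying k r0 (2 / (kappa * k) * (\<bar>u\<bar> * (c * D))) (\<lambda>r. snd (Y r) - snd (Y' r))" by (simp add: init)
  moreover have "2 / (kappa * k) * (\<bar>u\<bar> * (c * D)) \<le> c * (\<delta> * (c * D))"
    using c_ge_conductivity u c_pos kappa_pos D0 by (intro mult_mono) auto
  moreover have "\<dots> = c\<^sup>2 * \<delta> * D" by (simp add: power2_eq_square mult_ac)
  ultimately show ?thesis using r0_pos by (metis decaying_mono)
qed

lemma quadratic_forcing_contraction:
  assumes rad: "decaying k r0 radius y" "decaying k r0 radius y'" and D: "decaying k r0 D (\<lambda>r. y r - y' r)"
  shows "decaying k r0 (3 / 32 * D) (\<lambda>r. quadratic_forcing y r - quadratic_forcing y' r)"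
proof -
  note y = rad[THEN admissible_if_decaying_radius]
  have p: "decaying k r0 radius (\<lambda>r. fst (y r))" "decaying k r0 radius (\<lambda>r. fst (y' r))"
    "decaying k r0 D (\<lambda>r. fst (y r) - fst (y' r))"
    using rad[THEN decaying_fst] decaying_fst[OF D] by simp_all
  note s = lipschitz_boundD(1)[OF bound_inverse_vol abs_u_le_1 y(2)]
    lipschitz_boundD(2)[OF bound_inverse_vol abs_u_le_1 y D]
  note square = decaying_mult[OF decaying_0_if_decaying[OF p(1)] p(1)]
    decaying_mult_diff[OF decaying_0_if_decaying[OF p(1)] p(2) decaying_0_if_decaying[OF p(3)] p(3)]
  note bound = decaying_mult_diff[OF square(1) s(1) square(2) s(2),
    unfolded add_0 add_0_right, folded quadratic_forcing_def]
  have "c * radius * radius * (c * D) + (c * radius * D + c * D * radius) * c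
      = (c * c * radius) * (radius + 2) * D" by (simp add: algebra_simps)
  also have "\<dots> \<le> 3 / 32 * D"
    unfolding c_radius(1) using c_radius(3) decaying_const_nonneg[OF D r0_pos] by (intro mult_right_mono) auto
  finally show ?thesis by (rule decaying_mono[OF bound _ r0_pos])
qed

lemma thermal_forcing_contraction:
  assumes y: "admissible y" "admissible y'" and D: "decaying k r0 D (\<lambda>r. y r - y' r)"
    and Q: "decaying k r0 (2 * c\<^sup>2 * \<delta>) Q" "decaying k r0 (c\<^sup>2 * \<delta> * D) (\<lambda>r. Q r - Q' r)"
  shows "decaying k r0 (3 * (c ^ 4 * \<delta>) * D) (\<lambda>r. thermal_forcing y Q r - thermal_forcing y' Q' r)"
proof -
  note s = lipschitz_boundD(1)[OF bound_inverse_vol abs_u_le_1 y(2)]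
    lipschitz_boundD(2)[OF bound_inverse_vol abs_u_le_1 y D]
  note bound = decaying_cmult[OF decaying_mult_diff[OF Q(1) s(1) Q(2) s(2), unfolded add_0_right], of "vp\<^sup>2 / tp"]
  have "\<bar>vp\<^sup>2 / tp\<bar> * (2 * c\<^sup>2 * \<delta> * (c * D) + c\<^sup>2 * \<delta> * D * c)
      \<le> c * (2 * c\<^sup>2 * \<delta> * (c * D) + c\<^sup>2 * \<delta> * D * c)"
    using c_ge_thermal tp_pos c_pos \<delta>_pos decaying_const_nonneg[OF D r0_pos] by (intro mult_right_mono) auto
  also have "\<dots> = 3 * (c ^ 4 * \<delta>) * D" by (simp add: power2_eq_square power4_eq_xxxx algebra_simps)
  finally have "decaying k r0 (3 * (c ^ 4 * \<delta>) * D) (\<lambda>r. vp\<^sup>2 / tp * (Q r * (1 / vol y r) - Q' r * (1 / vol y' r)))"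
    by (rule decaying_mono[OF bound _ r0_pos])
  then show ?thesis by (simp add: thermal_forcing_def right_diff_distrib)
qed

lemma inertial_forcing_contraction:
  assumes y: "admissible y" "admissible y'" and D: "decaying k r0 D (\<lambda>r. y r - y' r)"
  shows "decaying k r0 (c\<^sup>2 * \<delta> * D) (\<lambda>r. inertial_forcing u y r - inertial_forcing u y' r)"
  using decaying_inertial_factor[OF lipschitz_boundD(2)[OF bound_inertia abs_u_le_1 y D]
      decaying_const_nonneg[OF D r0_pos]]
  by (simp add: inertial_forcing_def right_diff_distrib)

lemma forcing_contraction:
  assumes rad: "decaying k r0 radius y" "decaying k r0 radius y'" and D: "decaying k r0 D (\<lambda>r. y r - y' r)"
    and Q: "decaying k r0 (2 * c\<^sup>2 * \<delta>) Q" "decaying k r0 (c\<^sup>2 * \<delta> * D) (\<lambda>r. Q r - Q' r)"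
  shows "decaying k r0 (13 / 128 * D) (\<lambda>r. forcing u y Q r - forcing u y' Q' r)"
proof -
  note y = rad[THEN admissible_if_decaying_radius]
  have "3 / 32 * D + 3 * (c ^ 4 * \<delta>) * D + c\<^sup>2 * \<delta> * D \<le> 3 / 32 * D + 3 * (1 / 512) * D + 1 / 512 * D"
    using c_power_\<delta>[of 4] c_power_\<delta>[of 2] decaying_const_nonneg[OF D r0_pos]
    by (intro add_mono mult_right_mono mult_left_mono order_refl) auto
  then have "decaying k r0 (13 / 128 * D) (\<lambda>r. quadratic_forcing y r - quadratic_forcing y' r
      + (thermal_forcing y Q r - thermal_forcing y' Q' r) + (inertial_forcing u y r - inertial_forcing u y' r))"
    by (intro decaying_mono[OF decaying_add[OF decaying_add[OF quadratic_forcing_contraction[OF rad D]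
            thermal_forcing_contraction[OF y D Q]] inertial_forcing_contraction[OF y D]] _ r0_pos]) simp
  then show ?thesis by (simp add: forcing_def add_diff_add)
qed

text \<open>The two mass fluxes differ; the relative difference of the relaxation rates is absorbed into the forcing.\<close>

lemma linearized_volume_difference:
  assumes y: "admissible y" "admissible y'" and lin: "linearized u p0 q0 y Y" "linearized u p0 q0 y' Y'"
  defines "\<epsilon> \<equiv> (fst (y r0) - fst (y' r0)) * (1 / vol y r0)"
  shows "deriv_from r0 (\<lambda>r. fst (Y r) - fst (Y' r)) (\<lambda>r. - (\<beta> * r ^ Suc k / mass_flux u y) *
    ((fst (Y r) - fst (Y' r)) - ((forcing u y (snd \<circ> Y) r - forcing u y' (snd \<circ> Y') r)
      - \<epsilon> * (fst (Y' r) - forcing u y' (snd \<circ> Y') r))))"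
proof -
  have "1 - \<epsilon> = vol y' r0 / vol y r0"
    using admissible_bounds(3)[OF y(1), of r0] by (simp add: \<epsilon>_def vol_def field_simps)
  then have rate: "b / mass_flux u y' = b / mass_flux u y * (1 - \<epsilon>)" for b
    using admissible_bounds(3)[OF y(1), of r0] admissible_bounds(3)[OF y(2), of r0]
    by (simp add: mass_flux_def unit_mass_flux_def)
  have eq: "deriv_from r0 (\<lambda>r. fst (Y r))
      (\<lambda>r. - (\<beta> * r ^ Suc k / mass_flux u y) * (fst (Y r) - forcing u y (snd \<circ> Y) r))"
    "deriv_from r0 (\<lambda>r. fst (Y' r))
      (\<lambda>r. - (\<beta> * r ^ Suc k / mass_flux u y * (1 - \<epsilon>)) * (fst (Y' r) - forcing u y' (snd \<circ> Y') r))"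
    using lin unfolding linearized_def rate by blast+
  have identity: "- x * (p - g) - - (x * (1 - e)) * (p' - g') = - x * ((p - p') - ((g - g') - e * (p' - g')))"
    for x p g e p' g' :: real by (simp add: algebra_simps)
  show ?thesis
    using deriv_from_diff[OF eq] unfolding identity .
qed

lemma mass_flux_defect_decaying:
  assumes rad: "decaying k r0 radius y" "decaying k r0 radius y'" and lin: "linearized u p0 q0 y' Y'"
    and D: "decaying k r0 D (\<lambda>r. y r - y' r)"
  defines "\<epsilon> \<equiv> (fst (y r0) - fst (y' r0)) * (1 / vol y r0)"
  shows "decaying k r0 (21 / 1024 * D) (\<lambda>r. \<epsilon> * (fst (Y' r) - forcing u y' (snd \<circ> Y') r))"
proof -
  note y = rad[THEN admissible_if_decaying_radius]
  let ?X = "2 * (radius / 32 + 3 * c ^ 4 * \<delta>) + (radius / 32 + 3 * c ^ 4 * \<delta>)"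
  have D0: "0 \<le> D" by (rule decaying_const_nonneg[OF D r0_pos])
  have bound: "decaying k r0 (\<bar>\<epsilon>\<bar> * ?X) (\<lambda>r. \<epsilon> * (fst (Y' r) - forcing u y' (snd \<circ> Y') r))"
    using linearized_volume_decaying[OF rad(2,2) lin]
      forcing_decaying[OF rad(2,2) linearized_temperature_decaying[OF y(2) lin, folded comp_def]]
    by (intro decaying_cmult decaying_diff)
  have "\<bar>\<epsilon>\<bar> \<le> c * D * c"
    using decaying_norm_le[OF decaying_0_if_decaying[OF decaying_fst[OF D]], of r0]
      decaying_norm_le[OF lipschitz_boundD(1)[OF bound_inverse_vol abs_u_le_1 y(1)], of r0] c_pos D0
    unfolding \<epsilon>_def abs_mult by (intro mult_mono) auto
  then have "\<bar>\<epsilon>\<bar> * ?X \<le> c * D * c * ?X"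
    using radius_pos c_pos \<delta>_pos by (intro mult_right_mono) auto
  also have "\<dots> = (3 / 32 * (c * c * radius) + 9 * (c ^ 6 * \<delta>)) * D"
    by (simp add: eval_nat_numeral algebra_simps)
  also have "\<dots> \<le> 21 / 1024 * D"
    unfolding c_radius(1) using c_power_\<delta>[of 6] D0 by (intro mult_right_mono) linarith+
  finally show ?thesis by (rule decaying_mono[OF bound _ r0_pos])
qed

lemma linearized_volume_contraction:
  assumes rad: "decaying k r0 radius y" "decaying k r0 radius y'"
    and lin: "linearized u p0 q0 y Y" "linearized u p0 q0 y' Y'" and D: "decaying k r0 D (\<lambda>r. y r - y' r)"
  shows "decaying k r0 (D / 4) (\<lambda>r. fst (Y r) - fst (Y' r))"
proof -
  note y = rad[THEN admissible_if_decaying_radius]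
  note volume_difference = linearized_volume_difference[OF y lin]
  have D0: "0 \<le> D" by (rule decaying_const_nonneg[OF D r0_pos])
  have "decaying k r0 (2 * c\<^sup>2 * \<delta>) (snd \<circ> Y)" "decaying k r0 (c\<^sup>2 * \<delta> * D) (\<lambda>r. (snd \<circ> Y) r - (snd \<circ> Y') r)"
    using linearized_temperature_decaying[OF y(1) lin(1)] linearized_temperature_contraction[OF y lin D]
    by (simp_all add: o_def)
  note decaying_diff[OF forcing_contraction[OF rad D this] mass_flux_defect_decaying[OF rad lin(2) D]]
  note forcing = decaying_mono[OF this _ r0_pos, of "D / 8"]
  obtain B B' where "decaying k r0 B Y" "decaying k r0 B' Y'" using lin unfolding linearized_def by blast
  note bounded = decaying_weaken_0[OF decaying_diff[OF this[THEN decaying_fst]] r0_pos]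
  have "\<bar>fst (Y r0) - fst (Y' r0)\<bar> \<le> 2 * (D / 8) / r0 ^ k" if "0 < mass_flux u y"
    using that lin mass_flux_pos_iff[OF y(1)] D0 r0_pos unfolding linearized_def by simp
  from relaxation_decaying[OF r0_pos \<beta>_pos mass_flux_nonzero[OF y(1) u(1)] relaxation_rate_small[OF y(1)] forcing
      volume_difference this bounded]
  show ?thesis using D0 by simp
qed

lemma linearized_contraction:
  assumes rad: "decaying k r0 radius y" "decaying k r0 radius y'"
    and lin: "linearized u p0 q0 y Y" "linearized u p0 q0 y' Y'" and D: "decaying k r0 D (\<lambda>r. y r - y' r)"
  shows "decaying k r0 (D / 2) (\<lambda>r. Y r - Y' r)"
proof -
  note y = rad[THEN admissible_if_decaying_radius]
  have "c\<^sup>2 * \<delta> * D \<le> D / 4"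
    using mult_right_mono[OF c_power_\<delta>[of 2] decaying_const_nonneg[OF D r0_pos]]
      decaying_const_nonneg[OF D r0_pos] by simp
  with linearized_temperature_contraction[OF y lin D]
  have "decaying k r0 (D / 4) (\<lambda>r. snd (Y r) - snd (Y' r))" using r0_pos by (rule decaying_mono)
  then show ?thesis
    using decaying_Pair[of k r0 "D / 4" "\<lambda>r. Y r - Y' r" "D / 4"] linearized_volume_contraction[OF assms] by simp
qed

lemma solution_radius_le: "16 * c ^ 4 * \<delta> \<le> radius"
proof -
  have "(16 * c ^ 4 * \<delta>) * (32 * c\<^sup>2) = 512 * c ^ 6 * \<delta>" by (simp add: eval_nat_numeral)
  then have "(16 * c ^ 4 * \<delta>) * (32 * c\<^sup>2) \<le> 1" using small by (simp only:)
  then show ?thesis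
    unfolding radius_def by (intro iffD2[OF pos_le_divide_eq]) (use c_pos in simp_all)
qed

theorem fixed_point_exists:
  obtains y where "decaying k r0 (16 * c ^ 4 * \<delta>) y" "linearized u p0 q0 y y"
proof (rule decaying_contraction_fixed_point[OF r0_pos, of "16 * c ^ 4 * \<delta>" k "linearized u p0 q0"])
  have rad: "decaying k r0 radius y" if "decaying k r0 (16 * c ^ 4 * \<delta>) y" for y :: "real \<Rightarrow> real \<times> real"
    by (rule decaying_mono[OF that solution_radius_le r0_pos])
  show "0 \<le> 16 * c ^ 4 * \<delta>" using c_pos \<delta>_pos by simp
  fix y :: "real \<Rightarrow> real \<times> real" assume y: "decaying k r0 (16 * c ^ 4 * \<delta>) y"
  have "16 * c ^ 4 * \<delta> / 2 + 8 * c ^ 4 * \<delta> = 16 * c ^ 4 * \<delta>" by simp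
  then show "\<exists>Y. decaying k r0 (16 * c ^ 4 * \<delta>) Y \<and> linearized u p0 q0 y Y"
    using linearized_exists[OF rad[OF y] y] by metis
  fix y' Y Y' :: "real \<Rightarrow> real \<times> real" and D
  assume "decaying k r0 (16 * c ^ 4 * \<delta>) y'" "linearized u p0 q0 y Y" "linearized u p0 q0 y' Y'"
    "decaying k r0 D (\<lambda>r. y r - y' r)"
  then show "decaying k r0 (D / 2) (\<lambda>r. Y r - Y' r)"
    by (intro linearized_contraction[OF rad[OF y] rad])
qed (rule linearized_cong)

theorem fixed_point_unique:
  assumes "decaying k r0 radius y" "decaying k r0 radius y'"
    "linearized u p0 q0 y y" "linearized u p0 q0 y' y'" "r0 \<le> r"
  shows "y r = y' r"
  using decaying_eq_if_difference_contracts[OF r0_pos linearized_contraction[OF assms(1-4)] assms(1,2,5)] .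

end

section \<open>Existence and uniqueness of decaying flows\<close>

lemma abs_inverse_diff_le:
  fixes x v e :: real
  assumes "0 < x" "0 < v" "\<bar>x - 1 / v\<bar> \<le> e" "e \<le> 1 / (2 * v)"
  shows "\<bar>1 / x - v\<bar> \<le> 2 * v\<^sup>2 * e"
proof -
  have "1 / v = 1 / (2 * v) + 1 / (2 * v)" using assms(2) by (simp add: field_simps)
  then have "1 / (2 * v) \<le> x" using assms(3,4) by linarith
  then have inverse: "1 / x \<le> 2 * v" using assms by (simp add: field_simps)
  have "1 / x - v = - ((x - 1 / v) * (v * (1 / x)))" using assms by (simp add: field_simps)
  then have "\<bar>1 / x - v\<bar> = \<bar>x - 1 / v\<bar> * (v * (1 / x))"
    using assms by (simp add: abs_mult)
  also have "\<dots> \<le> e * (v * (2 * v))" using assms inverse by (intro mult_mono) auto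
  finally show ?thesis by (simp add: power2_eq_square mult_ac)
qed

context gas
begin

lemma gas_bounds_exists: "\<exists>c. gas_bounds k r0 cV R nu lam kappa vp tp c"
proof -
  obtain c1 c2 c3 c4 where c: "lipschitz_bound 0 c1 heat_source" "lipschitz_bound k c2 (\<lambda>u y. inertia y)"
    "lipschitz_bound 0 c3 (\<lambda>u y r. 1 / vol y r)" "lipschitz_bound 0 c4 (\<lambda>u y r. unit_mass_flux y)"
    using lipschitz_decay_heat_source lipschitz_decay_inertia lipschitz_decay_inverse_vol
      lipschitz_decay_unit_mass_flux unfolding lipschitz_decay_def by metis
  define c where "c = Max {1, r0 ^ k, 1 / r0 ^ k, 2 / (kappa * k), vp\<^sup>2 / tp, vp\<^sup>2 / (R * tp),
    2 * real k / (\<beta> * r0 ^ (k + 2)), 2 / min vp tp, 2 * vp, 2 * vp\<^sup>2, 2 / vp\<^sup>2, 3 * r0 ^ Suc k, 3 / r0 ^ Suc k,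
    c1, c2, c3, c4}"
  have "gas_bounds k r0 cV R nu lam kappa vp tp c"
    by unfold_locales (auto intro!: Max_ge lipschitz_bound_mono[OF c(1)] lipschitz_bound_mono[OF c(2)]
        lipschitz_bound_mono[OF c(3)] lipschitz_bound_mono[OF c(4)] simp: c_def simp del: Max_insert)
  then show ?thesis by blast
qed

definition state :: "(real \<Rightarrow> real) \<Rightarrow> (real \<Rightarrow> real) \<Rightarrow> real \<Rightarrow> real \<times> real" where
  "state rho th r = (1 / rho r - vp, th r - tp)"

lemma vol_state: "vol (state rho th) r = 1 / rho r" and temp_state: "temp (state rho th) r = th r"
  by (simp_all add: vol_def temp_def state_def)

lemma vol_decaying:
  assumes "admissible y"
  shows "decaying 0 r0 (vp + min vp tp / 2) (vol y)"
  using decaying_add[OF decaying_const[of r0 vp] decaying_fst[OF assms]] vp_pos by (simp add: vol_def[abs_def])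

lemma abs_inverse_vol_diff_le:
  assumes "admissible y" "r0 \<le> r"
  shows "\<bar>1 / vol y r - 1 / vp\<bar> \<le> 2 / vp\<^sup>2 * \<bar>fst (y r)\<bar>"
proof -
  note v = admissible_bounds[OF assms]
  have "1 / vol y r - 1 / vp = - (1 / (vp * vol y r) * fst (y r))"
    using v(3) vp_pos by (simp add: vol_def field_simps)
  then have "\<bar>1 / vol y r - 1 / vp\<bar> = 1 / (vp * vol y r) * \<bar>fst (y r)\<bar>"
    using v(3) vp_pos by (simp add: abs_mult)
  also have "\<dots> \<le> 1 / (vp * (vp / 2)) * \<bar>fst (y r)\<bar>"
    using v(1,3) vp_pos by (intro mult_right_mono divide_left_mono mult_left_mono) auto
  finally show ?thesis by (simp add: power2_eq_square)
qed

lemma velocity_bounds: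
  assumes y: "admissible y" and r: "r0 \<le> r"
  shows "\<bar>u\<bar> * (r0 ^ Suc k / 3) * \<sigma> r \<le> \<bar>mass_flux u y * vol y r * \<sigma> r\<bar>"
    "\<bar>mass_flux u y * vol y r * \<sigma> r\<bar> \<le> \<bar>u\<bar> * (3 * r0 ^ Suc k) * \<sigma> r"
proof -
  note v = admissible_bounds[OF assms] admissible_bounds[OF y order_refl]
  have "0 < \<sigma> r" using r r0_pos by (simp add: \<sigma>_def)
  have eq: "\<bar>mass_flux u y * vol y r * \<sigma> r\<bar> = \<bar>u\<bar> * (r0 ^ Suc k * (vol y r / vol y r0)) * \<sigma> r"
    using v r0_pos \<open>0 < \<sigma> r\<close> by (simp add: mass_flux_def unit_mass_flux_def abs_mult)
  have ratio: "1 / 3 \<le> vol y r / vol y r0" "vol y r / vol y r0 \<le> 3"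
    using v by (simp_all add: field_simps)
  show "\<bar>u\<bar> * (r0 ^ Suc k / 3) * \<sigma> r \<le> \<bar>mass_flux u y * vol y r * \<sigma> r\<bar>"
    unfolding eq using mult_left_mono[OF ratio(1), of "r0 ^ Suc k"] r0_pos \<open>0 < \<sigma> r\<close>
    by (intro mult_right_mono mult_left_mono) auto
  show "\<bar>mass_flux u y * vol y r * \<sigma> r\<bar> \<le> \<bar>u\<bar> * (3 * r0 ^ Suc k) * \<sigma> r"
    unfolding eq using mult_left_mono[OF ratio(2), of "r0 ^ Suc k"] r0_pos \<open>0 < \<sigma> r\<close>
    by (intro mult_right_mono mult_left_mono) auto
qed

lemma boundary_velocity: "admissible y \<Longrightarrow> mass_flux u y * vol y r0 * \<sigma> r0 = u"
  using admissible_bounds(3)[of y r0] r0_pos by (simp add: mass_flux_def unit_mass_flux_def \<sigma>_def)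

lemma stationary_flow_of_fixed_point:
  assumes y: "admissible y" and u: "u \<noteq> 0" and fixed: "linearized u p0 q0 y y"
  shows "stationary_flow (\<lambda>r. 1 / vol y r) (\<lambda>r. mass_flux u y * vol y r * \<sigma> r) (temp y)"
proof -
  obtain B where "decaying k r0 B y" and sys: "first_order_system (mass_flux u y) (vol y) (temp y)"
    using fixed unfolding linearized_self_iff[OF y] by blast
  then have lim: "((\<lambda>r. fst (y r)) \<longlongrightarrow> 0) at_top" "((\<lambda>r. snd (y r)) \<longlongrightarrow> 0) at_top"
    using decaying_tendsto_0[OF decaying_fst k_pos] decaying_tendsto_0[OF decaying_snd k_pos] by blast+
  show ?thesis
  proof (rule stationary_if_first_order_system[OF sys mass_flux_nonzero[OF y u] _ vol_decaying[OF y]])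
    show "(vol y \<longlongrightarrow> vp) at_top" "(temp y \<longlongrightarrow> tp) at_top"
      using tendsto_add[OF tendsto_const lim(1), of vp] tendsto_add[OF tendsto_const lim(2), of tp]
      by (simp_all add: vol_def[abs_def] temp_def[abs_def])
  qed (use admissible_bounds[OF y] in auto)
qed

lemma fixed_point_of_stationary_flow:
  assumes flow: "stationary_flow rho u th" and y: "admissible (state rho th)"
    and decay: "decaying k r0 B (state rho th)"
    and u0: "u r0 \<noteq> 0"
  shows "linearized (u r0) (1 / rho r0 - vp) (th r0 - tp) (state rho th) (state rho th)"
    "r0 \<le> r \<Longrightarrow> u r = mass_flux (u r0) (state rho th) * (1 / rho r) * \<sigma> r"
proof -
  have M: "mass_flux (u r0) (state rho th) = r0 ^ Suc k * rho r0 * u r0"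
    by (simp add: mass_flux_def unit_mass_flux_def vol_state)
  have vol: "vol (state rho th) = (\<lambda>r. 1 / rho r)" "temp (state rho th) = th" by (auto simp: vol_state temp_state)
  have "first_order_system (r0 ^ Suc k * rho r0 * u r0) (\<lambda>r. 1 / rho r) th"
    by (rule first_order_system_if_stationary[OF flow u0 vol_decaying[OF y, unfolded vol]])
  then show "linearized (u r0) (1 / rho r0 - vp) (th r0 - tp) (state rho th) (state rho th)"
    unfolding linearized_self_iff[OF y] M vol using decay by (auto simp: state_def)
  show "r0 \<le> r \<Longrightarrow> u r = mass_flux (u r0) (state rho th) * (1 / rho r) * \<sigma> r"
    unfolding M by (rule stationary_flow_velocity[OF flow])
qed

definition decaying_flow ::
  "real \<Rightarrow> real \<Rightarrow> real \<Rightarrow> real \<Rightarrow> real \<Rightarrow> (real \<Rightarrow> real) \<Rightarrow> (real \<Rightarrow> real) \<Rightarrow> (real \<Rightarrow> real) \<Rightarrow> bool" where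
  "decaying_flow C S rho_m u_m th_m rho u th \<longleftrightarrow> stationary_flow rho u th \<and>
     (0 < u_m \<longrightarrow> rho r0 = rho_m) \<and> u r0 = u_m \<and> th r0 = th_m \<and>
     (\<forall>r\<ge>r0. \<bar>rho r - 1 / vp\<bar> \<le> C / r ^ k * S \<and> \<bar>th r - tp\<bar> \<le> C / r ^ k * S \<and>
        \<bar>u_m\<bar> / (C * r ^ Suc k) \<le> \<bar>u r\<bar> \<and> \<bar>u r\<bar> \<le> C / r ^ Suc k * \<bar>u_m\<bar>)"

end

context gas_bounds
begin

lemma deviation_bounds:
  assumes y: "admissible y" and decay: "decaying k r0 (16 * c ^ 5 * S) y" and r: "r0 \<le> r"
  shows "\<bar>1 / vol y r - 1 / vp\<bar> \<le> 16 * c ^ 6 / r ^ k * S" "\<bar>temp y r - tp\<bar> \<le> 16 * c ^ 6 / r ^ k * S"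
proof -
  have eq: "c * (16 * c ^ 5 * S / r ^ k) = 16 * c ^ 6 / r ^ k * S" by (simp add: eval_nat_numeral)
  have "\<bar>1 / vol y r - 1 / vp\<bar> \<le> 2 / vp\<^sup>2 * \<bar>fst (y r)\<bar>" by (rule abs_inverse_vol_diff_le[OF y r])
  also have "\<dots> \<le> c * (16 * c ^ 5 * S / r ^ k)"
    using c_ge_inverse_vp_square c_pos decaying_norm_le[OF decaying_fst[OF decay] r] by (intro mult_mono) auto
  finally show "\<bar>1 / vol y r - 1 / vp\<bar> \<le> 16 * c ^ 6 / r ^ k * S" unfolding eq .
  have "\<bar>temp y r - tp\<bar> = \<bar>snd (y r)\<bar>" by (simp add: temp_def)
  also have "\<dots> \<le> 1 * (16 * c ^ 5 * S / r ^ k)" using decaying_norm_le[OF decaying_snd[OF decay] r] by simp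
  also have "\<dots> \<le> c * (16 * c ^ 5 * S / r ^ k)"
    using c_ge_1 decaying_const_nonneg[OF decay r0_pos] r r0_pos by (intro mult_right_mono) auto
  finally show "\<bar>temp y r - tp\<bar> \<le> 16 * c ^ 6 / r ^ k * S" unfolding eq .
qed

lemma velocity_decay:
  assumes y: "admissible y" and r: "r0 \<le> r"
  shows "\<bar>u\<bar> / (16 * c ^ 6 * r ^ Suc k) \<le> \<bar>mass_flux u y * vol y r * \<sigma> r\<bar>"
    "\<bar>mass_flux u y * vol y r * \<sigma> r\<bar> \<le> 16 * c ^ 6 / r ^ Suc k * \<bar>u\<bar>"
proof -
  have \<sigma>: "0 \<le> \<sigma> r" using r r0_pos by (simp add: \<sigma>_def)
  have c_le: "c \<le> 16 * c ^ 6" using c_power_mono[of 1 6] c_pos by simp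
  have "1 = 3 / r0 ^ Suc k * (r0 ^ Suc k / 3)" using r0_pos by simp
  also have "\<dots> \<le> 16 * c ^ 6 * (r0 ^ Suc k / 3)"
    using c_ge_inverse_area c_le r0_pos by (intro mult_right_mono) auto
  finally have "1 / (16 * c ^ 6) \<le> r0 ^ Suc k / 3" using c_pos by (simp add: pos_divide_le_eq mult.commute)
  then have "\<bar>u\<bar> * (1 / (16 * c ^ 6)) * \<sigma> r \<le> \<bar>u\<bar> * (r0 ^ Suc k / 3) * \<sigma> r"
    using \<sigma> by (intro mult_right_mono mult_left_mono) auto
  also have "\<dots> \<le> \<bar>mass_flux u y * vol y r * \<sigma> r\<bar>" by (rule velocity_bounds[OF y r])
  finally show "\<bar>u\<bar> / (16 * c ^ 6 * r ^ Suc k) \<le> \<bar>mass_flux u y * vol y r * \<sigma> r\<bar>" by (simp add: \<sigma>_def)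
  have "\<bar>mass_flux u y * vol y r * \<sigma> r\<bar> \<le> \<bar>u\<bar> * (3 * r0 ^ Suc k) * \<sigma> r" by (rule velocity_bounds[OF y r])
  also have "\<dots> \<le> \<bar>u\<bar> * (16 * c ^ 6) * \<sigma> r"
    using c_ge_area c_le \<sigma> by (intro mult_right_mono mult_left_mono) auto
  finally show "\<bar>mass_flux u y * vol y r * \<sigma> r\<bar> \<le> 16 * c ^ 6 / r ^ Suc k * \<bar>u\<bar>" by (simp add: \<sigma>_def mult_ac)
qed

lemma volume_deviation_of_density:
  assumes x: "0 < x" "\<bar>x - 1 / vp\<bar> \<le> 16 * c ^ 6 / r ^ k * S" and S: "0 \<le> S" "1024 * c ^ 9 * S \<le> 1" and r: "r0 \<le> r"
  shows "\<bar>1 / x - vp\<bar> \<le> 16 * c ^ 7 * S / r ^ k"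
proof -
  let ?e = "16 * c ^ 6 / r ^ k * S"
  have "1 / r ^ k \<le> 1 / r0 ^ k" using r r0_pos by (intro divide_left_mono power_mono) auto
  also note c_ge_inverse_r0_power
  finally have "16 * c ^ 6 * S * (1 / r ^ k) \<le> 16 * c ^ 6 * S * c" using S(1) c_pos by (intro mult_left_mono) auto
  then have "?e \<le> 16 * c ^ 6 * S * c" by simp
  then have "?e * (2 * vp) \<le> 16 * c ^ 6 * S * c * c"
    by (rule mult_mono[OF _ c_ge_vp]) (use S(1) c_pos vp_pos in auto)
  also have "\<dots> = 16 * c ^ 8 * S" by (simp add: eval_nat_numeral)
  also have "\<dots> \<le> 1024 * c ^ 9 * S" using c_power_mono[of 8 9] c_pos S(1) by (intro mult_mono) auto
  also note S(2)
  finally have "?e \<le> 1 / (2 * vp)"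
    using vp_pos by (simp only: pos_le_divide_eq zero_less_mult_iff zero_less_numeral simp_thms)
  then have "\<bar>1 / x - vp\<bar> \<le> 2 * vp\<^sup>2 * ?e" by (rule abs_inverse_diff_le[OF x(1) vp_pos x(2)])
  also have "\<dots> \<le> c * ?e" using c_ge_vp_square S(1) c_pos r r0_pos by (intro mult_right_mono) auto
  also have "\<dots> = 16 * c ^ 7 * S / r ^ k" by (simp add: eval_nat_numeral)
  finally show ?thesis .
qed

end

context small_data
begin

lemma stationary_flow_unique:
  assumes flow: "stationary_flow rho w th" "stationary_flow rho' w' th'"
    and decay: "decaying k r0 radius (state rho th)" "decaying k r0 radius (state rho' th')"
    and boundary: "w r0 = u" "th r0 = tp + q0" "0 < u \<Longrightarrow> rho r0 = 1 / (vp + p0)"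
      "w' r0 = u" "th' r0 = tp + q0" "0 < u \<Longrightarrow> rho' r0 = 1 / (vp + p0)"
    and r: "r0 \<le> r"
  shows "rho' r = rho r \<and> w' r = w r \<and> th' r = th r"
proof -
  note y = decay[THEN admissible_if_decaying_radius]
  have "linearized u p0 q0 (state rho th) (state rho th)" "linearized u p0 q0 (state rho' th') (state rho' th')"
    using fixed_point_of_stationary_flow(1)[OF flow(1) y(1) decay(1)]
      fixed_point_of_stationary_flow(1)[OF flow(2) y(2) decay(2)]
      boundary u(1) unfolding linearized_def by simp_all
  note eq = fixed_point_unique[OF decay this]
  have rho: "rho r = rho' r" "th r = th' r" if "r0 \<le> r" for r
    using eq[OF that] by (auto simp: state_def inverse_eq_divide[symmetric])
  moreover have "w r = w' r"
    using fixed_point_of_stationary_flow(2)[OF flow(1) y(1) decay(1) _ r]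
      fixed_point_of_stationary_flow(2)[OF flow(2) y(2) decay(2) _ r]
      boundary u(1) rho[OF r] rho[OF order_refl]
    by (simp add: mass_flux_def unit_mass_flux_def vol_state)
  ultimately show ?thesis using r by simp
qed

lemma decaying_flow_exists:
  assumes S: "\<delta> = c * S"
  shows "\<exists>rho w th. decaying_flow (16 * c ^ 6) S (1 / (vp + p0)) u (tp + q0) rho w th"
proof -
  obtain y where decay: "decaying k r0 (16 * c ^ 4 * \<delta>) y" and fixed: "linearized u p0 q0 y y"
    by (rule fixed_point_exists)
  have y: "admissible y"
    by (rule admissible_if_decaying_radius[OF decaying_mono[OF decay solution_radius_le r0_pos]])
  have "decaying k r0 (16 * c ^ 5 * S) y" using decay by (simp add: S eval_nat_numeral mult_ac)
  then have "decaying_flow (16 * c ^ 6) S (1 / (vp + p0)) u (tp + q0)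
      (\<lambda>r. 1 / vol y r) (\<lambda>r. mass_flux u y * vol y r * \<sigma> r) (temp y)"
    unfolding decaying_flow_def
    using stationary_flow_of_fixed_point[OF y u(1) fixed] fixed deviation_bounds[OF y] velocity_decay[OF y]
      boundary_velocity[OF y]
    by (auto simp: linearized_def vol_def temp_def)
  then show ?thesis by blast
qed

end

context gas_bounds
begin

lemma decaying_flow_state_decaying:
  assumes flow: "decaying_flow (16 * c ^ 6) S rho_m u_m th_m rho u th" and S: "0 \<le> S" "1024 * c ^ 9 * S \<le> 1"
  shows "decaying k r0 radius (state rho th)"
proof -
  have stationary: "stationary_flow rho u th" using flow unfolding decaying_flow_def by blast
  then have rho_pos: "0 < rho r" if "r0 \<le> r" for r using that unfolding stationary_flow_iff by blast
  have cont: "continuous_on {r0..} rho" "continuous_on {r0..} th"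
    using stationary[unfolded stationary_flow_iff] C_infty_on_imp_C_k_on[of "{r0..}" _ 0] by auto
  have bound: "decaying k r0 (16 * c ^ 7 * S + 16 * c ^ 7 * S) (state rho th)"
  proof (intro decaying_Pair decayingI)
    show "continuous_on {r0..} (\<lambda>r. fst (state rho th r))" "continuous_on {r0..} (\<lambda>r. snd (state rho th r))"
      unfolding state_def fst_conv snd_conv using rho_pos
      by (auto intro!: continuous_intros cont simp: less_imp_neq[symmetric])
    fix r assume r: "r0 \<le> r"
    then show "norm (fst (state rho th r)) \<le> 16 * c ^ 7 * S / r ^ k"
      using volume_deviation_of_density[OF rho_pos[OF r] _ S r] flow by (simp add: decaying_flow_def state_def)
    have "\<bar>th r - tp\<bar> \<le> 16 * c ^ 6 * S / r ^ k" using flow r by (auto simp: decaying_flow_def)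
    also have "\<dots> \<le> 16 * c ^ 7 * S / r ^ k"
      using c_power_mono[of 6 7] S(1) r r0_pos by (intro divide_right_mono mult_right_mono) auto
    finally show "norm (snd (state rho th r)) \<le> 16 * c ^ 7 * S / r ^ k" by (simp add: state_def)
  qed
  have "(16 * c ^ 7 * S + 16 * c ^ 7 * S) * (32 * c\<^sup>2) = 1024 * c ^ 9 * S" by (simp add: eval_nat_numeral)
  then have "(16 * c ^ 7 * S + 16 * c ^ 7 * S) * (32 * c\<^sup>2) \<le> 1" using S(2) by (simp only:)
  then have "16 * c ^ 7 * S + 16 * c ^ 7 * S \<le> radius"
    unfolding radius_def by (intro iffD2[OF pos_le_divide_eq]) (use c_pos in simp_all)
  then show ?thesis by (rule decaying_mono[OF bound _ r0_pos])
qed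

theorem decaying_flow_exists_unique:
  assumes u_m: "u_m \<noteq> 0" "\<bar>u_m\<bar> \<le> S" and th_m: "\<bar>th_m - tp\<bar> \<le> S"
    and rho_m: "0 < u_m \<Longrightarrow> 0 < rho_m \<and> \<bar>rho_m - 1 / vp\<bar> \<le> S" and S_le: "S \<le> 1 / (1024 * c ^ 9)"
  shows "\<exists>rho u th. decaying_flow (16 * c ^ 6) S rho_m u_m th_m rho u th \<and>
    (\<forall>rho' u' th'. decaying_flow (16 * c ^ 6) S rho_m u_m th_m rho' u' th' \<longrightarrow>
      (\<forall>r\<ge>r0. rho' r = rho r \<and> u' r = u r \<and> th' r = th r))"
proof -
  define p0 where "p0 = (if 0 < u_m then 1 / rho_m - vp else 0)"
  have S0: "0 < S" using u_m by linarith
  have S: "1024 * c ^ 9 * S \<le> 1" using S_le c_pos by (simp add: pos_le_divide_eq mult.commute)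
  have S_small: "c ^ i * S \<le> 1 / 1024" if "i \<le> 9" for i
    using mult_right_mono[OF c_power_mono[OF that], of S] S S0 by linarith
  have "S \<le> c * S" using mult_right_mono[OF c_ge_1, of S] S0 by simp
  moreover have "\<bar>p0\<bar> \<le> c * S" if "0 < u_m"
  proof -
    have "S * (2 * vp) \<le> S * c" using c_ge_vp S0 by (intro mult_left_mono) auto
    then have "S \<le> 1 / (2 * vp)" using S_small[of 1] vp_pos by (simp add: pos_le_divide_eq mult.commute)
    then have "\<bar>1 / rho_m - vp\<bar> \<le> 2 * vp\<^sup>2 * S" using rho_m[OF that] vp_pos by (intro abs_inverse_diff_le) auto
    also have "\<dots> \<le> c * S" using c_ge_vp_square S0 by (intro mult_right_mono) auto
    finally show ?thesis using that by (simp add: p0_def)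
  qed
  ultimately interpret small_data k r0 cV R nu lam kappa vp tp c "c * S" u_m p0 "th_m - tp"
    using u_m th_m S_small[of 7] by unfold_locales (auto simp: eval_nat_numeral mult_ac)
  have inflow: "1 / (vp + p0) = rho_m" if "0 < u_m" using that by (simp add: p0_def)
  obtain rho u th where flow: "decaying_flow (16 * c ^ 6) S (1 / (vp + p0)) u_m (tp + (th_m - tp)) rho u th"
    using decaying_flow_exists[OF refl] by blast
  then have flow: "decaying_flow (16 * c ^ 6) S rho_m u_m th_m rho u th"
    using inflow by (simp add: decaying_flow_def)
  moreover have "rho' r = rho r \<and> u' r = u r \<and> th' r = th r"
    if flow': "decaying_flow (16 * c ^ 6) S rho_m u_m th_m rho' u' th'" and r: "r0 \<le> r" for rho' u' th' r
  proof (rule stationary_flow_unique[OF _ _ _ _ _ _ _ _ _ _ r])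
    show "decaying k r0 radius (state rho th)" "decaying k r0 radius (state rho' th')"
      using decaying_flow_state_decaying[OF flow] decaying_flow_state_decaying[OF flow'] S S0 by auto
  qed (use flow flow' inflow in \<open>auto simp: decaying_flow_def\<close>)
  ultimately show ?thesis by blast
qed

end

theorem theorem1p1:
  fixes n :: nat and r0 cV R nu lam kappa rho_p theta_p :: real
  assumes "n \<ge> 3" and "r0 > 0" and "cV > 0" and "R > 0" and "nu > 0"
    and "2 * nu + real n * lam \<ge> 0" and "kappa > 0" and "2 * nu + lam > 0"
    and "rho_p > 0" and "theta_p > 0"
  shows "\<exists>eps0 > 0. \<exists>C > 0.
    (\<forall>rho_m u_m theta_m. u_m > 0 \<and> rho_m > 0 \<and> theta_m > 0 \<and>
        \<bar>u_m\<bar> + \<bar>rho_m - rho_p\<bar> + \<bar>theta_m - theta_p\<bar> \<le> eps0 \<longrightarrow>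
      (\<exists>rho u theta.
         (stationary_sol n r0 cV R nu lam kappa rho_p 0 theta_p rho u theta \<and>
          rho r0 = rho_m \<and> u r0 = u_m \<and> theta r0 = theta_m \<and>
          (\<forall>r\<ge>r0.
             \<bar>rho r - rho_p\<bar> \<le> C / r^(n-2) * (\<bar>u_m\<bar> + \<bar>rho_m - rho_p\<bar> + \<bar>theta_m - theta_p\<bar>) \<and>
             \<bar>theta r - theta_p\<bar> \<le> C / r^(n-2) * (\<bar>u_m\<bar> + \<bar>rho_m - rho_p\<bar> + \<bar>theta_m - theta_p\<bar>) \<and>
             \<bar>u_m\<bar> / (C * r^(n-1)) \<le> \<bar>u r\<bar> \<and> \<bar>u r\<bar> \<le> C / r^(n-1) * \<bar>u_m\<bar>)) \<and>
         (\<forall>rho' u' theta'.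
            (stationary_sol n r0 cV R nu lam kappa rho_p 0 theta_p rho' u' theta' \<and>
             rho' r0 = rho_m \<and> u' r0 = u_m \<and> theta' r0 = theta_m \<and>
             (\<forall>r\<ge>r0.
                \<bar>rho' r - rho_p\<bar> \<le> C / r^(n-2) * (\<bar>u_m\<bar> + \<bar>rho_m - rho_p\<bar> + \<bar>theta_m - theta_p\<bar>) \<and>
                \<bar>theta' r - theta_p\<bar> \<le> C / r^(n-2) * (\<bar>u_m\<bar> + \<bar>rho_m - rho_p\<bar> + \<bar>theta_m - theta_p\<bar>) \<and>
                \<bar>u_m\<bar> / (C * r^(n-1)) \<le> \<bar>u' r\<bar> \<and> \<bar>u' r\<bar> \<le> C / r^(n-1) * \<bar>u_m\<bar>))
            \<longrightarrow> (\<forall>r\<ge>r0. rho' r = rho r \<and> u' r = u r \<and> theta' r = theta r)))) \<and>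
    (\<forall>u_m theta_m. u_m < 0 \<and> theta_m > 0 \<and>
        \<bar>u_m\<bar> + \<bar>theta_m - theta_p\<bar> \<le> eps0 \<longrightarrow>
      (\<exists>rho u theta.
         (stationary_sol n r0 cV R nu lam kappa rho_p 0 theta_p rho u theta \<and>
          u r0 = u_m \<and> theta r0 = theta_m \<and>
          (\<forall>r\<ge>r0.
             \<bar>rho r - rho_p\<bar> \<le> C / r^(n-2) * (\<bar>u_m\<bar> + \<bar>theta_m - theta_p\<bar>) \<and>
             \<bar>theta r - theta_p\<bar> \<le> C / r^(n-2) * (\<bar>u_m\<bar> + \<bar>theta_m - theta_p\<bar>) \<and>
             \<bar>u_m\<bar> / (C * r^(n-1)) \<le> \<bar>u r\<bar> \<and> \<bar>u r\<bar> \<le> C / r^(n-1) * \<bar>u_m\<bar>)) \<and>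
         (\<forall>rho' u' theta'.
            (stationary_sol n r0 cV R nu lam kappa rho_p 0 theta_p rho' u' theta' \<and>
             u' r0 = u_m \<and> theta' r0 = theta_m \<and>
             (\<forall>r\<ge>r0.
                \<bar>rho' r - rho_p\<bar> \<le> C / r^(n-2) * (\<bar>u_m\<bar> + \<bar>theta_m - theta_p\<bar>) \<and>
                \<bar>theta' r - theta_p\<bar> \<le> C / r^(n-2) * (\<bar>u_m\<bar> + \<bar>theta_m - theta_p\<bar>) \<and>
                \<bar>u_m\<bar> / (C * r^(n-1)) \<le> \<bar>u' r\<bar> \<and> \<bar>u' r\<bar> \<le> C / r^(n-1) * \<bar>u_m\<bar>))
            \<longrightarrow> (\<forall>r\<ge>r0. rho' r = rho r \<and> u' r = u r \<and> theta' r = theta r))))"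
proof -
  obtain k where n: "n = k + 2" using le_Suc_ex[of 2 n] assms(1) by auto
  interpret gas k r0 cV R nu lam kappa "1 / rho_p" theta_p
    by unfold_locales (use assms n in auto)
  obtain c where "gas_bounds k r0 cV R nu lam kappa (1 / rho_p) theta_p c"
    using gas_bounds_exists by blast
  then interpret gas_bounds k r0 cV R nu lam kappa "1 / rho_p" theta_p c .
  have pos: "0 < 1 / (1024 * c ^ 9)" "0 < 16 * c ^ 6" using c_pos by simp_all
  have exponents: "k + 2 - 2 = k" "k + 2 - 1 = Suc k" and rho_p: "1 / (1 / rho_p) = rho_p" by auto
  note flow = decaying_flow_exists_unique[unfolded decaying_flow_def rho_p]
  show ?thesis
    unfolding n exponents
  proof (rule exI[of _ "1 / (1024 * c ^ 9)"], rule conjI[OF pos(1)], rule exI[of _ "16 * c ^ 6"],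
      rule conjI[OF pos(2)], intro conjI allI impI, goal_cases)
    case (1 rho_m u_m theta_m)
    then have inflow: "(0 < u_m \<longrightarrow> P) = P" for P by simp
    show ?case
      by (rule flow[where u_m = u_m and S = "\<bar>u_m\<bar> + \<bar>rho_m - rho_p\<bar> + \<bar>theta_m - theta_p\<bar>",
          unfolded inflow]) (use 1 in auto)
  next
    case (2 u_m theta_m)
    then have outflow: "(0 < u_m \<longrightarrow> P) = True" for P by simp
    show ?case
      by (rule flow[where u_m = u_m and S = "\<bar>u_m\<bar> + \<bar>theta_m - theta_p\<bar>", unfolded outflow simp_thms]) (use 2 in auto)
  qed
qed

end
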